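(* For every $\varepsilon>0$ there exist $C=C(\varepsilon)>0$ and $\beta=\beta(\varepsilon)>0$ such that the following holds. Let $p=p(n)\ge C\cdot\frac{\ln n}{n}$, let $v\in[n]$, let $G\sim G(n,p)$, and let $L=(1+\varepsilon)n\ln n$. Then with high probability $G$ is such that, with high probability (over the walk), the trace $\Gamma^v_L(G)$ of a simple random walk of length $L$ on $G$ starting at $v$ is Hamiltonian and $(\beta\ln n)$-vertex-connected.
   Context: $G(n,p)$ is the Erdős–Rényi random graph on vertex set $[n]=\{1,\dots,n\}$ where each edge is present independently with probability $p$. A simple random walk on $G$ starting at $v$ is the sequence $X_0=v$, and for each $i\ge 0$, $X_{i+1}$ is a uniformly random neighbour of $X_i$ (chosen independently of the past). The trace $\Gamma^v_L(G)$ is the (multi)graph on vertex set $[n]$ whose edges are the edges $\{X_{i-1},X_i\}$, $1\le i\le L$, traversed by the walk, counted with multiplicity. Hamiltonicity and vertex-connectivity of a multigraph refer to its underlying simple graph. "With high probability" means with probability tending to $1$ as $n\to\infty$. *)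

theory Defs
  imports "HOL-Probability.Probability" "HOL-Library.Multiset"
begin

text \<open>
  An undirected graph is given by an explicit vertex set \<open>V\<close> together with a set \<open>E\<close> of edges,
  an edge being a two-element set of vertices.  A multigraph has a multiset of edges instead;
  a singleton \<open>{x}\<close> in it stands for a loop at \<open>x\<close>.
\<close>

subsection \<open>Graph properties\<close>

definition simple_edges :: "'a set multiset \<Rightarrow> 'a set set" where
  "simple_edges M = {e \<in> set_mset M. card e = 2}"

definition graph_connected :: "'a set \<Rightarrow> 'a set set \<Rightarrow> bool" where
  "graph_connected V E \<longleftrightarrow>
     (\<forall>x\<in>V. \<forall>y\<in>V. (x, y) \<in> {(a, b). a \<in> V \<and> b \<in> V \<and> {a, b} \<in> E}\<^sup>*)"

text \<open>
  The graph \<open>G - S\<close> needs no restriction of \<open>E\<close>: \<^const>\<open>graph_connected\<close> only uses edges inside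
  the given vertex set.
\<close>

definition vertex_connected :: "nat \<Rightarrow> 'a set \<Rightarrow> 'a set set \<Rightarrow> bool" where
  "vertex_connected k V E \<longleftrightarrow>
     k < card V \<and> (\<forall>S\<subseteq>V. finite S \<and> card S < k \<longrightarrow> graph_connected (V - S) E)"

definition hamiltonian :: "'a set \<Rightarrow> 'a set set \<Rightarrow> bool" where
  "hamiltonian V E \<longleftrightarrow>
     (\<exists>c. distinct c \<and> set c = V \<and> 3 \<le> length c \<and>
          (\<forall>i<length c. {c ! i, c ! (Suc i mod length c)} \<in> E))"

subsection \<open>The random graph \<open>G(n,p)\<close>\<close>

definition all_edges :: "nat \<Rightarrow> nat set set" where
  "all_edges n = {e. e \<subseteq> {1..n} \<and> card e = 2}"

text \<open>
  The random edge set of \<open>G(n,p)\<close>, for \<open>p \<in> [0,1]\<close> (\<^const>\<open>bernoulli_pmf\<close> truncates other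
  values of \<open>p\<close> to this interval).
\<close>

definition gnp :: "nat \<Rightarrow> real \<Rightarrow> nat set set pmf" where
  "gnp n p = map_pmf (\<lambda>f. {e \<in> all_edges n. f e})
               (Pi_pmf (all_edges n) False (\<lambda>_. bernoulli_pmf p))"

subsection \<open>Simple random walk and its trace\<close>

definition neighbours :: "nat set set \<Rightarrow> nat \<Rightarrow> nat set" where
  "neighbours E x = {y. y \<noteq> x \<and> {x, y} \<in> E}"

text \<open>
  A simple random walk has no next step at an isolated vertex; by convention it then stays put.
  This happens only if the starting vertex itself is isolated.
\<close>

definition walk_step :: "nat set set \<Rightarrow> nat \<Rightarrow> nat pmf" where
  "walk_step E x =
     (if neighbours E x = {} then return_pmf x else pmf_of_set (neighbours E x))"

text \<open>The distribution of \<open>[X\<^sub>0, X\<^sub>1, \<dots>, X\<^sub>L]\<close>, a list of length \<open>L + 1\<close>.\<close>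

primrec random_walk :: "nat set set \<Rightarrow> nat \<Rightarrow> nat \<Rightarrow> nat list pmf" where
  "random_walk E v 0 = return_pmf [v]"
| "random_walk E v (Suc L) =
     bind_pmf (random_walk E v L) (\<lambda>xs. map_pmf (\<lambda>y. xs @ [y]) (walk_step E (last xs)))"

definition walk_trace :: "nat list \<Rightarrow> nat set multiset" where
  "walk_trace xs = {# {xs ! (i - 1), xs ! i}. i \<in># mset_set {1..<length xs} #}"

definition trace_dist :: "nat set set \<Rightarrow> nat \<Rightarrow> nat \<Rightarrow> nat set multiset pmf" where
  "trace_dist E v L = map_pmf walk_trace (random_walk E v L)"

end

theory Submission
  imports Defs "HOL-Real_Asymp.Real_Asymp"
begin

text \<open>
  The graph is never exposed before the walk: one works with the annealed law of the walk,
  averaged over the graph. Given a path so far, the weight of a graph is \<open>1\<close> over a product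
  of degrees, so inserting or deleting one edge \<open>xy\<close> changes it only by a factor close to \<open>1\<close> as long as
  \<open>x\<close> and \<open>y\<close> have been visited much less often than their degree. Resampling that edge shows that the
  annealed walk moves to each vertex other than the current one with conditional probability at least
  \<open>(1 - \<kappa>) / n\<close>, where \<open>\<kappa>\<close> is as small as we like once \<open>C\<close> is large. The required bound \<open>O(ln n)\<close>
  on the number of visits comes from a Green function estimate, which for a fixed graph
  follows from edge expansion by Cheeger's inequality.

  Any walk with such transition probabilities, however adaptive, is handled by exponential
  supermartingales: within \<open>(1 + \<epsilon>/2) n ln n\<close> steps it visits every vertex of order \<open>ln n\<close> times, its trace
  is then a strong vertex expander (hence highly connected), and by Posa rotations each
  later pair of steps lengthens a longest path or closes a Hamilton cycle with probability bounded below.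
\<close>

section \<open>Adaptive walks and supermartingales\<close>

text \<open>Two scales are kept apart. The Cheeger and Green function constants are crude, but they
  only have to give \<open>O(ln n)\<close> visits per vertex; the sharp factor
  \<open>1 + \<epsilon>\<close> in the length comes entirely from the transition bound
  \<open>(1 - \<kappa>) / n\<close>. Over \<open>n ln n\<close> steps the Green function is not
  bounded, hence a killing rate of \<open>1 / n\<close>; undoing it costs a fixed power of
  \<open>n\<close>, which a large multiple of \<open>ln n\<close> visits pays for. The obstacle is
  that the transition bound holds only along histories with few visits and a small posterior
  probability of irregular degrees, while the supermartingales want it at every history. So the
  kernel follows the annealed law at good histories and is uniform at all others: it then satisfies
  the bound everywhere, and the path laws differ by at most the probability of ever meeting a bad
  history. Randomness never has to be set aside for the Hamilton cycle: the kernel may depend on the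
  whole past, so the steps made after the trace has become an expander are still spread over all
  vertices. The annealed failure probability is the mean of the quenched one, so Markov's inequality
  yields both layers of "with high probability".\<close>

primrec adaptive_walk :: "('a list \<Rightarrow> 'a pmf) \<Rightarrow> 'a \<Rightarrow> nat \<Rightarrow> 'a list pmf" where
  "adaptive_walk Q v 0 = return_pmf [v]"
| "adaptive_walk Q v (Suc t) =
     bind_pmf (adaptive_walk Q v t) (\<lambda>xs. map_pmf (\<lambda>y. xs @ [y]) (Q xs))"

lemma random_walk_adaptive:
  "random_walk E v t = adaptive_walk (\<lambda>xs. walk_step E (last xs)) v t"
  by (induction t) auto

lemma adaptive_walk_length:
  "xs \<in> set_pmf (adaptive_walk Q v t) \<Longrightarrow> length xs = Suc t"
  by (induction t arbitrary: xs) auto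

lemma nn_integral_adaptive_walk_Suc:
  "(\<integral>\<^sup>+xs. F xs \<partial>adaptive_walk Q v (Suc t)) =
     (\<integral>\<^sup>+xs. (\<integral>\<^sup>+y. F (xs @ [y]) \<partial>Q xs) \<partial>adaptive_walk Q v t)"
  by (simp add: nn_integral_bind_pmf nn_integral_map_pmf)

text \<open>Stated with nonnegative integrals, so that integrability of \<open>\<Phi>\<close> never
  has to be checked; the one-step condition is asked only at histories that occur.\<close>

lemma adaptive_walk_supermartingale:
  fixes \<Phi> :: "'a list \<Rightarrow> real"
  assumes "\<And>t xs. t < T \<Longrightarrow> xs \<in> set_pmf (adaptive_walk Q v t) \<Longrightarrow>
             (\<integral>\<^sup>+y. ennreal (\<Phi> (xs @ [y])) \<partial>Q xs) \<le> ennreal (\<Phi> xs)"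
  shows "(\<integral>\<^sup>+xs. ennreal (\<Phi> xs) \<partial>adaptive_walk Q v T) \<le> ennreal (\<Phi> [v])"
  using assms
proof (induction T)
  case (Suc t)
  have "(\<integral>\<^sup>+xs. ennreal (\<Phi> xs) \<partial>adaptive_walk Q v (Suc t)) =
     (\<integral>\<^sup>+xs. (\<integral>\<^sup>+y. ennreal (\<Phi> (xs @ [y])) \<partial>Q xs) \<partial>adaptive_walk Q v t)"
    by (rule nn_integral_adaptive_walk_Suc)
  also have "\<dots> \<le> (\<integral>\<^sup>+xs. ennreal (\<Phi> xs) \<partial>adaptive_walk Q v t)"
    using Suc.prems[of t] by (intro nn_integral_mono_AE) (auto simp: AE_measure_pmf_iff)
  also have "\<dots> \<le> ennreal (\<Phi> [v])" by (rule Suc.IH) (rule Suc.prems, simp_all)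
  finally show ?case .
qed auto

lemma pmf_markov:
  fixes F :: "'a \<Rightarrow> real"
  assumes "(\<integral>\<^sup>+x. ennreal (F x) \<partial>measure_pmf M) \<le> ennreal B" "0 \<le> B" "0 < c"
    and "\<And>x. x \<in> set_pmf M \<Longrightarrow> P x \<Longrightarrow> c \<le> F x"
  shows "measure_pmf.prob M {x. P x} \<le> B / c"
proof -
  have "ennreal c * emeasure M {x. P x} = (\<integral>\<^sup>+x. ennreal c * indicator {x. P x} x \<partial>M)"
    by (simp add: nn_integral_cmult)
  also have "\<dots> \<le> (\<integral>\<^sup>+x. ennreal (F x) \<partial>M)"
    using assms(4) by (intro nn_integral_mono_AE)
      (auto simp: AE_measure_pmf_iff indicator_def intro!: ennreal_leI)
  also have "\<dots> \<le> ennreal B" by fact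
  finally have "ennreal (c * measure_pmf.prob M {x. P x}) \<le> ennreal B"
    using \<open>0 < c\<close> by (simp add: measure_pmf.emeasure_eq_measure ennreal_mult)
  then have "c * measure_pmf.prob M {x. P x} \<le> B" using assms by simp
  then show ?thesis using assms by (simp add: field_simps)
qed

lemma adaptive_walk_tail:
  fixes \<Phi> :: "'a list \<Rightarrow> real"
  assumes "\<And>t xs. t < T \<Longrightarrow> xs \<in> set_pmf (adaptive_walk Q v t) \<Longrightarrow>
             (\<integral>\<^sup>+y. ennreal (\<Phi> (xs @ [y])) \<partial>Q xs) \<le> ennreal (\<Phi> xs)"
    and "0 \<le> \<Phi> [v]" "0 < c"
    and "\<And>xs. length xs = Suc T \<Longrightarrow> P xs \<Longrightarrow> c \<le> \<Phi> xs"
  shows "measure_pmf.prob (adaptive_walk Q v T) {xs. P xs} \<le> \<Phi> [v] / c"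
  by (rule pmf_markov[OF adaptive_walk_supermartingale])
     (use assms adaptive_walk_length in \<open>fastforce+\<close>)

lemma map_take_adaptive_walk:
  "map_pmf (take (Suc t)) (adaptive_walk Q v (t + j)) = adaptive_walk Q v t"
proof (induction j)
  case 0
  have "map_pmf (take (Suc t)) (adaptive_walk Q v t) = map_pmf id (adaptive_walk Q v t)"
    by (rule map_pmf_cong) (auto dest: adaptive_walk_length)
  then show ?case by simp
next
  case (Suc j)
  have "map_pmf (take (Suc t)) (adaptive_walk Q v (t + Suc j)) =
     bind_pmf (adaptive_walk Q v (t + j))
       (\<lambda>xs. map_pmf (\<lambda>y. take (Suc t) (xs @ [y])) (Q xs))"
    by (simp add: map_bind_pmf map_pmf_comp)
  also have "\<dots> = bind_pmf (adaptive_walk Q v (t + j)) (\<lambda>xs. return_pmf (take (Suc t) xs))"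
    by (rule bind_pmf_cong) (auto dest!: adaptive_walk_length)
  finally show ?case using Suc by (simp add: map_pmf_def)
qed

text \<open>The one-step estimates for spread kernels all have this shape: a trivial bound
  \<open>B\<close>, improved to \<open>A\<close> on an event of probability at least
  \<open>w\<close>. With \<open>W = {}\<close> and \<open>A = B\<close> it is a plain upper
  bound.\<close>

lemma nn_integral_two_values:
  fixes f :: "'a \<Rightarrow> real"
  assumes "\<And>y. y \<in> set_pmf q \<Longrightarrow> f y \<le> B" "\<And>y. y \<in> W \<Longrightarrow> f y \<le> A" "A \<le> B" "0 \<le> A"
    and "w \<le> measure_pmf.prob q W"
  shows "(\<integral>\<^sup>+y. ennreal (f y) \<partial>q) \<le> ennreal (B - (B - A) * w)"
proof -
  have "(\<integral>\<^sup>+y. ennreal (f y) \<partial>q) \<le> (\<integral>\<^sup>+y. ennreal (B - (B - A) * indicator W y) \<partial>q)"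
    using assms by (intro nn_integral_mono_AE)
      (auto simp: AE_measure_pmf_iff indicator_def intro!: ennreal_leI)
  also have "\<dots> = ennreal (measure_pmf.expectation q (\<lambda>y. B - (B - A) * indicator W y))"
    by (rule nn_integral_eq_integral)
       (use assms in \<open>auto intro!: measure_pmf.integrable_const_bound[where B=B] simp: indicator_def\<close>)
  also have "measure_pmf.expectation q (\<lambda>y. B - (B - A) * indicator W y) =
      B - (B - A) * measure_pmf.prob q W"
    by (subst Bochner_Integration.integral_diff)
      (auto intro!: integrable_mult_right measure_pmf.integrable_const_bound[where B=1])
  also have "ennreal \<dots> \<le> ennreal (B - (B - A) * w)"
    using assms by (intro ennreal_leI diff_left_mono mult_left_mono) auto
  finally show ?thesis .
qed

lemma prob_ge_card:
  assumes "finite W" "\<And>y. y \<in> W \<Longrightarrow> r \<le> pmf q y"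
  shows "real (card W) * r \<le> measure_pmf.prob q W"
  using sum_mono[of W "\<lambda>_. r" "pmf q"] assms by (simp add: measure_measure_pmf_finite)

text \<open>The current vertex is left out because a walk without loops gives it no mass. The bound
  is imposed at every list, reachable or not, so that it can be used inside any
  supermartingale.\<close>

definition spread_kernel :: "nat \<Rightarrow> real \<Rightarrow> (nat list \<Rightarrow> nat pmf) \<Rightarrow> bool" where
  "spread_kernel n r Q \<longleftrightarrow> (\<forall>xs. \<forall>y\<in>{1..n} - {last xs}. r \<le> pmf (Q xs) y)"

text \<open>A factor \<open>s\<close> per visit and \<open>1 / c\<close> per step balance: a step
  from another vertex hits \<open>u\<close> with probability at least \<open>r\<close> and then
  contributes \<open>2 * s\<close>, so its mean factor is at most
  \<open>1 - r * (1 - 2 * s) = c\<close>. For small \<open>s\<close> the decay per step is close to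
  \<open>r\<close>, which preserves the constant in the length of the walk, and
  \<open>(1 / s) ^ k\<close> is only a small power of \<open>n\<close> when \<open>k\<close> is a
  small multiple of \<open>ln n\<close>.\<close>

lemma visits_tail:
  assumes Q: "spread_kernel n r Q" and u: "u \<in> {1..n}"
    and s: "0 < s" "s \<le> 1/2" and r: "0 \<le> r" "r \<le> 1/2"
  shows "measure_pmf.prob (adaptive_walk Q v T) {xs. count_list xs u \<le> k}
           \<le> 2 * (1 / s) ^ k * (1 - r * (1 - 2 * s)) ^ T"
proof -
  define c where "c = 1 - r * (1 - 2 * s)"
  have "r * (1 - 2 * s) \<le> 1/2 * 1" using s r by (intro mult_mono) auto
  then have c: "1/2 \<le> c" "c \<le> 1" using s r by (auto simp: c_def)
  \<comment> \<open>The factor 2 pays for the step taken at \<open>u\<close> itself, which cannot visit \<open>u\<close>.\<close>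
  define \<Phi> where "\<Phi> xs = s ^ count_list xs u * (if last xs = u then 2 else 1) * (1 / c) ^ length xs"
    for xs :: "nat list"
  have "measure_pmf.prob (adaptive_walk Q v T) {xs. count_list xs u \<le> k} \<le> \<Phi> [v] / (s ^ k * (1 / c) ^ Suc T)"
  proof (rule adaptive_walk_tail)
    fix t xs assume "xs \<in> set_pmf (adaptive_walk Q v t)"
    define X where "X = s ^ count_list xs u * (1 / c) ^ length xs"
    have X0: "0 \<le> X" using s c by (simp add: X_def)
    have \<Phi>xs: "\<Phi> xs = X * (if last xs = u then 2 else 1)" by (simp add: \<Phi>_def X_def)
    have st: "\<Phi> (xs @ [y]) = X / c * (if y = u then 2 * s else 1)" for y
      by (simp add: \<Phi>_def X_def)
    have Xc: "0 \<le> X / c" using X0 c by simp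
    show "(\<integral>\<^sup>+y. ennreal (\<Phi> (xs @ [y])) \<partial>Q xs) \<le> ennreal (\<Phi> xs)"
    proof (cases "last xs = u")
      case True
      have "(\<integral>\<^sup>+y. ennreal (\<Phi> (xs @ [y])) \<partial>Q xs) \<le> ennreal (X / c - (X / c - X / c) * 0)"
      proof (rule nn_integral_two_values)
        fix y show "\<Phi> (xs @ [y]) \<le> X / c" 
          unfolding st using s Xc by (intro mult_left_le) auto
      qed (use Xc in auto)
      also have "\<dots> \<le> ennreal (\<Phi> xs)"
        unfolding \<Phi>xs using X0 c True mult_left_mono[of "1/2" c X]
        by (intro ennreal_leI) (auto simp: field_simps)
      finally show ?thesis .
    next
      case False
      have "(\<integral>\<^sup>+y. ennreal (\<Phi> (xs @ [y])) \<partial>Q xs) \<le> ennreal (X / c - (X / c - X / c * (2 * s)) * r)"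
      proof (rule nn_integral_two_values[where W="{u}"])
        fix y show "\<Phi> (xs @ [y]) \<le> X / c" 
          unfolding st using s Xc by (intro mult_left_le) auto
        show "X / c * (2 * s) \<le> X / c" "0 \<le> X / c * (2 * s)"
          using s Xc by (auto intro!: mult_left_le simp del: times_divide_eq_left)
        show "r \<le> measure_pmf.prob (Q xs) {u}"
          using Q u False by (auto simp: spread_kernel_def measure_pmf_single)
      next
        fix y assume "y \<in> {u}" then show "\<Phi> (xs @ [y]) \<le> X / c * (2 * s)" unfolding st by simp
      qed
      also have "X / c - (X / c - X / c * (2 * s)) * r = X / c * c"
        by (subst (2) c_def) (simp add: algebra_simps)
      finally show ?thesis using False c \<Phi>xs by simp
    qed
  next
    fix xs :: "nat list" assume xs: "length xs = Suc T" "count_list xs u \<le> k"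
    have "s ^ k * (1 / c) ^ Suc T \<le> s ^ count_list xs u * (1 / c) ^ length xs"
      unfolding xs(1) using xs s c by (intro mult_right_mono power_decreasing) auto
    also have "\<dots> \<le> \<Phi> xs" using s c by (auto simp: \<Phi>_def)
    finally show "s ^ k * (1 / c) ^ Suc T \<le> \<Phi> xs" .
  qed (use s c in \<open>auto simp: \<Phi>_def\<close>)
  also have "\<dots> \<le> (2 * (1/c)) / (s ^ k * (1 / c) ^ Suc T)"
    using s c by (intro divide_right_mono) (auto simp: \<Phi>_def intro!: divide_right_mono)
  also have "\<dots> = 2 * (1 / s) ^ k * c ^ T"
    using s c by (simp add: field_simps)
  finally show ?thesis by (simp add: c_def)
qed

section \<open>Expansion of the trace\<close>

text \<open>Only traversals out of \<open>S\<close> are recorded, although entering steps also leave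
  trace edges: the former are choices made at \<open>S\<close>, which the kernel controls.\<close>

definition escapes :: "'a set \<Rightarrow> 'a list \<Rightarrow> 'a set" where
  "escapes S xs = {xs ! Suc i | i. Suc i < length xs \<and> xs ! i \<in> S} - S"

text \<open>Counts all steps that start in \<open>S\<close>, whether or not they leave it;
  \<open>butlast\<close> drops the final position, from which no step has been made.\<close>

definition exits :: "'a set \<Rightarrow> 'a list \<Rightarrow> nat" where
  "exits S xs = length (filter (\<lambda>x. x \<in> S) (butlast xs))"

lemma escapes_singleton [simp]: "escapes S [v] = {}"
  by (auto simp: escapes_def)

lemma exits_singleton [simp]: "exits S [v] = 0"
  by (auto simp: exits_def)

lemma snoc_steps:
  assumes "xs \<noteq> []"
  shows "{f ((xs @ [y]) ! i) ((xs @ [y]) ! Suc i) | i. Suc i < length (xs @ [y]) \<and> P ((xs @ [y]) ! i)} =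
         {f (xs ! i) (xs ! Suc i) | i. Suc i < length xs \<and> P (xs ! i)} \<union> (if P (last xs) then {f (last xs) y} else {})"
    (is "?L = ?R")
proof (intro set_eqI iffI)
  fix z assume "z \<in> ?L"
  then obtain i where i: "z = f ((xs @ [y]) ! i) ((xs @ [y]) ! Suc i)" "Suc i < length (xs @ [y])"
    "P ((xs @ [y]) ! i)" by blast
  show "z \<in> ?R"
  proof (cases "Suc i < length xs")
    case True then show ?thesis using i by (auto simp: nth_append)
  next
    case False
    then have il: "i = length xs - 1" "Suc i = length xs" using i(2) by auto
    then have "(xs @ [y]) ! i = last xs" "(xs @ [y]) ! Suc i = y"
      using assms by (simp_all add: nth_append last_conv_nth)
    then show ?thesis using i by auto
  qed
next
  fix z assume z: "z \<in> ?R"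
  show "z \<in> ?L"
  proof (cases "z \<in> {f (xs ! i) (xs ! Suc i) | i. Suc i < length xs \<and> P (xs ! i)}")
    case True
    then obtain i where "z = f (xs ! i) (xs ! Suc i)" "Suc i < length xs" "P (xs ! i)" by blast
    then show ?thesis by (auto intro!: exI[of _ i] simp: nth_append)
  next
    case False
    with z have "P (last xs)" "z = f (last xs) y" by (auto split: if_splits)
    then show ?thesis using assms
      by (auto intro!: exI[of _ "length xs - 1"] simp: nth_append last_conv_nth)
  qed
qed

lemma escapes_snoc:
  assumes "xs \<noteq> []"
  shows "escapes S (xs @ [y]) = escapes S xs \<union> (if last xs \<in> S then {y} - S else {})"
  using snoc_steps[OF assms, of "\<lambda>a b. b" y "\<lambda>a. a \<in> S"] unfolding escapes_def by auto

lemma exits_snoc: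
  assumes "xs \<noteq> []"
  shows "exits S (xs @ [y]) = exits S xs + (if last xs \<in> S then 1 else 0)"
proof -
  have "exits S (xs @ [y]) = length (filter (\<lambda>x. x \<in> S) (butlast xs @ [last xs]))"
    using assms by (simp add: exits_def)
  then show ?thesis by (simp add: exits_def)
qed

lemma finite_escapes [simp]: "finite (escapes S xs)"
  by (rule finite_subset[of _ "set xs"]) (auto simp: escapes_def)

text \<open>While fewer than \<open>m\<close> vertices have been reached, a step started in
  \<open>S\<close> finds a new one with probability at least \<open>w\<close>, which brings a factor
  \<open>\<theta>\<close>. The mean factor is then at most \<open>a\<close>, compensated by
  \<open>1 / a\<close> per step. The potential is set to 0 once \<open>m\<close> vertices are
  reached, since fresh vertices are not guaranteed any more.\<close>

lemma escape_tail:
  assumes Q: "spread_kernel n r Q" and S: "S \<subseteq> {1..n}"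
    and \<theta>: "0 < \<theta>" "\<theta> \<le> 1" and r: "0 \<le> r" and w: "0 \<le> w" "w \<le> 1" "w \<le> r * (real n - card S - m)"
    and a: "a = 1 - (1 - \<theta>) * w"
  shows "measure_pmf.prob (adaptive_walk Q v T) {xs. card (escapes S xs) < m \<and> N \<le> exits S xs}
           \<le> (1 / \<theta>) ^ m * a ^ N"
proof -
  have "(1 - \<theta>) * w \<le> (1 - \<theta>) * 1" "0 \<le> (1 - \<theta>) * w" 
    using \<theta> w mult_left_mono[of w 1 "1 - \<theta>"] by auto
  then have a0: "0 < a" "a \<le> 1" using \<theta> unfolding a by auto
  define \<Phi> where "\<Phi> xs = (if card (escapes S xs) < m then \<theta> ^ card (escapes S xs) * (1 / a) ^ exits S xs else 0)"
    for xs
  have "measure_pmf.prob (adaptive_walk Q v T) {xs. card (escapes S xs) < m \<and> N \<le> exits S xs}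
         \<le> \<Phi> [v] / (\<theta> ^ m * (1 / a) ^ N)"
  proof (rule adaptive_walk_tail)
    fix t xs assume "xs \<in> set_pmf (adaptive_walk Q v t)"
    then have xs: "xs \<noteq> []" by (auto dest: adaptive_walk_length)
    note snoc = escapes_snoc[OF xs] exits_snoc[OF xs]
    show "(\<integral>\<^sup>+y. ennreal (\<Phi> (xs @ [y])) \<partial>Q xs) \<le> ennreal (\<Phi> xs)"
    proof (cases "last xs \<in> S \<and> card (escapes S xs) < m")
      case False
      have "\<Phi> (xs @ [y]) \<le> \<Phi> xs" for y
      proof (cases "last xs \<in> S")
        case True
        have "card (escapes S xs) \<le> card (escapes S (xs @ [y]))"
          by (rule card_mono) (auto simp: snoc)
        then show ?thesis using False True by (auto simp: \<Phi>_def)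
      qed (auto simp: \<Phi>_def snoc)
      then have "(\<integral>\<^sup>+y. ennreal (\<Phi> (xs @ [y])) \<partial>Q xs) \<le> ennreal (\<Phi> xs - (\<Phi> xs - \<Phi> xs) * 0)"
        using \<theta> a0 by (intro nn_integral_two_values[where W="{}"]) (auto simp: \<Phi>_def)
      then show ?thesis by simp
    next
      case True
      define E where "E = escapes S xs"
      define B where "B = \<theta> ^ card E * (1 / a) ^ Suc (exits S xs)"
      have B0: "0 \<le> B" using \<theta> a0 by (simp add: B_def)
      define W where "W = {1..n} - S - E"
      have fin: "finite S" using S finite_subset by blast
      have "card W \<ge> n - card S - card E"
        unfolding W_def using diff_card_le_card_Diff[of E "{1..n} - S"] S fin
        by (simp add: card_Diff_subset E_def)
      then have "n \<le> card W + card S + m" using True E_def by auto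
      then have cW: "real n - card S - m \<le> card W" by linarith
      have "(\<integral>\<^sup>+y. ennreal (\<Phi> (xs @ [y])) \<partial>Q xs) \<le> ennreal (B - (B - \<theta> * B) * w)"
      proof (rule nn_integral_two_values)
        fix y
        have 1: "exits S (xs @ [y]) = Suc (exits S xs)" using True by (simp add: snoc)
        have "card E \<le> card (escapes S (xs @ [y]))"
          unfolding E_def by (rule card_mono) (auto simp: snoc)
        then have "\<theta> ^ card (escapes S (xs @ [y])) \<le> \<theta> ^ card E"
          using \<theta> by (intro power_decreasing) auto
        then show "\<Phi> (xs @ [y]) \<le> B"
          unfolding \<Phi>_def 1 B_def using \<theta> a0 mult_right_mono[of _ _ "(1 / a) ^ Suc (exits S xs)"]
          by auto
      next
        fix y assume y: "y \<in> W"
        have 1: "exits S (xs @ [y]) = Suc (exits S xs)" using True by (simp add: snoc)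
        have 2: "card (escapes S (xs @ [y])) = Suc (card E)"
        proof -
          have "escapes S (xs @ [y]) = insert y E" using y True by (auto simp: W_def snoc E_def)
          then show ?thesis using y by (simp add: W_def E_def)
        qed
        show "\<Phi> (xs @ [y]) \<le> \<theta> * B"
          using \<theta> a0 by (simp add: \<Phi>_def 1 2 B_def)
      next
        have "w \<le> r * (real n - card S - m)" by fact
        also have "\<dots> \<le> r * card W" using r cW by (intro mult_left_mono) auto
        also have "\<dots> = real (card W) * r" by simp
        also have "\<dots> \<le> measure_pmf.prob (Q xs) W"
          using Q[unfolded spread_kernel_def, rule_format, of _ xs] True
          by (intro prob_ge_card) (auto simp: W_def)
        finally show "w \<le> measure_pmf.prob (Q xs) W" .
      qed (use B0 \<theta> in \<open>auto intro: mult_left_le_one_le\<close>)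
      also have "B - (B - \<theta> * B) * w = B * a" unfolding a by (simp add: algebra_simps)
      also have "\<dots> = \<Phi> xs" using True a0 by (simp add: \<Phi>_def B_def E_def)
      finally show ?thesis .
    qed
  next
    fix xs assume xs: "length xs = Suc T" "card (escapes S xs) < m \<and> N \<le> exits S xs"
    have "\<theta> ^ m \<le> \<theta> ^ card (escapes S xs)" "(1 / a) ^ N \<le> (1 / a) ^ exits S xs"
      using xs \<theta> a0 by (auto intro: power_decreasing power_increasing)
    then show "\<theta> ^ m * (1 / a) ^ N \<le> \<Phi> xs"
      using xs \<theta> a0 mult_mono[of "\<theta> ^ m" _ "(1 / a) ^ N"] by (simp add: \<Phi>_def)
  qed (use \<theta> a0 in \<open>auto simp: \<Phi>_def\<close>)
  also have "\<dots> \<le> 1 / (\<theta> ^ m * (1 / a) ^ N)"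
    using \<theta> a0 by (intro divide_right_mono) (auto simp: \<Phi>_def)
  also have "\<dots> = (1 / \<theta>) ^ m * a ^ N" using \<theta> a0 by (simp add: field_simps)
  finally show ?thesis .
qed

section \<open>Vertex expanders and the edges of the trace\<close>

definition ext_nbrs :: "'a set \<Rightarrow> 'a set set \<Rightarrow> 'a set \<Rightarrow> 'a set" where
  "ext_nbrs V E S = {y \<in> V - S. \<exists>x\<in>S. {x, y} \<in> E}"

text \<open>The factor 3 exceeds the two path neighbours per endpoint that Posa's argument leaves,
  and \<open>k\<close> makes every set that separates a small part have at least \<open>k\<close>
  vertices.\<close>

definition expander :: "nat \<Rightarrow> nat \<Rightarrow> nat set set \<Rightarrow> bool" where
  "expander n k E \<longleftrightarrow> (\<forall>S\<subseteq>{1..n}. S \<noteq> {} \<and> 6 * card S \<le> n \<longrightarrow>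
     max k (3 * card S) \<le> card (ext_nbrs {1..n} E S))"

abbreviation (input) trace_edges :: "nat list \<Rightarrow> nat set set" where
  "trace_edges xs \<equiv> simple_edges (walk_trace xs)"

abbreviation (input) deficient :: "nat \<Rightarrow> nat \<Rightarrow> nat list \<Rightarrow> bool" where
  "deficient n k xs \<equiv>
     \<not> (hamiltonian {1..n} (trace_edges xs) \<and> vertex_connected k {1..n} (trace_edges xs))"

lemma walk_edges_eq:
  "trace_edges xs = {e \<in> {{xs ! i, xs ! Suc i} | i. Suc i < length xs}. card e = 2}"
proof -
  have "(\<lambda>i. {xs ! (i - 1), xs ! i}) ` {1..<length xs} = {{xs ! i, xs ! Suc i} | i. Suc i < length xs}"
  proof (intro set_eqI iffI)
    fix e assume "e \<in> (\<lambda>i. {xs ! (i - 1), xs ! i}) ` {1..<length xs}"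
    then obtain i where "i \<in> {1..<length xs}" "e = {xs ! (i - 1), xs ! i}" by blast
    then show "e \<in> {{xs ! i, xs ! Suc i} | i. Suc i < length xs}"
      by (auto intro!: exI[of _ "i - 1"])
  next
    fix e assume "e \<in> {{xs ! i, xs ! Suc i} | i. Suc i < length xs}"
    then obtain i where "e = {xs ! i, xs ! Suc i}" "Suc i < length xs" by blast
    then show "e \<in> (\<lambda>i. {xs ! (i - 1), xs ! i}) ` {1..<length xs}"
      by (intro image_eqI[of _ _ "Suc i"]) auto
  qed
  then show ?thesis by (simp add: simple_edges_def walk_trace_def)
qed

lemma walk_edges_snoc:
  "xs \<noteq> [] \<Longrightarrow> trace_edges (xs @ [y]) =
     trace_edges xs \<union> (if last xs = y then {} else {{last xs, y}})"
  using snoc_steps[of xs "\<lambda>a b. {a, b}" y "\<lambda>_. True"] unfolding walk_edges_eq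
  by (auto simp: card_2_iff doubleton_eq_iff)

lemma walk_edges_take:
  "trace_edges (take t xs) \<subseteq> trace_edges xs"
  unfolding walk_edges_eq by auto

lemma escapes_subset_ext_nbrs:
  assumes "set xs \<subseteq> V"
  shows "escapes S xs \<subseteq> ext_nbrs V (trace_edges xs) S"
proof
  fix y assume "y \<in> escapes S xs"
  then obtain i where i: "y = xs ! Suc i" "Suc i < length xs" "xs ! i \<in> S" "y \<notin> S"
    by (auto simp: escapes_def)
  then have "{xs ! i, y} \<in> trace_edges xs"
  proof -
    have "card {xs ! i, y} = 2" using i by (intro card_2_iff[THEN iffD2] exI[of _ "xs ! i"] exI[of _ y]) auto
    then show ?thesis using i unfolding walk_edges_eq by blast
  qed
  moreover have "y \<in> V" using i assms nth_mem by blast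
  ultimately show "y \<in> ext_nbrs V (trace_edges xs) S"
    using i by (auto simp: ext_nbrs_def)
qed

lemma length_filter_eq_sum_count:
  "finite S \<Longrightarrow> length (filter (\<lambda>x. x \<in> S) ys) = (\<Sum>u\<in>S. count_list ys u)"
proof (induction ys)
  case (Cons a ys)
  have "(\<Sum>u\<in>S. count_list (a # ys) u) = (\<Sum>u\<in>S. (if a = u then 1 else 0) + count_list ys u)"
    by (intro sum.cong) auto
  also have "\<dots> = (if a \<in> S then 1 else 0) + (\<Sum>u\<in>S. count_list ys u)"
    using Cons.prems by (simp add: sum.distrib)
  finally show ?case using Cons by simp
qed auto

text \<open>A visit at the very end of the list starts no step, so one visit per vertex is given up;
  this is why the bound on the visits is strict.\<close>

lemma exits_ge:
  assumes "finite S" "xs \<noteq> []" "\<And>u. u \<in> S \<Longrightarrow> k < count_list xs u"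
  shows "k * card S \<le> exits S xs"
proof -
  have "k \<le> count_list (butlast xs) u" if "u \<in> S" for u
  proof -
    have "count_list xs u = count_list (butlast xs @ [last xs]) u" using assms by simp
    also have "\<dots> \<le> count_list (butlast xs) u + 1" by (simp del: append_butlast_last_id)
    finally show ?thesis using assms(3)[OF that] by simp
  qed
  then have "(\<Sum>u\<in>S. k) \<le> (\<Sum>u\<in>S. count_list (butlast xs) u)" by (rule sum_mono)
  then show ?thesis
    using length_filter_eq_sum_count[OF assms(1), of "butlast xs"] by (simp add: exits_def mult.commute)
qed

section \<open>Rotations, boosters and connectivity\<close>

fun path_edges :: "'a list \<Rightarrow> 'a set set" where
  "path_edges (x # y # xs) = insert {x, y} (path_edges (y # xs))"
| "path_edges _ = {}"

lemma path_edges_append: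
  "path_edges (xs @ ys) = path_edges xs \<union> path_edges ys \<union>
     (if xs \<noteq> [] \<and> ys \<noteq> [] then {{last xs, hd ys}} else {})"
proof (induction xs rule: path_edges.induct)
  case ("2_2" v) then show ?case by (cases ys) auto
qed auto

lemma path_edges_rev [simp]: "path_edges (rev xs) = path_edges xs"
proof (induction xs rule: path_edges.induct)
  case (1 x y xs)
  have "path_edges (rev (x # y # xs)) = path_edges (rev (y # xs)) \<union> {{y, x}}"
    by (subst rev.simps, subst path_edges_append) (simp add: last_rev)
  then show ?case using 1 by (auto simp: insert_commute)
qed auto

lemma path_edges_subset: "e \<in> path_edges xs \<Longrightarrow> e \<subseteq> set xs"
  by (induction xs rule: path_edges.induct) auto

lemma path_edges_nth: "Suc i < length xs \<Longrightarrow> {xs ! i, xs ! Suc i} \<in> path_edges xs"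
proof (induction xs arbitrary: i rule: path_edges.induct)
  case (1 x y xs) then show ?case by (cases i) auto
qed auto

lemma path_edges_neighbour:
  assumes "distinct (A @ y # B)" "{y, c} \<in> path_edges (A @ y # B)"
  shows "(A \<noteq> [] \<and> c = last A) \<or> (B \<noteq> [] \<and> c = hd B)"
proof -
  have "path_edges (y # B) = path_edges B \<union> (if B \<noteq> [] then {{y, hd B}} else {})"
    by (cases B) auto
  moreover have "{y, c} \<notin> path_edges A" "{y, c} \<notin> path_edges B"
    using assms(1) path_edges_subset by fastforce+
  ultimately show ?thesis
    using assms(2) by (auto simp: path_edges_append doubleton_eq_iff split: if_splits)
qed

definition path_in :: "'a set \<Rightarrow> 'a set set \<Rightarrow> 'a list \<Rightarrow> bool" where
  "path_in V E xs \<longleftrightarrow> xs \<noteq> [] \<and> distinct xs \<and> set xs \<subseteq> V \<and> path_edges xs \<subseteq> E"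

definition longest_path :: "'a set \<Rightarrow> 'a set set \<Rightarrow> 'a list \<Rightarrow> bool" where
  "longest_path V E xs \<longleftrightarrow> path_in V E xs \<and> (\<forall>ys. path_in V E ys \<longrightarrow> length ys \<le> length xs)"

lemma path_in_length_le: "finite V \<Longrightarrow> path_in V E xs \<Longrightarrow> length xs \<le> card V"
  unfolding path_in_def using card_mono[of V "set xs"] distinct_card[of xs] by simp

lemma longest_path_exists:
  assumes "finite V" "V \<noteq> {}"
  shows "\<exists>xs. longest_path V E xs"
proof -
  obtain v where "v \<in> V" using assms by blast
  then have "path_in V E [v]" by (simp add: path_in_def)
  moreover have "\<forall>ys. path_in V E ys \<longrightarrow> length ys \<le> card V"
    using path_in_length_le[OF assms(1)] by blast
  ultimately show ?thesis
    unfolding longest_path_def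
    by (intro ex_has_greatest_nat[where k = "[v]" and b = "Suc (card V)"]) (auto simp: less_Suc_eq_le)
qed

lemma path_in_rev [simp]: "path_in V E (rev xs) = path_in V E xs"
  by (simp add: path_in_def)

lemma longest_path_rev: "longest_path V E xs \<Longrightarrow> longest_path V E (rev xs)"
  by (simp add: longest_path_def)

text \<open>Posa rotations with the first vertex fixed: the path edge \<open>{z, hd B}\<close> is
  exchanged for \<open>{z, last B}\<close>, and \<open>hd B\<close> becomes the new end. Iterated
  rotations are included, so the last vertices of these lists form Posa's full endpoint set.\<close>

inductive_set rotations :: "'a set set \<Rightarrow> 'a list \<Rightarrow> 'a list set" for E P where
  base: "P \<in> rotations E P"
| rot: "A @ z # B \<in> rotations E P \<Longrightarrow> B \<noteq> [] \<Longrightarrow> {z, last B} \<in> E \<Longrightarrow> A @ z # rev B \<in> rotations E P"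

lemma path_edges_split:
  "B \<noteq> [] \<Longrightarrow> path_edges (A @ z # B) = path_edges (A @ [z]) \<union> path_edges B \<union> {{z, hd B}}"
  using path_edges_append[of "A @ [z]" B] by auto

lemma rotations_path:
  assumes "path_in V E P" "Q \<in> rotations E P"
  shows "path_in V E Q \<and> set Q = set P \<and> length Q = length P \<and> hd Q = hd P"
  using assms(2)
proof induction
  case (rot A z B)
  have "path_edges (A @ z # B) \<subseteq> E" using rot.IH by (simp add: path_in_def)
  then have "path_edges (A @ z # rev B) \<subseteq> E" using rot.hyps by (simp add: path_edges_split hd_rev)
  moreover have "hd (A @ z # rev B) = hd (A @ z # B)" by (cases A) auto
  ultimately show ?case using rot.IH by (auto simp: path_in_def)
qed (use assms in auto)

lemma rotations_longest_path:
  assumes "longest_path V E P" "Q \<in> rotations E P"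
  shows "longest_path V E Q"
  using rotations_path[of V E P Q] assms by (auto simp: longest_path_def)

text \<open>A rotation removes and adds only path edges that meet an endpoint.\<close>

lemma rotations_keep_edges:
  assumes "Q \<in> rotations E P" "e \<in> path_edges P" "e \<inter> last ` rotations E P = {}"
  shows "e \<in> path_edges Q"
  using assms
proof induction
  case (rot A z B)
  have "last (A @ z # rev B) \<in> last ` rotations E P"
    using rotations.rot[OF rot.hyps] by blast
  then have "hd B \<in> last ` rotations E P" using rot.hyps by (simp add: last_rev)
  then have "e \<noteq> {z, hd B}" using rot.prems by auto
  then show ?case using rot by (auto simp: path_edges_split)
qed

text \<open>Posa's lemma. If no neighbour of \<open>y\<close> on \<open>P\<close> is an end of a
  rotation, every path edge at \<open>y\<close> survives in \<open>Q\<close>. But \<open>Q\<close>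
  runs through \<open>y\<close>, as \<open>P\<close> is longest, and the rotation at
  \<open>y\<close> makes its successor \<open>hd B\<close> an end; so the predecessor
  \<open>last A\<close> is the only possible neighbour of \<open>y\<close> on
  \<open>P\<close>.\<close>

lemma rotations_ext_nbrs:
  assumes P: "longest_path V E P" and y: "y \<in> ext_nbrs V E (last ` rotations E P)"
  shows "\<exists>r\<in>last ` rotations E P. {y, r} \<in> path_edges P"
proof (rule ccontr)
  let ?R = "last ` rotations E P"
  assume contra: "\<not> ?thesis"
  have pP: "path_in V E P" using P by (simp add: longest_path_def)
  obtain Q where Q: "Q \<in> rotations E P" "{last Q, y} \<in> E" "y \<in> V" "y \<notin> ?R"
    using y by (auto simp: ext_nbrs_def)
  note Qp = rotations_path[OF pP Q(1)]
  have "y \<in> set Q"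
  proof (rule ccontr)
    assume "y \<notin> set Q"
    then have "path_in V E (Q @ [y])" using Qp Q by (auto simp: path_in_def path_edges_append)
    then show False using rotations_longest_path[OF P Q(1)] by (auto simp: longest_path_def)
  qed
  then obtain A B where AB: "Q = A @ y # B" by (auto simp: in_set_conv_decomp)
  have "last Q \<in> ?R" using Q by blast
  then have B: "B \<noteq> []" using Q AB by auto
  then have "A @ y # rev B \<in> rotations E P"
    using Q AB by (intro rotations.rot) (auto simp: insert_commute)
  then have hdB: "hd B \<in> ?R" using B by (force simp: last_rev)
  have nbr: "A \<noteq> [] \<and> c = last A" if "{y, c} \<in> path_edges P" for c
  proof -
    have "c \<notin> ?R" using contra that by blast
    then have "{y, c} \<in> path_edges Q" using Q by (intro rotations_keep_edges[OF Q(1) that]) auto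
    then show ?thesis using path_edges_neighbour[of A y B c] Qp AB hdB \<open>c \<notin> ?R\<close>
      by (auto simp: path_in_def)
  qed
  have "y \<in> set P" using Qp \<open>y \<in> set Q\<close> by simp
  then obtain A' B' where AB': "P = A' @ y # B'" by (auto simp: in_set_conv_decomp)
  have "last P \<in> ?R" using rotations.base by blast
  then have B': "B' \<noteq> []" using AB' Q by auto
  have 1: "A \<noteq> [] \<and> hd B' = last A" using B' AB' by (intro nbr) (simp add: path_edges_split)
  \<comment> \<open>If \<open>y\<close> is first in \<open>P\<close>, it is first in every rotation,
    against \<open>A \<noteq> []\<close>; otherwise both neighbours of \<open>y\<close> on
    \<open>P\<close> are \<open>last A\<close>, against distinctness.\<close>
  show False
  proof (cases "A' = []")
    case True
    then have "hd Q = y" using Qp AB' by simp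
    moreover have "hd Q \<in> set A" using 1 AB by simp
    ultimately show False using Qp AB by (auto simp: path_in_def)
  next
    case False
    then have "last A' = last A" using AB' nbr[of "last A'"] by (auto simp: path_edges_append insert_commute)
    then have "last A' = hd B'" using 1 by simp
    moreover have "last A' \<in> set A'" "hd B' \<in> set B'" using False B' by auto
    ultimately show False using pP AB' by (auto simp: path_in_def)
  qed
qed

lemma last_rotations_subset:
  assumes "path_in V E P"
  shows "last ` rotations E P \<subseteq> set P"
proof
  fix x assume "x \<in> last ` rotations E P"
  then obtain Q where "Q \<in> rotations E P" "x = last Q" by blast
  then show "x \<in> set P" using rotations_path[OF assms, of Q] by (auto simp: path_in_def)
qed

text \<open>By Posa's lemma the outer neighbours of the endpoint set \<open>R\<close> are path
  neighbours of \<open>R\<close>, at most \<open>2 * card R\<close> in number; expansion by a factor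
  3 rules this out unless \<open>R\<close> is too large for the expander condition.\<close>

lemma expander_card_rotations:
  assumes P: "longest_path {1..n} E P" and ex: "expander n k E"
  shows "n < 6 * card (last ` rotations E P)"
proof (rule ccontr)
  let ?R = "last ` rotations E P"
  assume small: "\<not> ?thesis"
  have pP: "path_in {1..n} E P" using P by (simp add: longest_path_def)
  have R: "?R \<subseteq> set P" by (rule last_rotations_subset[OF pP])
  then have finR: "finite ?R" by (rule finite_subset) simp
  have "?R \<noteq> {}" using rotations.base by blast
  moreover have "?R \<subseteq> {1..n}" using R pP by (auto simp: path_in_def)
  ultimately have "max k (3 * card ?R) \<le> card (ext_nbrs {1..n} E ?R)"
    using ex small unfolding expander_def by simp
  then have "3 * card ?R \<le> card (ext_nbrs {1..n} E ?R)" by simp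
  also have "\<dots> \<le> card (\<Union>r\<in>?R. {y. {y, r} \<in> path_edges P})"
  proof (rule card_mono)
    show "finite (\<Union>r\<in>?R. {y. {y, r} \<in> path_edges P})"
    proof (rule finite_subset[of _ "set P"])
      show "(\<Union>r\<in>?R. {y. {y, r} \<in> path_edges P}) \<subseteq> set P"
        using path_edges_subset[of _ P] by blast
    qed simp
    show "ext_nbrs {1..n} E ?R \<subseteq> (\<Union>r\<in>?R. {y. {y, r} \<in> path_edges P})"
      using rotations_ext_nbrs[OF P] by blast
  qed
  also have "\<dots> \<le> (\<Sum>r\<in>?R. card {y. {y, r} \<in> path_edges P})"
    by (rule card_UN_le[OF finR])
  also have "\<dots> \<le> (\<Sum>r\<in>?R. 2)"
  proof (rule sum_mono)
    fix r assume "r \<in> ?R"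
    then have "r \<in> set P" using R by blast
    then obtain A B where AB: "P = A @ r # B" by (auto simp: in_set_conv_decomp)
    \<comment> \<open>For \<open>A = []\<close> or \<open>B = []\<close> one of these two is an
      unspecified value, which is harmless in an upper bound.\<close>
    have "{y. {y, r} \<in> path_edges P} \<subseteq> {last A, hd B}"
    proof
      fix y assume "y \<in> {y. {y, r} \<in> path_edges P}"
      then have "{r, y} \<in> path_edges (A @ r # B)" using AB by (simp add: insert_commute)
      then show "y \<in> {last A, hd B}" using path_edges_neighbour[of A r B y] pP AB
        by (auto simp: path_in_def)
    qed
    then have "card {y. {y, r} \<in> path_edges P} \<le> card {last A, hd B}" by (rule card_mono[rotated]) simp
    also have "\<dots> \<le> 2" by (simp add: card_insert_if)
    finally show "card {y. {y, r} \<in> path_edges P} \<le> 2" .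
  qed
  also have "\<dots> = 2 * card ?R" by simp
  finally have "card ?R = 0" by simp
  then show False using finR \<open>?R \<noteq> {}\<close> by simp
qed

text \<open>The edges \<open>{w, z}\<close> with \<open>z\<close> in this set are the boosters of
  Posa's method: adding one closes a longest path to a cycle.\<close>

definition partners :: "'a set \<Rightarrow> 'a set set \<Rightarrow> 'a \<Rightarrow> 'a set" where
  "partners V E w = {z. \<exists>Q. longest_path V E Q \<and> hd Q = w \<and> last Q = z}"

lemma partners_subset: "partners V E w \<subseteq> V"
  unfolding partners_def longest_path_def path_in_def using last_in_set by blast

text \<open>Both ends are rotated: each end reached from \<open>P\<close> becomes the fixed first
  vertex of a reversed longest path, and the rotations of that path supply its partners.\<close>

lemma expander_many_boosters:
  assumes ex: "expander n k E" and n: "0 < n"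
  shows "n < 6 * card {w \<in> {1..n}. n < 6 * card (partners {1..n} E w)}"
proof -
  let ?U = "{w \<in> {1..n}. n < 6 * card (partners {1..n} E w)}"
  obtain P where P: "longest_path {1..n} E P" using longest_path_exists[of "{1..n}" E] n by auto
  have pP: "path_in {1..n} E P" using P by (simp add: longest_path_def)
  have "last ` rotations E P \<subseteq> ?U"
  proof safe
    fix Q assume Q: "Q \<in> rotations E P"
    have lQ: "longest_path {1..n} E (rev Q)"
      by (intro longest_path_rev rotations_longest_path[OF P Q])
    have "Q \<noteq> []" "set Q \<subseteq> {1..n}" using rotations_path[OF pP Q] by (auto simp: path_in_def)
    then show "last Q \<in> {1..n}" using last_in_set by blast
    have "last ` rotations E (rev Q) \<subseteq> partners {1..n} E (last Q)"
    proof safe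
      fix Q' assume Q': "Q' \<in> rotations E (rev Q)"
      have "path_in {1..n} E (rev Q)" using lQ by (simp add: longest_path_def)
      then have "hd Q' = last Q" using rotations_path[OF _ Q'] \<open>Q \<noteq> []\<close> by (simp add: hd_rev)
      then show "last Q' \<in> partners {1..n} E (last Q)"
        using rotations_longest_path[OF lQ Q'] by (auto simp: partners_def)
    qed
    then have "card (last ` rotations E (rev Q)) \<le> card (partners {1..n} E (last Q))"
      by (intro card_mono finite_subset[OF partners_subset]) auto
    then show "n < 6 * card (partners {1..n} E (last Q))"
      using expander_card_rotations[OF lQ ex] by linarith
  qed
  then have "card (last ` rotations E P) \<le> card ?U" by (intro card_mono) auto
  then show ?thesis using expander_card_rotations[OF P ex] by linarith
qed

lemma rtrancl_crossing:
  "(a, b) \<in> r\<^sup>* \<Longrightarrow> a \<in> S \<Longrightarrow> b \<notin> S \<Longrightarrow> \<exists>c d. (c, d) \<in> r \<and> c \<in> S \<and> d \<notin> S"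
  by (induction rule: rtrancl_induct) auto

text \<open>The added edge turns \<open>Q\<close> into a cycle. If the cycle misses a vertex,
  connectivity gives an edge leaving it, and opening the cycle there gives a path with one more
  vertex.\<close>

lemma booster:
  assumes Q: "longest_path V E Q" "3 \<le> length Q" and conn: "graph_connected V E" and V: "finite V"
    and E': "E \<subseteq> E'" "{hd Q, last Q} \<in> E'"
  shows "hamiltonian V E' \<or> (\<exists>ys. path_in V E' ys \<and> length Q < length ys)"
proof (cases "set Q = V")
  case True
  have "hamiltonian V E'"
    unfolding hamiltonian_def
  proof (intro exI[of _ Q] conjI allI impI)
    fix i assume i: "i < length Q"
    show "{Q ! i, Q ! (Suc i mod length Q)} \<in> E'"
    proof (cases "Suc i = length Q")
      case True
      then have "Suc i mod length Q = 0" by simp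
      moreover have "Q ! i = last Q" "Q ! 0 = hd Q"
        using Q(2) True by (cases Q; simp add: last_conv_nth)+
      ultimately show ?thesis using E' by (simp add: insert_commute)
    next
      case False
      then show ?thesis using path_edges_nth[of i Q] i Q E' by (auto simp: longest_path_def path_in_def)
    qed
  qed (use Q True in \<open>auto simp: longest_path_def path_in_def\<close>)
  then show ?thesis ..
next
  case False
  have pQ: "path_in V E Q" using Q by (simp add: longest_path_def)
  then obtain y0 where y0: "y0 \<in> V" "y0 \<notin> set Q" using False by (auto simp: path_in_def)
  have "hd Q \<in> V" "hd Q \<in> set Q" using pQ by (auto simp: path_in_def)
  then have "(hd Q, y0) \<in> {(a, b). a \<in> V \<and> b \<in> V \<and> {a, b} \<in> E}\<^sup>*"
    using conn y0 by (simp add: graph_connected_def)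
  then obtain q y where qy: "q \<in> V" "y \<in> V" "{q, y} \<in> E" "q \<in> set Q" "y \<notin> set Q"
    using rtrancl_crossing[of "hd Q" y0 _ "set Q"] y0 \<open>hd Q \<in> set Q\<close> by blast
  then obtain A B where AB: "Q = A @ q # B" by (auto simp: in_set_conv_decomp)
  \<comment> \<open>The cycle is read from \<open>q\<close> to the end of \<open>Q\<close>, across
    the closing edge and along \<open>A\<close>, stopping just before \<open>q\<close>.\<close>
  have "path_in V E' (y # (q # B) @ A)"
    unfolding path_in_def
  proof (intro conjI)
    have pe: "path_edges (q # B) \<subseteq> E'" "path_edges A \<subseteq> E'" 
      using pQ E' AB by (auto simp: path_in_def path_edges_append)
    have "A \<noteq> [] \<Longrightarrow> {last (q # B), hd A} \<in> E'" using E' AB by (simp add: insert_commute)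
    then have "path_edges ((q # B) @ A) \<subseteq> E'" using pe
      by (subst path_edges_append) auto
    moreover have "path_edges (y # (q # B) @ A) = insert {q, y} (path_edges ((q # B) @ A))"
      by (simp add: insert_commute)
    ultimately show "path_edges (y # (q # B) @ A) \<subseteq> E'" using qy E' by auto
  qed (use pQ AB qy in \<open>auto simp: path_in_def\<close>)
  then show ?thesis using AB by (intro disjI2 exI[of _ "y # (q # B) @ A"]) auto
qed

section \<open>From vertex expansion to vertex connectivity\<close>

lemma ext_nbrs_subset: "ext_nbrs V E S \<subseteq> V"
  by (auto simp: ext_nbrs_def)

lemma expander_mono:
  assumes "expander n k E" "E \<subseteq> E'" shows "expander n k E'"
  unfolding expander_def
proof (intro allI impI)
  fix S assume S: "S \<subseteq> {1..n}" "S \<noteq> {} \<and> 6 * card S \<le> n"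
  have "card (ext_nbrs {1..n} E S) \<le> card (ext_nbrs {1..n} E' S)"
    using assms(2) by (intro card_mono finite_subset[OF ext_nbrs_subset]) (auto simp: ext_nbrs_def)
  then show "max k (3 * card S) \<le> card (ext_nbrs {1..n} E' S)"
    using assms(1) S unfolding expander_def by (meson order_trans)
qed

text \<open>If removing \<open>T\<close> disconnects the graph, some side \<open>S\<close> has at
  most \<open>n / 2\<close> vertices and all its outer neighbours in \<open>T\<close>. A small
  \<open>S\<close> contradicts the bound \<open>k\<close>. A large \<open>S\<close> contains a set
  \<open>S0\<close> of size \<open>n div 6\<close>, whose many neighbours must fit into
  \<open>(S - S0) \<union> T\<close>; so \<open>4 * (n div 6)\<close> would be less than
  \<open>n / 2 + n / 12\<close>, and \<open>n \<ge> 48\<close> absorbs the rounding.\<close>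

lemma expander_vertex_connected:
  assumes ex: "expander n k E" and k: "12 * k \<le> n" and n: "48 \<le> n"
  shows "vertex_connected k {1..n} E"
  unfolding vertex_connected_def
proof (intro conjI allI impI)
  show "k < card {1..n}" using k n by simp
next
  fix T :: "nat set" assume T: "T \<subseteq> {1..n}" "finite T \<and> card T < k"
  show "graph_connected ({1..n} - T) E"
  proof (rule ccontr)
    let ?V = "{1..n} - T"
    define r where "r = {(a, b). a \<in> ?V \<and> b \<in> ?V \<and> {a, b} \<in> E}"
    assume "\<not> ?thesis"
    then obtain x y where xy: "x \<in> ?V" "y \<in> ?V" "(x, y) \<notin> r\<^sup>*"
      by (auto simp: graph_connected_def r_def)
    define S1 where "S1 = {z \<in> ?V. (x, z) \<in> r\<^sup>*}"
    have sep: False if "a \<in> S1" "b \<in> ?V - S1" "{a, b} \<in> E" for a b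
    proof -
      have "(a, b) \<in> r" using that by (auto simp: r_def S1_def)
      then show False using that by (auto simp: S1_def intro: rtrancl_into_rtrancl)
    qed
    have fin: "finite S1" by (simp add: S1_def)
    have "card S1 + card (?V - S1) = card ?V"
      using card_Un_disjoint[of S1 "?V - S1"] fin by (auto simp: S1_def Un_absorb1 subset_eq)
    also have "\<dots> \<le> n" using card_mono[of "{1..n}" ?V] by auto
    finally have "2 * card S1 \<le> n \<or> 2 * card (?V - S1) \<le> n" by linarith
    then obtain S where S: "S = S1 \<or> S = ?V - S1" "2 * card S \<le> n" by blast
    have Sn: "S \<noteq> {}" "S \<subseteq> {1..n}" using S xy by (auto simp: S1_def)
    have finS: "finite S" using Sn finite_subset by blast
    have nb: "b \<in> S \<union> T" if "a \<in> S" "b \<in> {1..n}" "{a, b} \<in> E" for a b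
      using that S sep[of a b] sep[of b a] by (auto simp: S1_def insert_commute)
    show False
    proof (cases "6 * card S \<le> n")
      case True
      have "k \<le> card (ext_nbrs {1..n} E S)" using ex True Sn by (auto simp: expander_def)
      also have "\<dots> \<le> card T" using T nb by (intro card_mono) (auto simp: ext_nbrs_def)
      finally show False using T by simp
    next
      case False
      then have "n div 6 \<le> card S" by linarith
      then obtain S0 where S0: "S0 \<subseteq> S" "card S0 = n div 6"
        by (rule obtain_subset_with_card_n)
      have "S0 \<noteq> {}" using S0 n by auto
      then have "3 * (n div 6) \<le> card (ext_nbrs {1..n} E S0)"
        using ex[unfolded expander_def, rule_format, of S0] S0 Sn by auto
      also have "\<dots> \<le> card ((S - S0) \<union> T)"
        using T nb S0 finS by (intro card_mono) (auto simp: ext_nbrs_def)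
      also have "\<dots> \<le> card (S - S0) + card T" by (rule card_Un_le)
      also have "card (S - S0) = card S - n div 6"
        using S0 finS by (simp add: card_Diff_subset finite_subset)
      finally have "4 * (n div 6) \<le> card S + card T" using False by linarith
      then show False using T S k n by linarith
    qed
  qed
qed

section \<open>Hamilton cycles in the trace of an adaptive walk\<close>

lemma hamiltonian_mono: "hamiltonian V E \<Longrightarrow> E \<subseteq> E' \<Longrightarrow> hamiltonian V E'"
  unfolding hamiltonian_def by blast

lemma vertex_connected_mono:
  assumes "vertex_connected k V E" "E \<subseteq> E'" shows "vertex_connected k V E'"
proof -
  have "graph_connected W E'" if "graph_connected W E" for W
  proof -
    have "{(a, b). a \<in> W \<and> b \<in> W \<and> {a, b} \<in> E}\<^sup>* \<subseteq> {(a, b). a \<in> W \<and> b \<in> W \<and> {a, b} \<in> E'}\<^sup>*"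
      using assms(2) by (intro rtrancl_mono) auto
    then show ?thesis using that unfolding graph_connected_def by blast
  qed
  then show ?thesis using assms(1) unfolding vertex_connected_def by blast
qed

section \<open>Boosting, with the length of a longest path as progress\<close>

definition path_number :: "'a set \<Rightarrow> 'a set set \<Rightarrow> nat" where
  "path_number V E = (GREATEST l. \<exists>xs. path_in V E xs \<and> length xs = l)"

lemma path_number_ge: "finite V \<Longrightarrow> path_in V E xs \<Longrightarrow> length xs \<le> path_number V E"
  unfolding path_number_def
  by (rule Greatest_le_nat[where b = "card V"]) (auto dest: path_in_length_le)

lemma path_number_eq: "longest_path V E xs \<Longrightarrow> path_number V E = length xs"
  unfolding path_number_def longest_path_def by (rule Greatest_equality) auto

lemma path_in_mono: "path_in V E xs \<Longrightarrow> E \<subseteq> E' \<Longrightarrow> path_in V E' xs"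
  by (auto simp: path_in_def)

lemma path_number_mono:
  assumes "finite V" "V \<noteq> {}" "E \<subseteq> E'"
  shows "path_number V E \<le> path_number V E'"
proof -
  obtain xs where xs: "longest_path V E xs" using longest_path_exists[OF assms(1,2)] by blast
  then have "path_in V E' xs" using path_in_mono assms(3) by (auto simp: longest_path_def)
  then show ?thesis using path_number_ge[OF assms(1)] path_number_eq[OF xs] by simp
qed

lemma path_number_le:
  assumes "finite V" "V \<noteq> {}"
  shows "path_number V E \<le> card V"
proof -
  obtain xs where xs: "longest_path V E xs" using longest_path_exists[OF assms] by blast
  then show ?thesis
    using path_number_eq[OF xs] path_in_length_le[OF assms(1)] by (auto simp: longest_path_def)
qed

lemma vertex_connected_imp_connected:
  assumes "vertex_connected k V E" "0 < k" shows "graph_connected V E"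
proof -
  have "{} \<subseteq> V \<and> finite {} \<and> card {} < k" using assms by simp
  then show ?thesis using assms(1) unfolding vertex_connected_def by (metis Diff_empty)
qed

text \<open>The potential at least halves whenever the longest path grows, and vanishes at a
  Hamilton cycle. Expansion is tested only on the prefix at time \<open>t\<close>, so this condition
  stays frozen while the walk goes on; it passes to the larger trace by monotonicity.\<close>

definition lacking :: "nat \<Rightarrow> nat \<Rightarrow> nat \<Rightarrow> nat list \<Rightarrow> real" where
  "lacking n k t xs =
     (if expander n k (trace_edges (take (Suc t) xs)) \<and>
         \<not> hamiltonian {1..n} (trace_edges xs)
      then (1 / 2) ^ path_number {1..n} (trace_edges xs) else 0)"

text \<open>Both endpoints of a booster must be hit, so steps are grouped in pairs: the first lands
  in \<open>U\<close>, the second on a partner of that vertex, each with probability at least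
  \<open>w\<close>, and the edge just traversed halves the potential. The \<open>- 1\<close> in the
  bound on \<open>w\<close> allows for the current vertex, to which no step is guaranteed.\<close>

lemma lacking_two_steps:
  assumes Q: "spread_kernel n r Q" and n: "48 \<le> n" and k: "0 < k" "12 * k \<le> n"
    and r: "0 \<le> r" and w: "0 \<le> w" "w \<le> 1" "w \<le> r * (real n / 6 - 1)"
    and xs: "Suc t \<le> length xs"
  shows "(\<integral>\<^sup>+y. (\<integral>\<^sup>+z. ennreal (lacking n k t ((xs @ [y]) @ [z])) \<partial>Q (xs @ [y])) \<partial>Q xs)
           \<le> ennreal ((1 - w\<^sup>2 / 2) * lacking n k t xs)"
proof -
  define E where "E = trace_edges xs"
  define E2 where "E2 y z = trace_edges ((xs @ [y]) @ [z])" for y z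
  have ne: "xs \<noteq> []" using xs by auto
  have E2: "E \<subseteq> E2 y z" "z \<noteq> y \<Longrightarrow> {y, z} \<in> E2 y z" for y z
    using walk_edges_snoc[OF ne, of y] walk_edges_snoc[of "xs @ [y]" z] by (auto simp: E_def E2_def)
  have tk: "take (Suc t) ((xs @ [y]) @ [z]) = take (Suc t) xs" for y z using xs by simp
  have w2: "w\<^sup>2 \<le> 1" using w by (simp add: power_le_one)
  show ?thesis
  proof (cases "expander n k (trace_edges (take (Suc t) xs)) \<and> \<not> hamiltonian {1..n} E")
    case False
    then have "lacking n k t ((xs @ [y]) @ [z]) = 0" for y z
      unfolding lacking_def tk using hamiltonian_mono[of "{1..n}" E] E2(1)[of y z]
      by (auto simp: E2_def)
    then show ?thesis by simp
  next
    case True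
    define B where "B = (1 / 2 :: real) ^ path_number {1..n} E"
    have B0: "0 \<le> B" by (simp add: B_def)
    have lxs: "lacking n k t xs = B" using True by (simp add: lacking_def B_def E_def)
    have ex: "expander n k E"
      unfolding E_def by (rule expander_mono[OF conjunct1[OF True] walk_edges_take])
    have conn: "graph_connected {1..n} E"
      by (rule vertex_connected_imp_connected[OF expander_vertex_connected[OF ex k(2) n] k(1)])
    define U where "U = {w \<in> {1..n}. n < 6 * card (partners {1..n} E w)}"
    have cU: "n < 6 * card U" unfolding U_def by (rule expander_many_boosters[OF ex]) (use n in simp)
    have le: "lacking n k t ((xs @ [y]) @ [z]) \<le> B" for y z
    proof -
      have "path_number {1..n} E \<le> path_number {1..n} (E2 y z)"
        using n E2 by (intro path_number_mono) auto
      then show ?thesis unfolding lacking_def B_def E2_def[symmetric]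
        by (auto intro: power_decreasing)
    qed
    have boost: "lacking n k t ((xs @ [y]) @ [z]) \<le> B / 2" if yz: "z \<in> partners {1..n} E y" "z \<noteq> y" for y z
    proof (cases "hamiltonian {1..n} (E2 y z)")
      case False
      obtain P where P: "longest_path {1..n} E P" "hd P = y" "last P = z"
        using yz by (auto simp: partners_def)
      then have "n < 6 * card (set P)"
        using expander_card_rotations[OF P(1) ex] last_rotations_subset[of "{1..n}" E P]
          card_mono[of "set P" "last ` rotations E P"] by (auto simp: longest_path_def)
      then have "3 \<le> length P" using card_length[of P] n by linarith
      from booster[OF P(1) this conn _ E2(1)] E2(2)[OF yz(2)] P False
      obtain ys where "path_in {1..n} (E2 y z) ys" "length P < length ys" by auto
      then have "Suc (path_number {1..n} E) \<le> path_number {1..n} (E2 y z)"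
        using path_number_ge[of "{1..n}" "E2 y z" ys] path_number_eq[OF P(1)] by simp
      then have "(1 / 2 :: real) ^ path_number {1..n} (E2 y z) \<le> (1 / 2) ^ Suc (path_number {1..n} E)"
        by (intro power_decreasing) auto
      then show ?thesis using B0 unfolding lacking_def E2_def[symmetric] B_def by auto
    next
      case True
      then show ?thesis using B0 unfolding lacking_def E2_def[symmetric] by auto
    qed
    have many: "w \<le> measure_pmf.prob (Q ys) (A - {last ys})" if "A \<subseteq> {1..n}" "n < 6 * card A" for A ys
    proof -
      have fA: "finite A" using that(1) finite_subset by blast
      have "w \<le> r * (real n / 6 - 1)" by fact
      also have "\<dots> \<le> r * card (A - {last ys})"
      proof (rule mult_left_mono[OF _ r])
        have "card A \<le> Suc (card (A - {last ys}))"
          using fA by (cases "last ys \<in> A") (simp_all add: card_Diff_singleton)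
        then show "real n / 6 - 1 \<le> card (A - {last ys})" using that by linarith
      qed
      also have "\<dots> = real (card (A - {last ys})) * r" by simp
      also have "\<dots> \<le> measure_pmf.prob (Q ys) (A - {last ys})"
        using Q[unfolded spread_kernel_def, rule_format, of _ ys] that fA by (intro prob_ge_card) auto
      finally show ?thesis .
    qed
    define f where "f y = (if y \<in> U then B - (B - B / 2) * w else B)" for y
    have inner: "(\<integral>\<^sup>+z. ennreal (lacking n k t ((xs @ [y]) @ [z])) \<partial>Q (xs @ [y])) \<le> ennreal (f y)" for y
    proof (cases "y \<in> U")
      case True
      have "w \<le> measure_pmf.prob (Q (xs @ [y])) (partners {1..n} E y - {y})"
        using many[OF partners_subset[of "{1..n}" E y], of "xs @ [y]"] True by (auto simp: U_def)
      then have "(\<integral>\<^sup>+z. ennreal (lacking n k t ((xs @ [y]) @ [z])) \<partial>Q (xs @ [y])) \<le> ennreal (B - (B - B / 2) * w)"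
        using le boost B0 by (intro nn_integral_two_values[where W = "partners {1..n} E y - {y}"]) auto
      then show ?thesis using True by (simp add: f_def)
    next
      case False
      have "(\<integral>\<^sup>+z. ennreal (lacking n k t ((xs @ [y]) @ [z])) \<partial>Q (xs @ [y])) \<le> ennreal (B - (B - B) * 0)"
        using le B0 by (intro nn_integral_two_values[where W = "{}"]) auto
      then show ?thesis using False by (simp add: f_def)
    qed
    have Bw: "0 \<le> B * w" "B * w \<le> B" using B0 w by (auto intro: mult_left_le)
    have "(\<integral>\<^sup>+y. (\<integral>\<^sup>+z. ennreal (lacking n k t ((xs @ [y]) @ [z])) \<partial>Q (xs @ [y])) \<partial>Q xs) \<le> (\<integral>\<^sup>+y. ennreal (f y) \<partial>Q xs)"
      by (rule nn_integral_mono) (rule inner)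
    also have "\<dots> \<le> ennreal (B - (B - (B - (B - B / 2) * w)) * w)"
    proof (rule nn_integral_two_values[where W = "U - {last xs}"])
      have "U \<subseteq> {1..n}" by (auto simp: U_def)
      then show "w \<le> measure_pmf.prob (Q xs) (U - {last xs})" using many[of U xs] cU by simp
    qed (use Bw B0 in \<open>auto simp: f_def algebra_simps\<close>)
    also have "B - (B - (B - (B - B / 2) * w)) * w = (1 - w\<^sup>2 / 2) * lacking n k t xs"
      by (simp add: lxs field_simps power2_eq_square)
    finally show ?thesis .
  qed
qed

text \<open>The potential is at most 1 at time \<open>t\<close> and at least
  \<open>(1 / 2) ^ n\<close> on failure, so Markov's inequality costs \<open>2 ^ n\<close>; a number
  \<open>J\<close> of pairs of order \<open>n * ln n\<close> outweighs this.\<close>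

lemma booster_phase:
  assumes Q: "spread_kernel n r Q" and n: "48 \<le> n" and k: "0 < k" "12 * k \<le> n"
    and r: "0 \<le> r" and w: "0 \<le> w" "w \<le> 1" "w \<le> r * (real n / 6 - 1)"
  shows "measure_pmf.prob (adaptive_walk Q v (t + 2 * J))
     {xs. expander n k (trace_edges (take (Suc t) xs)) \<and>
          \<not> hamiltonian {1..n} (trace_edges xs)} \<le> 2 ^ n * (1 - w\<^sup>2 / 2) ^ J"
proof -
  define c where "c = 1 - w\<^sup>2 / 2"
  have "w\<^sup>2 \<le> 1" using w by (simp add: power_le_one)
  then have c: "0 \<le> c" by (simp add: c_def)
  have l0: "0 \<le> lacking n k t xs" for xs by (simp add: lacking_def)
  have "(\<integral>\<^sup>+xs. ennreal (lacking n k t xs) \<partial>adaptive_walk Q v (t + 2 * J)) \<le> ennreal (c ^ J)"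
  proof (induction J)
    case 0
    have "(\<integral>\<^sup>+xs. ennreal (lacking n k t xs) \<partial>adaptive_walk Q v (t + 2 * 0)) \<le> (\<integral>\<^sup>+xs. 1 \<partial>adaptive_walk Q v (t + 2 * 0))"
      by (intro nn_integral_mono) (auto simp: lacking_def power_le_one)
    then show ?case by simp
  next
    case (Suc J)
    have "(\<integral>\<^sup>+xs. ennreal (lacking n k t xs) \<partial>adaptive_walk Q v (t + 2 * Suc J)) =
       (\<integral>\<^sup>+xs. (\<integral>\<^sup>+y. (\<integral>\<^sup>+z. ennreal (lacking n k t ((xs @ [y]) @ [z])) \<partial>Q (xs @ [y])) \<partial>Q xs) \<partial>adaptive_walk Q v (t + 2 * J))"
    proof -
      have e: "t + 2 * Suc J = Suc (Suc (t + 2 * J))" by simp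
      show ?thesis unfolding e nn_integral_adaptive_walk_Suc ..
    qed
    also have "\<dots> \<le> (\<integral>\<^sup>+xs. ennreal (c * lacking n k t xs) \<partial>adaptive_walk Q v (t + 2 * J))"
      using lacking_two_steps[OF assms] unfolding c_def
      by (intro nn_integral_mono_AE) (auto simp: AE_measure_pmf_iff dest!: adaptive_walk_length)
    also have "\<dots> = ennreal c * (\<integral>\<^sup>+xs. ennreal (lacking n k t xs) \<partial>adaptive_walk Q v (t + 2 * J))"
      using c l0 by (simp add: ennreal_mult nn_integral_cmult)
    also have "\<dots> \<le> ennreal c * ennreal (c ^ J)" by (intro mult_left_mono Suc) auto
    also have "\<dots> = ennreal (c ^ Suc J)" using c by (simp add: ennreal_mult)
    finally show ?case .
  qed
  then have "measure_pmf.prob (adaptive_walk Q v (t + 2 * J))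
     {xs. expander n k (trace_edges (take (Suc t) xs)) \<and>
          \<not> hamiltonian {1..n} (trace_edges xs)} \<le> c ^ J / (1 / 2) ^ n"
  proof (rule pmf_markov)
    fix xs :: "nat list"
    assume "expander n k (trace_edges (take (Suc t) xs)) \<and>
          \<not> hamiltonian {1..n} (trace_edges xs)"
    moreover have "path_number {1..n} (trace_edges xs) \<le> n"
      using path_number_le[of "{1..n}"] n by simp
    ultimately show "(1 / 2) ^ n \<le> lacking n k t xs"
      by (auto simp: lacking_def intro: power_decreasing)
  qed (use c in auto)
  then show ?thesis by (simp add: c_def field_simps)
qed

section \<open>Union bounds and the choice of constants\<close>

lemma adaptive_walk_range:
  assumes "\<And>xs. set_pmf (Q xs) \<subseteq> V" "v \<in> V" "xs \<in> set_pmf (adaptive_walk Q v t)"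
  shows "set xs \<subseteq> V"
  using assms(3)
proof (induction t arbitrary: xs)
  case (Suc t)
  then obtain ys y where "ys \<in> set_pmf (adaptive_walk Q v t)" "y \<in> set_pmf (Q ys)" "xs = ys @ [y]"
    by auto
  then show ?case using Suc.IH[of ys] assms(1)[of ys] by auto
qed (use assms(2) in simp)

text \<open>Expansion can fail in two ways: some vertex is seen at most \<open>k\<close> times, or
  the at least \<open>k * card S\<close> steps started in some \<open>S\<close> reach too few outer
  vertices. The sum is enlarged to all nonempty sets because it then has a closed form.\<close>

lemma expander_fail:
  assumes range: "\<And>xs. set_pmf (Q xs) \<subseteq> {1..n}" "v \<in> {1..n}"
    and vis: "\<And>u. u \<in> {1..n} \<Longrightarrow>
          measure_pmf.prob (adaptive_walk Q v T) {xs. count_list xs u \<le> k} \<le> A"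
    and esc: "\<And>S. S \<subseteq> {1..n} \<Longrightarrow> S \<noteq> {} \<Longrightarrow> 6 * card S \<le> n \<Longrightarrow>
          measure_pmf.prob (adaptive_walk Q v T)
            {xs. card (escapes S xs) < max k0 (3 * card S) \<and> k * card S \<le> exits S xs} \<le> B S"
    and B0: "\<And>S. 0 \<le> B S"
  shows "measure_pmf.prob (adaptive_walk Q v T) {xs. \<not> expander n k0 (trace_edges xs)}
           \<le> real n * A + (\<Sum>S\<in>Pow {1..n} - {{}}. B S)"
proof -
  let ?M = "adaptive_walk Q v T"
  define \<S> where "\<S> = {S \<in> Pow {1..n} - {{}}. 6 * card S \<le> n}"
  have fin: "finite \<S>" by (simp add: \<S>_def)
  let ?V = "\<Union>u\<in>{1..n}. {xs. count_list xs u \<le> k}"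
  let ?S = "\<Union>S\<in>\<S>. {xs. card (escapes S xs) < max k0 (3 * card S) \<and> k * card S \<le> exits S xs}"
  have "measure_pmf.prob ?M {xs. \<not> expander n k0 (trace_edges xs)}
     = measure_pmf.prob ?M ({xs. \<not> expander n k0 (trace_edges xs)} \<inter> set_pmf ?M)"
    by (simp add: measure_Int_set_pmf)
  also have "\<dots> \<le> measure_pmf.prob ?M (?V \<union> ?S)"
  proof (rule measure_pmf.finite_measure_mono)
    show "{xs. \<not> expander n k0 (trace_edges xs)} \<inter> set_pmf ?M \<subseteq> ?V \<union> ?S"
    proof
      fix xs assume xs: "xs \<in> {xs. \<not> expander n k0 (trace_edges xs)} \<inter> set_pmf ?M"
      then have sx: "set xs \<subseteq> {1..n}" "xs \<noteq> []"
        using adaptive_walk_range[of Q "{1..n}" v xs T] range by (auto dest: adaptive_walk_length)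
      from xs have "\<not> expander n k0 (trace_edges xs)" by simp
      then obtain S where S: "S \<subseteq> {1..n}" "S \<noteq> {} \<and> 6 * card S \<le> n"
        "\<not> max k0 (3 * card S) \<le> card (ext_nbrs {1..n} (trace_edges xs) S)"
        unfolding expander_def by blast
      have "card (escapes S xs) \<le> card (ext_nbrs {1..n} (trace_edges xs) S)"
        by (intro card_mono finite_subset[OF ext_nbrs_subset] escapes_subset_ext_nbrs sx) auto
      then have 1: "card (escapes S xs) < max k0 (3 * card S)" using S by linarith
      show "xs \<in> ?V \<union> ?S"
      proof (cases "xs \<in> ?V")
        case False
        then have "k * card S \<le> exits S xs"
          using S sx by (intro exits_ge) (auto intro: finite_subset simp: not_le)
        then show ?thesis using S 1 by (auto simp: \<S>_def)
      qed auto
    qed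
  qed auto
  also have "\<dots> \<le> measure_pmf.prob ?M ?V + measure_pmf.prob ?M ?S"
    by (rule measure_Un_le) auto
  also have "measure_pmf.prob ?M ?V \<le> (\<Sum>u\<in>{1..n}. measure_pmf.prob ?M {xs. count_list xs u \<le> k})"
    by (rule measure_pmf.finite_measure_subadditive_finite) auto
  also have "\<dots> \<le> (\<Sum>u\<in>{1..n}. A)" by (rule sum_mono) (rule vis)
  also have "\<dots> = real n * A" by simp
  also have "measure_pmf.prob ?M ?S \<le> (\<Sum>S\<in>\<S>. measure_pmf.prob ?M
       {xs. card (escapes S xs) < max k0 (3 * card S) \<and> k * card S \<le> exits S xs})"
    by (rule measure_pmf.finite_measure_subadditive_finite) (auto simp: fin)
  also have "\<dots> \<le> (\<Sum>S\<in>\<S>. B S)" by (rule sum_mono, rule esc) (auto simp: \<S>_def)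
  also have "\<dots> \<le> (\<Sum>S\<in>Pow {1..n} - {{}}. B S)"
    by (rule sum_mono2) (auto simp: \<S>_def B0)
  finally show ?thesis by simp
qed

lemma sum_pow_card:
  fixes x :: real
  assumes "finite V"
  shows "(\<Sum>S\<in>Pow V - {{}}. x ^ card S) = (1 + x) ^ card V - 1"
proof -
  have "(\<Sum>S\<in>Pow V. x ^ card S) = (\<Prod>i\<in>V. 1 + x)"
    using prod_add[OF assms, of "\<lambda>_. x" "\<lambda>_. 1"] by (simp add: add.commute)
  moreover have "(\<Sum>S\<in>Pow V. x ^ card S) = 1 + (\<Sum>S\<in>Pow V - {{}}. x ^ card S)"
    using assms by (subst sum.remove[of _ "{}"]) auto
  ultimately show ?thesis by simp
qed

text \<open>A step from such a set is fresh with probability at least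
  \<open>1 - 2 * \<kappa>\<close>, so \<open>\<theta> = \<kappa>\<close> gives
  \<open>a \<le> 3 * \<kappa>\<close>. As \<open>m \<le> 3 * k * card S\<close>, asking for
  \<open>6 * k\<close> visits makes the power of \<open>3 * \<kappa>\<close> twice that of
  \<open>1 / \<kappa>\<close>. What remains is a power of \<open>9 * \<kappa>\<close> that beats the
  number of sets of this size once \<open>k\<close> is of order \<open>ln n\<close>.\<close>

lemma escape_tail_small:
  assumes Q: "spread_kernel n ((1 - \<kappa>) / n) Q" and S: "S \<subseteq> {1..n}" "S \<noteq> {}"
    and \<kappa>: "0 < \<kappa>" "\<kappa> \<le> 1 / 9" and n: "0 < n" and k: "0 < k"
    and small: "real (card S + max k (3 * card S)) \<le> \<kappa> * n"
  shows "measure_pmf.prob (adaptive_walk Q v T)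
            {xs. card (escapes S xs) < max k (3 * card S) \<and> 6 * k * card S \<le> exits S xs}
          \<le> ((9 * \<kappa>) ^ (3 * k)) ^ card S"
proof -
  define m where "m = max k (3 * card S)"
  define a where "a = 1 - (1 - \<kappa>) * (1 - 2 * \<kappa>)"
  have a: "0 \<le> a" "a \<le> 3 * \<kappa>" 
    using \<kappa> by (auto simp: a_def algebra_simps)
  have s: "0 < card S" using S finite_subset card_gt_0_iff by blast
  have m: "m \<le> 3 * k * card S"
    using s k by (auto simp: m_def)
  have "1 - 2 * \<kappa> \<le> (1 - \<kappa>) * (1 - \<kappa>)" by (simp add: algebra_simps)
  also have "\<dots> \<le> (1 - \<kappa>) * (1 - real (card S + m) / n)"
    using small n \<kappa> by (intro mult_left_mono) (auto simp: m_def field_simps)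
  also have "\<dots> = (1 - \<kappa>) / n * (real n - card S - m)" using n by (simp add: field_simps)
  finally have "measure_pmf.prob (adaptive_walk Q v T) {xs. card (escapes S xs) < m \<and> 6 * k * card S \<le> exits S xs}
      \<le> (1 / \<kappa>) ^ m * a ^ (6 * k * card S)"
    using \<kappa> by (intro escape_tail[OF Q S(1), where w = "1 - 2 * \<kappa>"]) (auto simp: a_def)
  also have "\<dots> \<le> (1 / \<kappa>) ^ (3 * k * card S) * (3 * \<kappa>) ^ (6 * k * card S)"
    using \<kappa> a m by (intro mult_mono power_increasing power_mono) auto
  also have "\<dots> = (1 / \<kappa>) ^ (3 * k * card S) * (3 * \<kappa>) ^ (2 * (3 * k * card S))" by (simp add: mult_ac)
  also have "\<dots> = (1 / \<kappa> * (3 * \<kappa>)\<^sup>2) ^ (3 * k * card S)"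
    by (simp only: power_mult_distrib power_mult)
  also have "1 / \<kappa> * (3 * \<kappa>)\<^sup>2 = 9 * \<kappa>" using \<kappa> by (simp add: power2_eq_square)
  also have "(9 * \<kappa>) ^ (3 * k * card S) = ((9 * \<kappa>) ^ (3 * k)) ^ card S" by (rule power_mult)
  finally show ?thesis unfolding m_def .
qed

text \<open>For sets of linear size crude constants suffice: at least a third of the vertices is
  always fresh, whence \<open>w = 1 / 6\<close>, and \<open>\<theta> = 1 / 2\<close> gives the base
  \<open>11 / 12\<close>. The exponent is of order \<open>n * k\<close>, which beats both
  \<open>2 ^ m\<close> and the number of sets.\<close>

lemma escape_tail_large:
  assumes Q: "spread_kernel n ((1 - \<kappa>) / n) Q" and S: "S \<subseteq> {1..n}" "6 * card S \<le> n"
    and \<kappa>: "0 < \<kappa>" "\<kappa> \<le> 1 / 9" and n: "0 < n" and k: "0 < k" "2 * real k \<le> \<kappa> * n"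
    and large: "\<kappa> * n < real (card S + max k (3 * card S))"
  shows "measure_pmf.prob (adaptive_walk Q v T)
            {xs. card (escapes S xs) < max k (3 * card S) \<and> 6 * k * card S \<le> exits S xs}
          \<le> 2 ^ n * (11 / 12) powr (\<kappa> * n * k)"
proof -
  define m where "m = max k (3 * card S)"
  have "\<kappa> * n \<le> 1/9 * n" using \<kappa> by (intro mult_right_mono) auto
  then have "2 * k \<le> n" using k by linarith
  then have m: "2 * m \<le> n" using S by (auto simp: m_def)
  have s: "\<kappa> * n \<le> 4 * card S" using large k by (auto simp: max_def split: if_splits)
  have "1 / 6 \<le> (1 - \<kappa>) * (1 / 3)" using \<kappa> by simp
  also have "\<dots> \<le> (1 - \<kappa>) * ((real n - card S - m) / n)"
    using m S n \<kappa> by (intro mult_left_mono) (auto simp: field_simps)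
  also have "\<dots> = (1 - \<kappa>) / n * (real n - card S - m)" using n by (simp add: field_simps)
  finally have "measure_pmf.prob (adaptive_walk Q v T) {xs. card (escapes S xs) < m \<and> 6 * k * card S \<le> exits S xs}
      \<le> (1 / (1 / 2)) ^ m * (11 / 12) ^ (6 * k * card S)"
    using \<kappa> by (intro escape_tail[OF Q S(1), where w = "1 / 6"]) auto
  also have "\<dots> \<le> 2 ^ n * (11 / 12) powr (\<kappa> * n * k)"
  proof (rule mult_mono)
    show "(1 / (1 / 2)) ^ m \<le> (2::real) ^ n" using m by (auto intro: power_increasing)
    have "\<kappa> * n * k \<le> real (4 * card S) * real k" by (rule mult_right_mono[OF s]) simp
    also have "\<dots> \<le> real (6 * k * card S)" by simp
    finally have "(11 / 12 :: real) powr real (6 * k * card S) \<le> (11 / 12) powr (\<kappa> * n * k)"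
      by (intro powr_mono') auto
    then show "(11 / 12 :: real) ^ (6 * k * card S) \<le> (11 / 12) powr (\<kappa> * n * k)"
      by (subst (asm) powr_realpow) auto
  qed auto
  finally show ?thesis by (simp add: m_def)
qed

text \<open>The first \<open>t\<close> steps build the expander and the last \<open>2 * J\<close>
  are reserved for boosters. The four terms account for a rarely visited vertex, a small set and a
  large set that do not expand, and a failure of the boosters.\<close>

lemma adaptive_walk_fail:
  fixes x y s :: real
  assumes Q: "spread_kernel n ((1 - \<kappa>) / n) Q" and range: "\<And>xs. set_pmf (Q xs) \<subseteq> {1..n}" "v \<in> {1..n}"
    and \<kappa>: "0 < \<kappa>" "\<kappa> \<le> 1 / 9" and n: "48 \<le> n" and k: "0 < k" "12 * k \<le> n" "2 * real k \<le> \<kappa> * n"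
    and s: "0 < s" "s \<le> 1/2"
    and x: "(9 * \<kappa>) ^ (3 * k) \<le> x" and y: "(11 / 12) powr (\<kappa> * n * k) \<le> y"
  shows "measure_pmf.prob (adaptive_walk Q v (t + 2 * J))
     {xs. deficient n k xs}
     \<le> real n * (2 * (1 / s) ^ (6 * k) * (1 - (1 - \<kappa>) / n * (1 - 2 * s)) ^ t)
        + ((1 + x) ^ n - 1) + 2 ^ n * (2 ^ n * y) + 2 ^ n * (449 / 450) ^ J" (is "?P \<le> _")
proof -
  define r where "r = (1 - \<kappa>) / n"
  have rn: "0 \<le> r" "r \<le> 1/2" using \<kappa> n by (auto simp: r_def field_simps)
  have x0: "0 \<le> x" by (rule order_trans[OF _ x]) (use \<kappa> in simp)
  have y0: "0 \<le> y" by (rule order_trans[OF _ y]) simp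
  let ?M = "adaptive_walk Q v (t + 2 * J)"
  let ?X = "{xs. \<not> expander n k (trace_edges (take (Suc t) xs))}"
  let ?Y = "{xs. expander n k (trace_edges (take (Suc t) xs)) \<and>
          \<not> hamiltonian {1..n} (trace_edges xs)}"
  have "?P \<le> measure_pmf.prob ?M (?X \<union> ?Y)"
  proof (rule measure_pmf.finite_measure_mono)
    have "vertex_connected k {1..n} (trace_edges xs)"
      if "expander n k (trace_edges (take (Suc t) xs))" for xs
      by (rule vertex_connected_mono[OF expander_vertex_connected[OF that k(2) n] walk_edges_take])
    then show "{xs. deficient n k xs} \<subseteq> ?X \<union> ?Y" by blast
  qed simp
  also have "\<dots> \<le> measure_pmf.prob ?M ?X + measure_pmf.prob ?M ?Y"
    by (rule measure_Un_le) auto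
  \<comment> \<open>The rate \<open>449 / 450\<close> of the statement is
    \<open>1 - w\<^sup>2 / 2\<close> for \<open>w = 1 / 15\<close>.\<close>
  also have "measure_pmf.prob ?M ?Y \<le> 2 ^ n * (1 - (1 / 15)\<^sup>2 / 2) ^ J"
  proof (rule booster_phase[OF Q n k(1,2)])
    have "1 / 15 \<le> 8 / 9 * (1 / 6 - 1 / 48 :: real)" by simp
    also have "\<dots> \<le> (1 - \<kappa>) * (1 / 6 - 1 / n)"
      using \<kappa> n by (intro mult_mono) (auto simp: field_simps)
    also have "\<dots> = (1 - \<kappa>) / n * (real n / 6 - 1)" using n by (simp add: field_simps)
    finally show "1 / 15 \<le> (1 - \<kappa>) / n * (real n / 6 - 1)" .
  qed (use \<kappa> in auto)
  also have "measure_pmf.prob ?M ?X = measure_pmf.prob (map_pmf (take (Suc t)) ?M) {xs. \<not> expander n k (trace_edges xs)}"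
    by (simp add: measure_map_pmf vimage_def)
  also have "\<dots> = measure_pmf.prob (adaptive_walk Q v t) {xs. \<not> expander n k (trace_edges xs)}"
    by (simp only: map_take_adaptive_walk)
  also have "\<dots> \<le> real n * (2 * (1 / s) ^ (6 * k) * (1 - r * (1 - 2 * s)) ^ t)
       + (\<Sum>S\<in>Pow {1..n} - {{}}. x ^ card S + 2 ^ n * y)"
  proof (rule expander_fail[OF range])
    fix u assume "u \<in> {1..n}"
    then show "measure_pmf.prob (adaptive_walk Q v t) {xs. count_list xs u \<le> 6 * k}
         \<le> 2 * (1 / s) ^ (6 * k) * (1 - r * (1 - 2 * s)) ^ t"
      using Q rn s by (intro visits_tail) (auto simp: r_def)
  next
    fix S assume S: "S \<subseteq> {1..n}" "S \<noteq> {}" "6 * card S \<le> n"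
    have xS: "((9 * \<kappa>) ^ (3 * k)) ^ card S \<le> x ^ card S" using \<kappa> x by (intro power_mono) auto
    have yS: "2 ^ n * (11 / 12) powr (\<kappa> * n * k) \<le> 2 ^ n * y" using y by simp
    have "0 \<le> x ^ card S" "0 \<le> 2 ^ n * y" using x0 y0 by auto
    moreover have n0: "0 < n" using n by simp
    ultimately show "measure_pmf.prob (adaptive_walk Q v t)
            {xs. card (escapes S xs) < max k (3 * card S) \<and> 6 * k * card S \<le> exits S xs} \<le> x ^ card S + 2 ^ n * y"
      using escape_tail_small[OF Q S(1,2) \<kappa> n0 k(1), of v t]
        escape_tail_large[OF Q S(1,3) \<kappa> n0 k(1,3), of v t] xS yS
      by (meson add_increasing add_increasing2 not_le order_trans)
  qed (use x0 y0 in auto)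
  also have "(\<Sum>S\<in>Pow {1..n} - {{}}. x ^ card S + 2 ^ n * y) =
      ((1 + x) ^ n - 1) + real (card (Pow {1..n} - {{}})) * (2 ^ n * y)"
    by (simp add: sum.distrib sum_pow_card del: Pow_iff)
  also have "\<dots> \<le> ((1 + x) ^ n - 1) + 2 ^ n * (2 ^ n * y)"
  proof -
    have "card (Pow {1..n} - {{}}) \<le> card (Pow {1..n})" by (intro card_mono) auto
    then have "real (card (Pow {1..n} - {{}})) \<le> 2 ^ n" by (simp add: card_Pow)
    then show ?thesis using y0 by (intro add_left_mono mult_right_mono) auto
  qed
  finally show ?thesis by (simp add: r_def power2_eq_square)
qed

text \<open>The first term decides the admissible length: by the conditions on
  \<open>\<beta>\<close> and \<open>e\<close> it is of order \<open>n\<close> to the power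
  \<open>1 + \<epsilon> / 4 - (1 + \<epsilon> / 2)\<close>. The last two are exponentials of a
  linear term minus a positive multiple of \<open>n * ln n\<close>.\<close>

lemma adaptive_walk_asymptotics:
  fixes \<epsilon> \<kappa> \<beta> s \<eta> :: real
  assumes \<epsilon>: "0 < \<epsilon>" and s: "0 < s" "s < 1/2" and \<beta>: "0 < \<beta>" "6 * \<beta> * ln (1 / s) \<le> \<epsilon> / 4"
    and \<kappa>: "0 < \<kappa>" "\<kappa> \<le> 1 / 9" and \<eta>: "0 < \<eta>" "\<eta> \<le> 1 / 2"
    and e: "1 + \<epsilon> / 2 \<le> (1 - \<kappa>) * (1 - 2 * s) * (1 + \<epsilon> - 2 * \<eta>)"
  defines "k \<equiv> \<lambda>n::nat. nat \<lceil>\<beta> * ln n\<rceil>"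
    and "L \<equiv> \<lambda>n::nat. nat \<lfloor>(1 + \<epsilon>) * n * ln n\<rfloor>" and "J \<equiv> \<lambda>n::nat. nat \<lfloor>\<eta> * n * ln n\<rfloor>"
  shows "(\<lambda>n. real n * (2 * (1 / s) ^ (6 * k n) * (1 - (1 - \<kappa>) / n * (1 - 2 * s)) ^ (L n - 2 * J n))
        + ((1 + 1 / n ^ 3) ^ n - 1) + 2 ^ n * (2 ^ n * (11 / 12) powr (\<kappa> * n * (\<beta> * ln n)))
        + 2 ^ n * (449 / 450) ^ J n) \<longlonglongrightarrow> 0"
proof -
  define e1 where "e1 = (1 - \<kappa>) * (1 - 2 * s)"
  define D where "D = 6 * ln (1 / s)"
  have D0: "0 \<le> D" using s by (simp add: D_def)
  have e1: "0 < e1" "e1 \<le> 1" 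
    using \<kappa> s mult_mono[of "1 - \<kappa>" 1 "1 - 2 * s" 1] by (auto simp: e1_def)
  \<comment> \<open>The factor \<open>exp (D + 1)\<close> collects the rounding of \<open>k\<close>
    and of \<open>L\<close>.\<close>
  have ev1: "\<forall>\<^sub>F n in sequentially. real n * (2 * (1 / s) ^ (6 * k n) * (1 - (1 - \<kappa>) / n * (1 - 2 * s)) ^ (L n - 2 * J n))
       \<le> 2 * exp (D + 1) * exp (- (\<epsilon> / 4) * ln n)"
    using eventually_ge_at_top[of 3]
  proof eventually_elim
    case (elim n)
    have ln0: "0 \<le> ln (real n)" using elim by simp
    have "exp (ln (1 / s)) = 1 / s" using s by (intro exp_ln) auto
    then have "(1 / s) ^ (6 * k n) = exp (ln (1 / s) * real (6 * k n))"
      by (simp only: exp_of_nat2_mult)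
    also have "\<dots> \<le> exp (D * (\<beta> * ln n + 1))"
    proof -
      have "real (k n) \<le> \<beta> * ln n + 1" using \<beta> ln0 unfolding k_def by (simp add: of_nat_nat)
      then have "ln (1 / s) * real (6 * k n) \<le> ln (1 / s) * (6 * (\<beta> * ln n + 1))"
        using s by (intro mult_left_mono) auto
      then show ?thesis by (simp add: D_def algebra_simps)
    qed
    finally have 1: "(1 / s) ^ (6 * k n) \<le> exp (D * (\<beta> * ln n + 1))" .
    have "(1 - \<kappa>) / n * (1 - 2 * s) = e1 / n" by (simp add: e1_def)
    have e1n: "e1 / n \<le> 1" using e1 elim by (simp add: field_simps)
    have "(1 - e1 / n) ^ (L n - 2 * J n) \<le> exp (- (e1 / n)) ^ (L n - 2 * J n)"
      using e1n exp_ge_add_one_self[of "- (e1 / n)"] by (intro power_mono) auto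
    also have "\<dots> = exp (- (e1 / n) * (L n - 2 * J n))" by (rule exp_of_nat2_mult[symmetric])
    also have "\<dots> \<le> exp (- (e1 * (1 + \<epsilon> - 2 * \<eta>) * ln n) + 1)"
    proof -
      have "(1 + \<epsilon>) * n * ln n - 1 \<le> real (L n)" 
        unfolding L_def by linarith
      moreover have "real (J n) \<le> \<eta> * n * ln n"
        unfolding J_def using \<eta> ln0 by (simp add: of_nat_nat)
      ultimately have "(1 + \<epsilon> - 2 * \<eta>) * n * ln n - 1 \<le> real (L n) - 2 * real (J n)"
        by (simp add: algebra_simps)
      also have "\<dots> \<le> real (L n - 2 * J n)" by linarith
      finally have "e1 / n * ((1 + \<epsilon> - 2 * \<eta>) * n * ln n - 1) \<le> e1 / n * real (L n - 2 * J n)"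
        using e1 by (intro mult_left_mono) auto
      moreover have "e1 / n * ((1 + \<epsilon> - 2 * \<eta>) * n * ln n - 1) = e1 * (1 + \<epsilon> - 2 * \<eta>) * ln n - e1 / n"
        using elim by (simp add: field_simps)
      ultimately show ?thesis using e1n by simp
    qed
    finally have 2: "(1 - (1 - \<kappa>) / n * (1 - 2 * s)) ^ (L n - 2 * J n) \<le> exp (- (e1 * (1 + \<epsilon> - 2 * \<eta>) * ln n) + 1)"
      by (simp add: e1_def)
    have "real n * (2 * (1 / s) ^ (6 * k n) * (1 - (1 - \<kappa>) / n * (1 - 2 * s)) ^ (L n - 2 * J n))
       \<le> exp (ln n) * (2 * exp (D * (\<beta> * ln n + 1)) * exp (- (e1 * (1 + \<epsilon> - 2 * \<eta>) * ln n) + 1))"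
      using 1 2 e1n elim s by (intro mult_mono) (auto simp: e1_def)
    also have "\<dots> = 2 * exp (ln n + D * (\<beta> * ln n + 1) + (- (e1 * (1 + \<epsilon> - 2 * \<eta>) * ln n) + 1))"
    proof -
      have "exp a * (2 * exp b * exp c) = 2 * exp (a + b + c)" for a b c :: real by (simp add: exp_add)
      then show ?thesis .
    qed
    also have "\<dots> \<le> 2 * exp ((D + 1) + (- (\<epsilon> / 4) * ln n))"
    proof -
      have "(1 + D * \<beta> - e1 * (1 + \<epsilon> - 2 * \<eta>)) * ln n \<le> - (\<epsilon> / 4) * ln n"
        using \<beta> e ln0 by (intro mult_right_mono) (auto simp: D_def e1_def field_simps)
      then show ?thesis by (simp add: algebra_simps)
    qed
    finally show ?case by (simp only: exp_add mult.assoc)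
  qed
  have 1: "(\<lambda>n. real n * (2 * (1 / s) ^ (6 * k n) * (1 - (1 - \<kappa>) / n * (1 - 2 * s)) ^ (L n - 2 * J n))) \<longlonglongrightarrow> 0"
  proof (rule tendsto_sandwich[OF _ ev1 tendsto_const])
    have "(1 - \<kappa>) / n * (1 - 2 * s) \<le> 1" if "n \<ge> 1" for n :: nat
      using e1 that unfolding e1_def by (simp add: field_simps)
    then show "\<forall>\<^sub>F n in sequentially. 0 \<le> real n * (2 * (1 / s) ^ (6 * k n) * (1 - (1 - \<kappa>) / n * (1 - 2 * s)) ^ (L n - 2 * J n))"
      using s by (intro eventually_mono[OF eventually_ge_at_top[of 1]]) simp
    show "(\<lambda>n. 2 * exp (D + 1) * exp (- (\<epsilon> / 4) * ln (real n))) \<longlonglongrightarrow> 0"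
      using \<epsilon> by real_asymp
  qed
  have 2: "(\<lambda>n. (1 + 1 / real n ^ 3) ^ n - 1) \<longlonglongrightarrow> 0" by real_asymp
  have 3: "(\<lambda>n. 2 ^ n * (2 ^ n * (11 / 12) powr (\<kappa> * real n * (\<beta> * ln n)))) \<longlonglongrightarrow> 0"
  proof -
    define l where "l = - ln (11 / 12 :: real)"
    have l: "0 < l" by (simp add: l_def)
    have eq: "2 ^ n * (2 ^ n * (11 / 12) powr (\<kappa> * real n * (\<beta> * ln n))) =
        exp (2 * ln 2 * n - l * (\<kappa> * real n * (\<beta> * ln n)))" for n :: nat
    proof -
      have "(2 :: real) ^ n = exp (ln 2 * n)" by (simp add: exp_of_nat2_mult)
      moreover have "(11 / 12 :: real) powr (\<kappa> * real n * (\<beta> * ln n)) = exp (- l * (\<kappa> * real n * (\<beta> * ln n)))"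
        by (simp add: powr_def l_def)
      ultimately show ?thesis by (simp only: exp_add[symmetric]) (simp add: algebra_simps)
    qed
    show ?thesis unfolding eq using l \<kappa> \<beta> by real_asymp
  qed
  have 4: "(\<lambda>n. 2 ^ n * (449 / 450 :: real) ^ J n) \<longlonglongrightarrow> 0"
  proof (rule tendsto_sandwich[OF _ _ tendsto_const])
    define l where "l = - ln (449 / 450 :: real)"
    have l: "0 < l" by (simp add: l_def)
    show "(\<lambda>n. exp (ln 2 * n - l * (\<eta> * n * ln n - 1))) \<longlonglongrightarrow> 0"
      using l \<eta> by real_asymp
    show "\<forall>\<^sub>F n in sequentially. 2 ^ n * (449 / 450 :: real) ^ J n \<le> exp (ln 2 * n - l * (\<eta> * n * ln n - 1))"
      using eventually_ge_at_top[of 3]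
    proof eventually_elim
      case (elim n)
      have "\<eta> * n * ln n - 1 \<le> real (J n)" unfolding J_def by linarith
      then have "l * (\<eta> * n * ln n - 1) \<le> l * real (J n)" using l by (intro mult_left_mono) auto
      then have "exp (ln 2 * n - l * real (J n)) \<le> exp (ln 2 * n - l * (\<eta> * n * ln n - 1))" by simp
      moreover have "exp (ln 2 * n - l * real (J n)) = 2 ^ n * (449 / 450 :: real) ^ J n"
      proof -
        have "exp (ln 2 * n) = (2 :: real) ^ n" by (simp add: exp_of_nat2_mult)
        moreover have "exp (- l * real (J n)) = (449 / 450 :: real) ^ J n"
          unfolding l_def by (simp only: exp_of_nat2_mult minus_minus) simp
        moreover have "exp (ln 2 * n - l * real (J n)) = exp (ln 2 * n) * exp (- l * real (J n))"
          by (simp flip: exp_add)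
        ultimately show ?thesis by (simp only:)
      qed
      ultimately show ?case by simp
    qed
  qed auto
  show ?thesis using tendsto_add[OF tendsto_add[OF tendsto_add[OF 1 2] 3] 4] by simp
qed

text \<open>The bound \<open>b\<close> is uniform in \<open>Q\<close> and \<open>v\<close>, so the
  kernel may depend on \<open>n\<close>, on the edge probability and on the starting vertex, as the
  annealed kernel does.\<close>

theorem adaptive_walk_good:
  fixes \<epsilon> :: real
  assumes \<epsilon>: "0 < \<epsilon>"
  shows "\<exists>\<beta>>0. \<exists>\<kappa>>0. \<kappa> < 1 \<and> (\<exists>b::nat \<Rightarrow> real. b \<longlonglongrightarrow> 0 \<and> (\<forall>\<^sub>F n in sequentially. \<forall>Q v.
     spread_kernel n ((1 - \<kappa>) / n) Q \<longrightarrow> (\<forall>xs. set_pmf (Q xs) \<subseteq> {1..n}) \<longrightarrow> v \<in> {1..n} \<longrightarrow>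
     measure_pmf.prob (adaptive_walk Q v (nat \<lfloor>(1 + \<epsilon>) * real n * ln n\<rfloor>))
       {xs. deficient n (nat \<lceil>\<beta> * ln n\<rceil>) xs} \<le> b n))"
proof -
  \<comment> \<open>Both \<open>2 * s\<close> and \<open>\<kappa>\<close> are at most
    \<open>\<tau>\<close>, and \<open>2 * \<eta> \<le> \<epsilon> / 4\<close>; two factors
    \<open>1 - \<tau>\<close> taken from \<open>1 + 3 * \<epsilon> / 4\<close> still leave
    \<open>1 + \<epsilon> / 2\<close>. Then \<open>s\<close> determines \<open>\<beta>\<close>, and
    \<open>\<kappa>\<close> comes last: \<open>9 * \<kappa> \<le> exp (- 1 / \<beta>)\<close> makes
    \<open>(9 * \<kappa>) ^ (3 * k)\<close> at most \<open>1 / n ^ 3\<close> for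
    \<open>k \<ge> \<beta> * ln n\<close>.\<close>
  define \<tau> where "\<tau> = \<epsilon> / (16 * (1 + \<epsilon>))"
  have \<tau>: "0 < \<tau>" "\<tau> < 1 / 9" using \<epsilon> by (auto simp: \<tau>_def field_simps)
  define s where "s = \<tau> / 2"
  define \<eta> where "\<eta> = min (\<epsilon> / 8) (1 / 2)"
  define \<beta> where "\<beta> = \<epsilon> / (24 * ln (1 / s))"
  define \<kappa> where "\<kappa> = min \<tau> (exp (- 1 / \<beta>) / 9)"
  have s: "0 < s" "s < 1 / 2" using \<tau> by (auto simp: s_def)
  have ls: "0 < ln (1 / s)" using s by simp
  have \<beta>: "0 < \<beta>" using \<epsilon> ls by (auto simp: \<beta>_def intro!: divide_pos_pos mult_pos_pos)
  have \<beta>2: "6 * \<beta> * ln (1 / s) \<le> \<epsilon> / 4" using ls unfolding \<beta>_def by (simp del: ln_div add: field_simps)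
  have \<kappa>: "0 < \<kappa>" "\<kappa> \<le> 1 / 9" "\<kappa> \<le> \<tau>" "9 * \<kappa> \<le> exp (- 1 / \<beta>)" using \<tau> by (auto simp: \<kappa>_def)
  have \<eta>: "0 < \<eta>" "\<eta> \<le> 1 / 2" using \<epsilon> by (auto simp: \<eta>_def)
  have e: "1 + \<epsilon> / 2 \<le> (1 - \<kappa>) * (1 - 2 * s) * (1 + \<epsilon> - 2 * \<eta>)"
  proof -
    have "2 * \<tau> * (1 + \<epsilon>) = \<epsilon> / 8" using \<epsilon> by (simp add: \<tau>_def field_simps)
    then have "1 + \<epsilon> / 2 \<le> 1 + 3 * \<epsilon> / 4 - 2 * \<tau> * (1 + \<epsilon>)" using \<epsilon> by simp
    also have "\<dots> \<le> 1 + 3 * \<epsilon> / 4 - 2 * \<tau> * (1 + 3 * \<epsilon> / 4)"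
      using \<epsilon> \<tau> by (intro diff_left_mono mult_left_mono) auto
    also have "\<dots> = (1 - 2 * \<tau>) * (1 + 3 * \<epsilon> / 4)" by (simp add: field_simps)
    also have "\<dots> \<le> ((1 - \<tau>) * (1 - \<tau>)) * (1 + 3 * \<epsilon> / 4)"
      using \<epsilon> by (intro mult_right_mono) (auto simp: algebra_simps)
    also have "\<dots> \<le> ((1 - \<kappa>) * (1 - 2 * s)) * (1 + \<epsilon> - 2 * \<eta>)"
      using \<epsilon> \<tau> \<kappa> by (intro mult_mono) (auto simp: s_def \<eta>_def)
    finally show ?thesis .
  qed
  note lim = adaptive_walk_asymptotics[OF \<epsilon> s \<beta> \<beta>2 \<kappa>(1,2) \<eta> e]
  show ?thesis
  proof (rule exI[of _ \<beta>], rule conjI[OF \<beta>], rule exI[of _ \<kappa>], intro conjI exI)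
    show "0 < \<kappa>" "\<kappa> < 1" using \<kappa> by auto
    have "\<forall>\<^sub>F n::nat in sequentially. 12 * (\<beta> * ln n + 1) \<le> n" by real_asymp
    moreover have "\<forall>\<^sub>F n::nat in sequentially. 2 * (\<beta> * ln n + 1) \<le> \<kappa> * n" using \<kappa> by real_asymp
    ultimately show "\<forall>\<^sub>F n in sequentially. \<forall>Q v.
     spread_kernel n ((1 - \<kappa>) / n) Q \<longrightarrow> (\<forall>xs. set_pmf (Q xs) \<subseteq> {1..n}) \<longrightarrow> v \<in> {1..n} \<longrightarrow>
     measure_pmf.prob (adaptive_walk Q v (nat \<lfloor>(1 + \<epsilon>) * real n * ln n\<rfloor>))
       {xs. deficient n (nat \<lceil>\<beta> * ln n\<rceil>) xs} \<le>
       real n * (2 * (1 / s) ^ (6 * nat \<lceil>\<beta> * ln n\<rceil>) * (1 - (1 - \<kappa>) / n * (1 - 2 * s)) ^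
          (nat \<lfloor>(1 + \<epsilon>) * n * ln n\<rfloor> - 2 * nat \<lfloor>\<eta> * n * ln n\<rfloor>))
        + ((1 + 1 / n ^ 3) ^ n - 1) + 2 ^ n * (2 ^ n * (11 / 12) powr (\<kappa> * n * (\<beta> * ln n)))
        + 2 ^ n * (449 / 450) ^ nat \<lfloor>\<eta> * n * ln n\<rfloor>"
      using eventually_ge_at_top[of 48]
    proof (eventually_elim, intro allI impI)
      fix n :: nat and Q v
      assume n: "12 * (\<beta> * ln n + 1) \<le> n" "2 * (\<beta> * ln n + 1) \<le> \<kappa> * n" "48 \<le> n"
        and Q: "spread_kernel n ((1 - \<kappa>) / n) Q" and range: "\<forall>xs. set_pmf (Q xs) \<subseteq> {1..n}" "v \<in> {1..n}"
      define k where "k = nat \<lceil>\<beta> * ln n\<rceil>"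
      define L where "L = nat \<lfloor>(1 + \<epsilon>) * n * ln n\<rfloor>"
      define J where "J = nat \<lfloor>\<eta> * n * ln n\<rfloor>"
      have ln0: "0 < ln (real n)" using n by simp
      have kl: "\<beta> * ln n \<le> k" "k \<le> \<beta> * ln n + 1" "0 < k"
        using \<beta> ln0 unfolding k_def by (auto simp: of_nat_nat real_nat_ceiling_ge)
      have "real (12 * k) \<le> real n" using kl n(1) by simp
      then have k2: "12 * k \<le> n" by (simp only: of_nat_le_iff)
      have "(2 * \<eta>) * n * ln n \<le> (1 + \<epsilon>) * n * ln n" using \<eta> \<epsilon> ln0 by (intro mult_right_mono) auto
      moreover have "real J \<le> \<eta> * n * ln n" unfolding J_def using \<eta> ln0 by (simp add: of_nat_nat)
      ultimately have "real (2 * J) \<le> (1 + \<epsilon>) * n * ln n" by simp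
      then have "2 * J \<le> L" unfolding L_def by linarith
      then have L: "L = (L - 2 * J) + 2 * J" by simp
      have x: "(9 * \<kappa>) ^ (3 * k) \<le> 1 / n ^ 3"
      proof -
        have "(9 * \<kappa>) ^ (3 * k) \<le> exp (- 1 / \<beta>) ^ (3 * k)" using \<kappa> by (intro power_mono) auto
        also have "\<dots> = exp (- (3 / \<beta>) * k)" by (simp add: exp_of_nat2_mult[symmetric] mult_ac)
        also have "\<dots> \<le> exp (- (3 / \<beta>) * (\<beta> * ln n))"
        proof -
          have "3 / \<beta> * (\<beta> * ln n) \<le> 3 / \<beta> * k" using kl \<beta> by (intro mult_left_mono) auto
          then show ?thesis by simp
        qed
        also have "\<dots> = 1 / n ^ 3" using \<beta> n(3) by (simp add: exp_minus exp_of_nat_mult[of 3, simplified] field_simps)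
        finally show ?thesis .
      qed
      have y: "(11 / 12) powr (\<kappa> * n * k) \<le> (11 / 12) powr (\<kappa> * n * (\<beta> * ln n))"
        using kl \<kappa> by (intro powr_mono') (auto intro!: mult_left_mono)
      have "measure_pmf.prob (adaptive_walk Q v L)
         {xs. deficient n k xs}
         \<le> real n * (2 * (1 / s) ^ (6 * k) * (1 - (1 - \<kappa>) / n * (1 - 2 * s)) ^ (L - 2 * J))
        + ((1 + 1 / n ^ 3) ^ n - 1) + 2 ^ n * (2 ^ n * (11 / 12) powr (\<kappa> * n * (\<beta> * ln n))) + 2 ^ n * (449 / 450) ^ J"
        by (subst L, rule adaptive_walk_fail[OF Q])
          (use range \<kappa> n kl k2 s x y in auto)
      then show "measure_pmf.prob (adaptive_walk Q v (nat \<lfloor>(1 + \<epsilon>) * real n * ln n\<rfloor>))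
       {xs. deficient n (nat \<lceil>\<beta> * ln n\<rceil>) xs} \<le>
       real n * (2 * (1 / s) ^ (6 * nat \<lceil>\<beta> * ln n\<rceil>) * (1 - (1 - \<kappa>) / n * (1 - 2 * s)) ^
          (nat \<lfloor>(1 + \<epsilon>) * n * ln n\<rfloor> - 2 * nat \<lfloor>\<eta> * n * ln n\<rfloor>))
        + ((1 + 1 / n ^ 3) ^ n - 1) + 2 ^ n * (2 ^ n * (11 / 12) powr (\<kappa> * n * (\<beta> * ln n)))
        + 2 ^ n * (449 / 450) ^ nat \<lfloor>\<eta> * n * ln n\<rfloor>"
        unfolding k_def L_def J_def .
    qed
  qed (rule lim)
qed

section \<open>Chernoff bounds for the random graph\<close>

lemma finite_all_edges [simp]: "finite (all_edges n)"
  by (rule finite_subset[of _ "Pow {1..n}"]) (auto simp: all_edges_def)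

lemma set_pmf_gnp: "set_pmf (gnp n p) \<subseteq> Pow (all_edges n)"
  by (auto simp: gnp_def)

lemma finite_set_pmf_gnp [simp]: "finite (set_pmf (gnp n p))"
  by (rule finite_subset[OF set_pmf_gnp]) simp

lemma integrable_gnp [simp]: "integrable (measure_pmf (gnp n p)) (h :: _ \<Rightarrow> real)"
  by (rule integrable_measure_pmf_finite) simp

text \<open>The edge \<open>e\<close> is independent of all others, so overwriting it by a fresh
  coin keeps the law. This turns questions about one edge into a comparison of the same graph with
  and without it.\<close>

lemma gnp_resample:
  assumes e: "e \<in> all_edges n"
  shows "gnp n p = bind_pmf (gnp n p) (\<lambda>E. map_pmf (\<lambda>b. if b then insert e E else E - {e}) (bernoulli_pmf p))"
proof -
  define A where "A = all_edges n - {e}"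
  have A: "finite A" "e \<notin> A" "all_edges n = insert e A" using e by (auto simp: A_def)
  have gnp: "gnp n p = bind_pmf (Pi_pmf A False (\<lambda>_. bernoulli_pmf p))
      (\<lambda>f. map_pmf (\<lambda>b. if b then insert e {x \<in> A. f x} else {x \<in> A. f x}) (bernoulli_pmf p))"
  proof -
    have "gnp n p = bind_pmf (bernoulli_pmf p) (\<lambda>b. bind_pmf (Pi_pmf A False (\<lambda>_. bernoulli_pmf p))
        (\<lambda>f. return_pmf {x \<in> insert e A. (f(e := b)) x}))"
      unfolding gnp_def A(3) Pi_pmf_insert'[OF A(1,2)] by (simp add: map_bind_pmf)
    also have "\<dots> = bind_pmf (Pi_pmf A False (\<lambda>_. bernoulli_pmf p)) (\<lambda>f. bind_pmf (bernoulli_pmf p)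
        (\<lambda>b. return_pmf {x \<in> insert e A. (f(e := b)) x}))"
      by (rule bind_commute_pmf)
    also have "\<dots> = bind_pmf (Pi_pmf A False (\<lambda>_. bernoulli_pmf p)) (\<lambda>f. bind_pmf (bernoulli_pmf p)
        (\<lambda>b. return_pmf (if b then insert e {x \<in> A. f x} else {x \<in> A. f x})))"
      using A(2) by (intro bind_pmf_cong refl arg_cong[where f = return_pmf]) auto
    finally show ?thesis by (simp add: map_pmf_def)
  qed
  have "bind_pmf (gnp n p) (\<lambda>E. map_pmf (\<lambda>b. if b then insert e E else E - {e}) (bernoulli_pmf p)) =
     bind_pmf (Pi_pmf A False (\<lambda>_. bernoulli_pmf p)) (\<lambda>f. bind_pmf (bernoulli_pmf p) (\<lambda>b0.
        map_pmf (\<lambda>b. if b then insert e {x \<in> A. f x} else {x \<in> A. f x}) (bernoulli_pmf p)))"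
    unfolding gnp bind_assoc_pmf bind_map_pmf using A(2)
    by (intro bind_pmf_cong map_pmf_cong refl) auto
  also have "\<dots> = gnp n p" unfolding gnp by simp
  finally show ?thesis by simp
qed

lemma gnp_expectation_resample:
  fixes h :: "nat set set \<Rightarrow> real"
  assumes e: "e \<in> all_edges n" and p: "0 \<le> p" "p \<le> 1"
  shows "measure_pmf.expectation (gnp n p) h =
     measure_pmf.expectation (gnp n p) (\<lambda>E. p * h (insert e E) + (1 - p) * h (E - {e}))"
proof -
  have "measure_pmf.expectation (gnp n p) h = measure_pmf.expectation (bind_pmf (gnp n p)
     (\<lambda>E. map_pmf (\<lambda>b. if b then insert e E else E - {e}) (bernoulli_pmf p))) h"
    by (subst gnp_resample[OF e]) simp
  also have "\<dots> = measure_pmf.expectation (gnp n p)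
     (\<lambda>E. measure_pmf.expectation (map_pmf (\<lambda>b. if b then insert e E else E - {e}) (bernoulli_pmf p)) h)"
    by (rule pmf_expectation_bind[where A = "set_pmf (gnp n p)", THEN trans])
       (auto simp: integral_measure_pmf_real[where A = "set_pmf (gnp n p)"] mult.commute)
  also have "\<dots> = measure_pmf.expectation (gnp n p) (\<lambda>E. p * h (insert e E) + (1 - p) * h (E - {e}))"
    using p by (intro Bochner_Integration.integral_cong) (auto simp: integral_bernoulli_pmf)
  finally show ?thesis .
qed

lemma gnp_exp_moment:
  fixes l p :: real
  assumes F: "F \<subseteq> all_edges n" and p: "0 \<le> p" "p \<le> 1"
  shows "measure_pmf.expectation (gnp n p) (\<lambda>E. exp (l * card (E \<inter> F))) = (1 + p * (exp l - 1)) ^ card F"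
proof -
  have "finite F" using F finite_subset finite_all_edges by blast
  then show ?thesis using F
  proof (induction F)
    case (insert e F)
    have 2: "(E - {e}) \<inter> insert e F = E \<inter> F" for E using insert.hyps by auto
    have "measure_pmf.expectation (gnp n p) (\<lambda>E. exp (l * card (E \<inter> insert e F))) =
       measure_pmf.expectation (gnp n p) (\<lambda>E. (1 + p * (exp l - 1)) * exp (l * card (E \<inter> F)))"
      by (subst gnp_expectation_resample[of e]) 
         (use insert.prems insert.hyps p in \<open>auto simp: 2 algebra_simps exp_add\<close>)
    also have "\<dots> = (1 + p * (exp l - 1)) * (1 + p * (exp l - 1)) ^ card F"
      using insert by simp
    finally show ?case using insert.hyps by simp
  qed simp
qed

text \<open>The sign of \<open>l\<close> is left open: positive \<open>l\<close> gives the upper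
  tail, negative \<open>l\<close> the lower one.\<close>

lemma gnp_chernoff:
  fixes l a p :: real
  assumes F: "F \<subseteq> all_edges n" and p: "0 \<le> p" "p \<le> 1"
  shows "measure_pmf.prob (gnp n p) {E. l * a \<le> l * card (E \<inter> F)} \<le> exp (p * (exp l - 1) * card F - l * a)"
proof -
  have "measure_pmf.prob (gnp n p) {E. l * a \<le> l * card (E \<inter> F)} \<le>
      (1 + p * (exp l - 1)) ^ card F / exp (l * a)"
  proof (rule pmf_markov[where F = "\<lambda>E. exp (l * card (E \<inter> F))"])
    show "(\<integral>\<^sup>+E. ennreal (exp (l * card (E \<inter> F))) \<partial>gnp n p) \<le> ennreal ((1 + p * (exp l - 1)) ^ card F)"
      using gnp_exp_moment[OF F p, of l] by (simp add: nn_integral_eq_integral)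
    have "0 \<le> (1 - p) + p * exp l" using p by (intro add_nonneg_nonneg mult_nonneg_nonneg) auto
    then show "0 \<le> (1 + p * (exp l - 1)) ^ card F" by (intro zero_le_power) (simp add: algebra_simps)
  qed auto
  also have "\<dots> \<le> exp (p * (exp l - 1)) ^ card F / exp (l * a)"
  proof (intro divide_right_mono power_mono)
    have "0 \<le> (1 - p) + p * exp l" using p by (intro add_nonneg_nonneg mult_nonneg_nonneg) auto
    then show "0 \<le> 1 + p * (exp l - 1)" by (simp add: algebra_simps)
  qed auto
  also have "\<dots> = exp (p * (exp l - 1) * card F - l * a)"
    by (simp only: exp_of_nat2_mult exp_diff)
  finally show ?thesis .
qed

lemma card_Int_image:
  "inj_on f I \<Longrightarrow> card (E \<inter> f ` I) = card {i \<in> I. f i \<in> E}"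
proof -
  assume f: "inj_on f I"
  have "E \<inter> f ` I = f ` {i \<in> I. f i \<in> E}" by auto
  then show ?thesis using f by (metis (no_types, lifting) card_image inj_on_subset mem_Collect_eq subsetI)
qed

lemma gnp_upper_tail:
  fixes p \<delta> :: real and m :: nat
  assumes F: "F \<subseteq> all_edges n" and p: "0 \<le> p" "p \<le> 1" and \<delta>: "0 < \<delta>" "\<delta> \<le> 1" and c: "card F \<le> m"
  shows "measure_pmf.prob (gnp n p) {E. (1 + \<delta>) * m * p < card (E \<inter> F)} \<le> exp (- \<delta>\<^sup>2 * m * p / 4)"
proof -
  \<comment> \<open>Minimises \<open>l\<^sup>2 - l * \<delta>\<close>, the exponent left after
    \<open>exp l - 1 \<le> l + l\<^sup>2\<close>.\<close>
  define l where "l = \<delta> / 2"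
  have l: "0 < l" "l \<le> 1" using \<delta> by (auto simp: l_def)
  have "measure_pmf.prob (gnp n p) {E. (1 + \<delta>) * m * p < card (E \<inter> F)} \<le>
     measure_pmf.prob (gnp n p) {E. l * ((1 + \<delta>) * m * p) \<le> l * card (E \<inter> F)}"
    using l by (intro measure_pmf.finite_measure_mono) auto
  also have "\<dots> \<le> exp (p * (exp l - 1) * card F - l * ((1 + \<delta>) * m * p))"
    by (rule gnp_chernoff[OF F p])
  also have "\<dots> \<le> exp (p * (l + l\<^sup>2) * m - l * ((1 + \<delta>) * m * p))"
    using exp_bound[of l] l p c by (auto intro!: mult_mono)
  also have "p * (l + l\<^sup>2) * m - l * ((1 + \<delta>) * m * p) = - \<delta>\<^sup>2 * m * p / 4"
    by (simp add: l_def algebra_simps power2_eq_square)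
  finally show ?thesis .
qed

text \<open>A vertex has \<open>n - 1\<close> possible neighbours while degrees are measured against
  \<open>n * p\<close>. In this direction the missing unit works against the bound, and it costs at
  most 1 in the exponent since \<open>p * (l - l\<^sup>2) \<le> 1\<close>.\<close>

lemma gnp_lower_tail:
  fixes p \<delta> :: real and m :: nat
  assumes F: "F \<subseteq> all_edges n" and p: "0 \<le> p" "p \<le> 1" and \<delta>: "0 < \<delta>" "\<delta> \<le> 1" and c: "m \<le> card F + 1"
  shows "measure_pmf.prob (gnp n p) {E. card (E \<inter> F) < (1 - \<delta>) * m * p} \<le> exp (1 - \<delta>\<^sup>2 * m * p / 4)"
proof -
  define l where "l = \<delta> / 2"
  have l: "0 < l" "l \<le> 1" using \<delta> by (auto simp: l_def)
  have "1 \<le> (1 + l) * (1 - l + l\<^sup>2)" using l by (simp add: algebra_simps power2_eq_square)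
  then have "1 / (1 + l) \<le> 1 - l + l\<^sup>2" using l by (simp add: field_simps)
  moreover have "exp (- l) \<le> 1 / (1 + l)"
    using exp_ge_add_one_self[of l] l by (simp add: exp_minus field_simps)
  ultimately have el: "exp (- l) - 1 \<le> - (l - l\<^sup>2)" by simp
  have ll: "0 \<le> l - l\<^sup>2" "l - l\<^sup>2 \<le> 1" using l by (auto simp: power2_eq_square mult_left_le_one_le intro: order_trans[of _ l])
  have "measure_pmf.prob (gnp n p) {E. card (E \<inter> F) < (1 - \<delta>) * m * p} \<le>
     measure_pmf.prob (gnp n p) {E. (- l) * ((1 - \<delta>) * m * p) \<le> (- l) * card (E \<inter> F)}"
    using l by (intro measure_pmf.finite_measure_mono) auto
  also have "\<dots> \<le> exp (p * (exp (- l) - 1) * card F - (- l) * ((1 - \<delta>) * m * p))"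
    by (rule gnp_chernoff[OF F p])
  also have "\<dots> \<le> exp (1 - \<delta>\<^sup>2 * m * p / 4)"
  proof -
    have "p * (exp (- l) - 1) * card F \<le> p * (- (l - l\<^sup>2)) * card F"
      using el p by (intro mult_right_mono mult_left_mono) auto
    moreover have "(p * (l - l\<^sup>2)) * (real m - 1) \<le> (p * (l - l\<^sup>2)) * card F"
      using ll p c by (intro mult_left_mono) auto
    moreover have "p * (l - l\<^sup>2) \<le> 1" using ll p mult_mono[of p 1 "l - l\<^sup>2" 1] by simp
    ultimately have "p * (exp (- l) - 1) * card F + l * ((1 - \<delta>) * m * p)
        \<le> - (p * (l - l\<^sup>2)) * m + 1 + l * ((1 - \<delta>) * m * p)"
      by (simp add: algebra_simps)
    also have "\<dots> = 1 - \<delta>\<^sup>2 * m * p / 4" by (simp add: l_def algebra_simps power2_eq_square)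
    finally show ?thesis by simp
  qed
  finally show ?thesis .
qed

definition degrees_within :: "nat \<Rightarrow> real \<Rightarrow> real \<Rightarrow> nat set set \<Rightarrow> bool" where
  "degrees_within n a b E \<longleftrightarrow>
     (\<forall>x\<in>{1..n}. a \<le> real (card (neighbours E x)) \<and> real (card (neighbours E x)) \<le> b)"

lemma card_neighbours:
  assumes "E \<subseteq> all_edges n" "x \<in> {1..n}"
  shows "card (neighbours E x) = card (E \<inter> (\<lambda>y. {x, y}) ` ({1..n} - {x}))"
proof -
  have "neighbours E x = {y \<in> {1..n} - {x}. {x, y} \<in> E}"
    using assms by (auto simp: neighbours_def all_edges_def)
  moreover have "inj_on (\<lambda>y. {x, y}) ({1..n} - {x})" by (auto simp: inj_on_def doubleton_eq_iff)
  ultimately show ?thesis by (simp add: card_Int_image)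
qed

lemma gnp_degrees:
  fixes p \<delta> :: real
  assumes p: "0 \<le> p" "p \<le> 1" and \<delta>: "0 < \<delta>" "\<delta> \<le> 1"
  shows "measure_pmf.prob (gnp n p) {E. \<not> degrees_within n ((1 - \<delta>) * n * p) ((1 + \<delta>) * n * p) E}
           \<le> n * (4 * exp (- \<delta>\<^sup>2 * n * p / 4))"
proof -
  let ?M = "gnp n p"
  define F where "F x = (\<lambda>y. {x, y}) ` ({1..n} - {x})" for x
  define U where "U x = {E. (1 + \<delta>) * n * p < card (E \<inter> F x)} \<union> {E. card (E \<inter> F x) < (1 - \<delta>) * n * p}" for x
  have F: "F x \<subseteq> all_edges n" "card (F x) = n - 1" if "x \<in> {1..n}" for x
  proof -
    show "F x \<subseteq> all_edges n" using that by (auto simp: F_def all_edges_def card_2_iff)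
    have "inj_on (\<lambda>y. {x, y}) ({1..n} - {x})" by (auto simp: inj_on_def doubleton_eq_iff)
    then show "card (F x) = n - 1" using that by (simp add: F_def card_image)
  qed
  have "measure_pmf.prob ?M {E. \<not> degrees_within n ((1 - \<delta>) * n * p) ((1 + \<delta>) * n * p) E}
    = measure_pmf.prob ?M ({E. \<not> degrees_within n ((1 - \<delta>) * n * p) ((1 + \<delta>) * n * p) E} \<inter> set_pmf ?M)"
    by (simp add: measure_Int_set_pmf)
  also have "\<dots> \<le> measure_pmf.prob ?M (\<Union>x\<in>{1..n}. U x)"
    using set_pmf_gnp[of n p] card_neighbours[of _ n]
    by (intro measure_pmf.finite_measure_mono)
      (auto simp: degrees_within_def U_def F_def not_le subset_eq)
  also have "\<dots> \<le> (\<Sum>x\<in>{1..n}. measure_pmf.prob ?M (U x))"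
    by (rule measure_pmf.finite_measure_subadditive_finite) auto
  also have "\<dots> \<le> (\<Sum>x\<in>{1..n}. 4 * exp (- \<delta>\<^sup>2 * n * p / 4))"
  proof (rule sum_mono)
    fix x assume x: "x \<in> {1..n}"
    have "measure_pmf.prob ?M (U x) \<le> measure_pmf.prob ?M {E. (1 + \<delta>) * n * p < card (E \<inter> F x)}
       + measure_pmf.prob ?M {E. card (E \<inter> F x) < (1 - \<delta>) * n * p}"
      unfolding U_def by (rule measure_Un_le) auto
    also have "\<dots> \<le> exp (- \<delta>\<^sup>2 * n * p / 4) + exp (1 - \<delta>\<^sup>2 * n * p / 4)"
      using F[OF x] by (intro add_mono gnp_upper_tail gnp_lower_tail p \<delta>) auto
    also have "exp (1 - \<delta>\<^sup>2 * n * p / 4) = exp 1 * exp (- \<delta>\<^sup>2 * n * p / 4)"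
      by (simp flip: exp_add)
    also have "\<dots> \<le> 3 * exp (- \<delta>\<^sup>2 * n * p / 4)"
      using exp_le by (intro mult_right_mono) auto
    finally show "measure_pmf.prob ?M (U x) \<le> 4 * exp (- \<delta>\<^sup>2 * n * p / 4)" by simp
  qed
  finally show ?thesis by simp
qed

section \<open>Edge expansion of the random graph\<close>

definition cut_expander :: "nat \<Rightarrow> real \<Rightarrow> nat set set \<Rightarrow> bool" where
  "cut_expander n c E \<longleftrightarrow> (\<forall>S\<subseteq>{1..n}. 2 * card S \<le> n \<longrightarrow>
     c * card S \<le> real (card {(x, y) \<in> S \<times> ({1..n} - S). {x, y} \<in> E}))"

text \<open>Chernoff with \<open>l = - 1\<close>: a cut has at least \<open>card S * n / 2\<close>
  possible edges, so the exponent is at most \<open>- n * p * card S / 4\<close> plus the allowance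
  \<open>n * p * card S / 8\<close> of the event. The result is geometric in \<open>card S\<close>,
  and the union bound becomes a binomial sum.\<close>

lemma gnp_cut_expander:
  fixes p :: real
  assumes p: "0 \<le> p" "p \<le> 1"
  shows "measure_pmf.prob (gnp n p) {E. \<not> cut_expander n (n * p / 8) E}
           \<le> (1 + exp (- real n * p / 8)) ^ n - 1"
proof -
  let ?M = "gnp n p"
  define I where "I S = S \<times> ({1..n} - S)" for S
  define F where "F S = (\<lambda>(x, y). {x, y}) ` I S" for S
  define \<S> where "\<S> = {S \<in> Pow {1..n} - {{}}. 2 * card S \<le> n}"
  have inj: "inj_on (\<lambda>(x, y). {x, y}) (I S)" for S by (auto simp: inj_on_def doubleton_eq_iff I_def)
  have cF: "card {(x, y) \<in> S \<times> ({1..n} - S). {x, y} \<in> E} = card (E \<inter> F S)" for S E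
  proof -
    have "{(x, y) \<in> S \<times> ({1..n} - S). {x, y} \<in> E} = {z \<in> I S. (case z of (x, y) \<Rightarrow> {x, y}) \<in> E}"
      by (auto simp: I_def)
    then show ?thesis unfolding F_def using card_Int_image[OF inj] by simp
  qed
  have "measure_pmf.prob ?M {E. \<not> cut_expander n (n * p / 8) E}
     \<le> measure_pmf.prob ?M (\<Union>S\<in>\<S>. {E. card (E \<inter> F S) < n * p / 8 * card S})"
  proof (rule measure_pmf.finite_measure_mono)
    show "{E. \<not> cut_expander n (n * p / 8) E} \<subseteq> (\<Union>S\<in>\<S>. {E. card (E \<inter> F S) < n * p / 8 * card S})"
    proof
      fix E assume "E \<in> {E. \<not> cut_expander n (n * p / 8) E}"
      then obtain S where S: "S \<subseteq> {1..n}" "2 * card S \<le> n" "\<not> n * p / 8 * card S \<le> card (E \<inter> F S)"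
        unfolding cut_expander_def cF by blast
      then have "S \<noteq> {}" by auto
      then have "S \<in> \<S>" using S by (simp add: \<S>_def)
      then show "E \<in> (\<Union>S\<in>\<S>. {E. card (E \<inter> F S) < n * p / 8 * card S})"
        using S(3) by (intro UN_I[of S]) (simp_all add: not_le)
    qed
  qed simp
  also have "\<dots> \<le> (\<Sum>S\<in>\<S>. measure_pmf.prob ?M {E. card (E \<inter> F S) < n * p / 8 * card S})"
    by (rule measure_pmf.finite_measure_subadditive_finite) (auto simp: \<S>_def)
  also have "\<dots> \<le> (\<Sum>S\<in>\<S>. exp (- real n * p / 8) ^ card S)"
  proof (rule sum_mono)
    fix S assume S: "S \<in> \<S>"
    define a where "a = n * p / 8 * card S"
    have fS: "finite S" using S finite_subset by (auto simp: \<S>_def)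
    have FS: "F S \<subseteq> all_edges n" using S by (auto simp: F_def I_def \<S>_def all_edges_def card_2_iff)
    have "card (F S) = card (I S)" unfolding F_def by (rule card_image[OF inj])
    then have "card (F S) = card S * (n - card S)"
      using S fS unfolding I_def by (simp add: card_cartesian_product card_Diff_subset \<S>_def)
    moreover have "real (n - card S) = real n - card S" "real n / 2 \<le> real n - card S"
      using S by (auto simp: \<S>_def of_nat_diff)
    ultimately have cFS: "card S * (real n / 2) \<le> card (F S)"
      by (simp del: times_divide_eq_right add: mult_left_mono)
    have "measure_pmf.prob ?M {E. card (E \<inter> F S) < a} \<le> measure_pmf.prob ?M {E. (- 1) * a \<le> (- 1) * real (card (E \<inter> F S))}"
      by (intro measure_pmf.finite_measure_mono) auto
    also have "\<dots> \<le> exp (p * (exp (- 1) - 1) * card (F S) - (- 1) * a)"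
      by (rule gnp_chernoff[OF FS p])
    also have "\<dots> \<le> exp (- real n * p / 8 * card S)"
    proof -
      have "exp (- 1) \<le> (1 / 2 :: real)" using exp_ge_add_one_self[of 1] by (simp add: exp_minus field_simps)
      then have "p * (exp (- 1) - 1) * card (F S) \<le> p * (- (1 / 2)) * card (F S)"
        using p by (intro mult_right_mono mult_left_mono) auto
      also have "\<dots> \<le> p * (- (1 / 2)) * (card S * (real n / 2))"
        using p cFS by (intro mult_left_mono_neg) auto
      finally have "p * (exp (- 1) - 1) * card (F S) - (- 1) * a \<le> - real n * p / 8 * card S"
        by (simp add: a_def mult_ac)
      then show ?thesis by (simp only: exp_le_cancel_iff)
    qed
    also have "\<dots> = exp (- real n * p / 8) ^ card S" by (rule exp_of_nat2_mult)
    finally show "measure_pmf.prob ?M {E. card (E \<inter> F S) < n * p / 8 * card S} \<le> exp (- real n * p / 8) ^ card S"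
      by (simp add: a_def)
  qed
  also have "\<dots> \<le> (\<Sum>S\<in>Pow {1..n} - {{}}. exp (- real n * p / 8) ^ card S)"
    by (rule sum_mono2) (auto simp: \<S>_def)
  also have "\<dots> = (1 + exp (- real n * p / 8)) ^ n - 1" by (subst sum_pow_card) auto
  finally show ?thesis .
qed

section \<open>Cheeger inequality and Green function\<close>

text \<open>Layers are peeled off by induction on the support: removing the lowest layer, of height
  \<open>\<mu>\<close>, lowers the left side by \<open>2 * c * \<mu> * card S\<close> and the right
  side by \<open>2 * \<mu>\<close> times the boundary of \<open>S\<close>, each boundary edge being
  seen in both orders. The isoperimetric condition compares the two.\<close>

lemma coarea_ineq:
  fixes B :: "'a \<Rightarrow> 'a \<Rightarrow> real" and h :: "'a \<Rightarrow> real" and c :: real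
  assumes V: "finite V" and sym: "\<And>x y. B x y = B y x" and B0: "\<And>x y. 0 \<le> B x y"
    and iso: "\<And>S. S \<subseteq> V \<Longrightarrow> 2 * card S \<le> card V \<Longrightarrow> c * card S \<le> (\<Sum>x\<in>S. \<Sum>y\<in>V - S. B x y)"
    and h0: "\<And>x. x \<in> V \<Longrightarrow> 0 \<le> h x" and supp: "2 * card {x \<in> V. 0 < h x} \<le> card V"
  shows "2 * c * (\<Sum>x\<in>V. h x) \<le> (\<Sum>x\<in>V. \<Sum>y\<in>V. B x y * \<bar>h x - h y\<bar>)"
  using h0 supp
proof (induction "card {x \<in> V. 0 < h x}" arbitrary: h rule: less_induct)
  case less
  define S where "S = {x \<in> V. 0 < h x}"
  have SV: "S \<subseteq> V" "finite S" using V by (auto simp: S_def)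
  have hS: "h x = 0" if "x \<in> V" "x \<notin> S" for x using that less.prems(1)[of x] by (auto simp: S_def)
  show ?case
  proof (cases "S = {}")
    case True
    then have "(\<Sum>x\<in>V. h x) = 0" using hS by (intro sum.neutral) auto
    moreover have "0 \<le> (\<Sum>x\<in>V. \<Sum>y\<in>V. B x y * \<bar>h x - h y\<bar>)" using B0 by (intro sum_nonneg) auto
    ultimately show ?thesis by simp
  next
    case False
    define \<mu> where "\<mu> = Min (h ` S)"
    have "\<mu> \<in> h ` S" unfolding \<mu>_def using SV False by (intro Min_in) auto
    then obtain z where z: "z \<in> S" "h z = \<mu>" by auto
    have \<mu>: "0 < \<mu>" "\<And>x. x \<in> S \<Longrightarrow> \<mu> \<le> h x" using z SV by (auto simp: S_def \<mu>_def)
    define h' where "h' x = h x - (if x \<in> S then \<mu> else 0)" for x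
    have sub: "{x \<in> V. 0 < h' x} \<subset> S"
    proof
      have "x \<in> S" if "x \<in> V" "0 < h' x" for x
        by (rule ccontr) (use that hS[of x] in \<open>simp add: h'_def\<close>)
      then show "{x \<in> V. 0 < h' x} \<subseteq> S" by blast
      show "{x \<in> V. 0 < h' x} \<noteq> S" using z by (force simp: h'_def)
    qed
    then have lt: "card {x \<in> V. 0 < h' x} < card S" by (intro psubset_card_mono SV)
    have IH: "2 * c * (\<Sum>x\<in>V. h' x) \<le> (\<Sum>x\<in>V. \<Sum>y\<in>V. B x y * \<bar>h' x - h' y\<bar>)"
    proof (rule less.hyps)
      show "card {x \<in> V. 0 < h' x} < card {x \<in> V. 0 < h x}" using lt by (simp add: S_def)
      show "2 * card {x \<in> V. 0 < h' x} \<le> card V" using lt less.prems(2) by (simp add: S_def)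
      show "0 \<le> h' x" if "x \<in> V" for x using that \<mu>(2) less.prems(1) by (auto simp: h'_def)
    qed
    have "h x = h' x + \<mu> * indicator S x" for x by (simp add: h'_def)
    then have 1: "(\<Sum>x\<in>V. h x) = (\<Sum>x\<in>V. h' x) + \<mu> * card S"
      using V SV by (simp add: sum.distrib indicator_def sum.If_cases Int_absorb1 flip: sum_distrib_left)
    have 2: "B x y * \<bar>h x - h y\<bar> = B x y * \<bar>h' x - h' y\<bar>
         + \<mu> * (indicator S x * indicator (V - S) y * B x y) + \<mu> * (indicator S y * indicator (V - S) x * B x y)"
      if "x \<in> V" "y \<in> V" for x y
      using that hS[of x] hS[of y] \<mu>(1) \<mu>(2)[of x] \<mu>(2)[of y]
      by (auto simp: h'_def indicator_def algebra_simps abs_if)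
    have ind: "(\<Sum>x\<in>V. indicator T x * F x) = (\<Sum>x\<in>T. F x)" if "T \<subseteq> V" for T and F :: "'a \<Rightarrow> real"
    proof -
      have "(\<Sum>x\<in>V. indicator T x * F x) = (\<Sum>x\<in>T. indicator T x * F x)"
        using V that by (intro sum.mono_neutral_right) (auto simp: indicator_def)
      then show ?thesis by simp
    qed
    have 3: "(\<Sum>x\<in>V. \<Sum>y\<in>V. indicator S x * indicator (V - S) y * B x y) = (\<Sum>x\<in>S. \<Sum>y\<in>V - S. B x y)"
      by (simp add: mult.assoc ind[OF Diff_subset] ind[OF SV(1)] flip: sum_distrib_left)
    have 4: "(\<Sum>x\<in>V. \<Sum>y\<in>V. indicator S y * indicator (V - S) x * B x y) = (\<Sum>x\<in>S. \<Sum>y\<in>V - S. B x y)"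
      unfolding 3[symmetric] by (subst sum.swap) (simp add: sym)
    have "2 * c * (\<Sum>x\<in>V. h x) = 2 * c * (\<Sum>x\<in>V. h' x) + 2 * \<mu> * (c * card S)"
      by (simp add: 1 algebra_simps)
    also have "\<dots> \<le> (\<Sum>x\<in>V. \<Sum>y\<in>V. B x y * \<bar>h' x - h' y\<bar>) + 2 * \<mu> * (\<Sum>x\<in>S. \<Sum>y\<in>V - S. B x y)"
      using IH iso[OF SV(1)] less.prems(2) \<mu>(1) by (intro add_mono mult_left_mono) (auto simp: S_def)
    also have "\<dots> = (\<Sum>x\<in>V. \<Sum>y\<in>V. B x y * \<bar>h' x - h' y\<bar>)
       + \<mu> * (\<Sum>x\<in>V. \<Sum>y\<in>V. indicator S x * indicator (V - S) y * B x y)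
       + \<mu> * (\<Sum>x\<in>V. \<Sum>y\<in>V. indicator S y * indicator (V - S) x * B x y)"
      unfolding 3 4 by simp
    also have "\<dots> = (\<Sum>x\<in>V. \<Sum>y\<in>V. B x y * \<bar>h x - h y\<bar>)"
      unfolding sum_distrib_left sum.distrib[symmetric] by (intro sum.cong refl) (simp add: 2)
    finally show ?thesis .
  qed
qed

text \<open>The coarea inequality is applied to the square of \<open>h\<close>. Each product
  \<open>\<bar>h x - h y\<bar> * (h x + h y)\<close> is split by a weighted AM-GM inequality, with
  weights for which the terms in squares of \<open>h\<close> sum to at most \<open>c * H\<close>,
  half of the left side \<open>2 * c * H\<close>.\<close>

lemma cheeger_ineq:
  fixes B :: "'a \<Rightarrow> 'a \<Rightarrow> real" and h :: "'a \<Rightarrow> real" and c :: real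
  assumes V: "finite V" and sym: "\<And>x y. B x y = B y x" and B0: "\<And>x y. 0 \<le> B x y"
    and iso: "\<And>S. S \<subseteq> V \<Longrightarrow> 2 * card S \<le> card V \<Longrightarrow> c * card S \<le> (\<Sum>x\<in>S. \<Sum>y\<in>V - S. B x y)"
    and h0: "\<And>x. x \<in> V \<Longrightarrow> 0 \<le> h x" and supp: "2 * card {x \<in> V. 0 < h x} \<le> card V"
    and c: "0 < c" and D: "0 < D" "\<And>x. x \<in> V \<Longrightarrow> (\<Sum>y\<in>V. B x y) \<le> D"
  shows "c\<^sup>2 / D * (\<Sum>x\<in>V. (h x)\<^sup>2) \<le> (\<Sum>x\<in>V. \<Sum>y\<in>V. B x y * (h x - h y)\<^sup>2)"
proof -
  define \<E> where "\<E> = (\<Sum>x\<in>V. \<Sum>y\<in>V. B x y * (h x - h y)\<^sup>2)"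
  define H where "H = (\<Sum>x\<in>V. (h x)\<^sup>2)"
  have one: "(\<Sum>x\<in>V. \<Sum>y\<in>V. B x y * (h x)\<^sup>2) \<le> D * H"
  proof -
    have "(\<Sum>x\<in>V. \<Sum>y\<in>V. B x y * (h x)\<^sup>2) = (\<Sum>x\<in>V. (\<Sum>y\<in>V. B x y) * (h x)\<^sup>2)"
      by (simp add: sum_distrib_right)
    also have "\<dots> \<le> (\<Sum>x\<in>V. D * (h x)\<^sup>2)" by (intro sum_mono mult_right_mono D) auto
    finally show ?thesis by (simp add: H_def sum_distrib_left)
  qed
  have two: "(\<Sum>x\<in>V. \<Sum>y\<in>V. B x y * (h y)\<^sup>2) \<le> D * H"
    using one by (subst sum.swap) (simp add: sym)
  have "{x \<in> V. 0 < (h x)\<^sup>2} = {x \<in> V. 0 < h x}" using h0 by force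
  then have "2 * c * H \<le> (\<Sum>x\<in>V. \<Sum>y\<in>V. B x y * \<bar>(h x)\<^sup>2 - (h y)\<^sup>2\<bar>)"
    unfolding H_def using supp by (intro coarea_ineq V sym B0 iso) auto
  also have "\<dots> \<le> (\<Sum>x\<in>V. \<Sum>y\<in>V. D / c * (B x y * (h x - h y)\<^sup>2)
       + c / (2 * D) * (B x y * (h x)\<^sup>2) + c / (2 * D) * (B x y * (h y)\<^sup>2))"
  proof (intro sum_mono)
    fix x y assume xy: "x \<in> V" "y \<in> V"
    define p where "p = \<bar>h x - h y\<bar>"
    define q where "q = h x + h y"
    have pq: "0 \<le> p" "0 \<le> q" using h0 xy by (auto simp: p_def q_def)
    have "\<bar>(h x)\<^sup>2 - (h y)\<^sup>2\<bar> = p * q"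
    proof -
      have "(h x)\<^sup>2 - (h y)\<^sup>2 = (h x - h y) * (h x + h y)" by (simp add: power2_eq_square algebra_simps)
      then show ?thesis using pq(2) by (simp add: p_def q_def abs_mult)
    qed
    also have "\<dots> \<le> D / c * p\<^sup>2 + c / (4 * D) * q\<^sup>2"
    proof -
      have "0 \<le> (2 * D * p - c * q)\<^sup>2 / (4 * c * D)" using c D by simp
      also have "\<dots> = D / c * p\<^sup>2 + c / (4 * D) * q\<^sup>2 - p * q"
        using c D by (simp add: power2_eq_square field_simps)
      finally show ?thesis by simp
    qed
    also have "\<dots> \<le> D / c * p\<^sup>2 + c / (4 * D) * (2 * (h x)\<^sup>2 + 2 * (h y)\<^sup>2)"
    proof (intro add_left_mono mult_left_mono)
      have "0 \<le> (h x - h y)\<^sup>2" by simp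
      then show "q\<^sup>2 \<le> 2 * (h x)\<^sup>2 + 2 * (h y)\<^sup>2" by (simp add: q_def power2_eq_square algebra_simps)
    qed (use c D in auto)
    finally have "B x y * \<bar>(h x)\<^sup>2 - (h y)\<^sup>2\<bar> \<le> B x y * (D / c * p\<^sup>2 + c / (4 * D) * (2 * (h x)\<^sup>2 + 2 * (h y)\<^sup>2))"
      by (rule mult_left_mono[OF _ B0])
    also have "\<dots> = D / c * (B x y * (h x - h y)\<^sup>2)
       + c / (2 * D) * (B x y * (h x)\<^sup>2) + c / (2 * D) * (B x y * (h y)\<^sup>2)"
      using D c by (simp add: p_def field_simps)
    finally show "B x y * \<bar>(h x)\<^sup>2 - (h y)\<^sup>2\<bar> \<le> D / c * (B x y * (h x - h y)\<^sup>2)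
       + c / (2 * D) * (B x y * (h x)\<^sup>2) + c / (2 * D) * (B x y * (h y)\<^sup>2)" .
  qed
  also have "\<dots> = D / c * \<E> + c / (2 * D) * (\<Sum>x\<in>V. \<Sum>y\<in>V. B x y * (h x)\<^sup>2)
       + c / (2 * D) * (\<Sum>x\<in>V. \<Sum>y\<in>V. B x y * (h y)\<^sup>2)"
    by (simp add: sum.distrib sum_distrib_left \<E>_def)
  also have "\<dots> \<le> D / c * \<E> + c / (2 * D) * (D * H) + c / (2 * D) * (D * H)"
    using c D by (intro add_mono mult_left_mono one two) auto
  also have "\<dots> = D / c * \<E> + c * H" using D by simp
  finally have "c * H \<le> D / c * \<E>" by (simp add: mult.commute)
  then have "c / D * (c * H) \<le> c / D * (D / c * \<E>)" using c D by (intro mult_left_mono) auto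
  then show ?thesis
    unfolding \<E>_def[symmetric] H_def[symmetric] using c D by (simp add: power2_eq_square mult.assoc)
qed

lemma dirichlet_identity:
  fixes B :: "'a \<Rightarrow> 'a \<Rightarrow> real" and f :: "'a \<Rightarrow> real"
  assumes sym: "\<And>x y. B x y = B y x"
  shows "(\<Sum>x\<in>V. \<Sum>y\<in>V. B x y * (f x - f y)\<^sup>2) =
     2 * (\<Sum>x\<in>V. (\<Sum>y\<in>V. B x y) * (f x)\<^sup>2) - 2 * (\<Sum>x\<in>V. f x * (\<Sum>y\<in>V. B x y * f y))"
proof -
  have "(\<Sum>x\<in>V. \<Sum>y\<in>V. B x y * (f x - f y)\<^sup>2) =
     (\<Sum>x\<in>V. \<Sum>y\<in>V. B x y * (f x)\<^sup>2) + (\<Sum>x\<in>V. \<Sum>y\<in>V. B x y * (f y)\<^sup>2) - 2 * (\<Sum>x\<in>V. \<Sum>y\<in>V. f x * (B x y * f y))"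
    by (simp add: sum_distrib_left sum.distrib[symmetric] sum_subtractf[symmetric] power2_diff algebra_simps)
  also have "(\<Sum>x\<in>V. \<Sum>y\<in>V. B x y * (f y)\<^sup>2) = (\<Sum>x\<in>V. \<Sum>y\<in>V. B x y * (f x)\<^sup>2)"
    by (subst sum.swap) (simp add: sym)
  finally show ?thesis by (simp add: sum_distrib_right sum_distrib_left)
qed

text \<open>Multiplying the subsolution inequality by \<open>d x * f x\<close> and summing bounds
  the killing term plus the Dirichlet energy by \<open>3 * A * f u\<close>. One of the two is at
  least a constant times \<open>A * (f u)\<^sup>2\<close>, so a factor \<open>f u\<close>
  cancels.\<close>

lemma green_energy_bound:
  fixes B :: "'a \<Rightarrow> 'a \<Rightarrow> real" and f :: "'a \<Rightarrow> real"
  assumes V: "finite V" and sym: "\<And>x y. B x y = B y x" and B0: "\<And>x y. 0 \<le> B x y"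
    and iso: "\<And>S. S \<subseteq> V \<Longrightarrow> 2 * card S \<le> card V \<Longrightarrow> A / 4 * card S \<le> (\<Sum>x\<in>S. \<Sum>y\<in>V - S. B x y)"
    and A: "0 < A" "\<And>x. x \<in> V \<Longrightarrow> A \<le> (\<Sum>y\<in>V. B x y)" "\<And>x. x \<in> V \<Longrightarrow> (\<Sum>y\<in>V. B x y) \<le> 3 * A"
    and f0: "\<And>x. x \<in> V \<Longrightarrow> 0 \<le> f x" and u: "u \<in> V"
    and n: "2 \<le> card V" and a: "a = 1 - 1 / card V"
    and sub: "\<And>x. x \<in> V \<Longrightarrow> f x \<le> (if x = u then 1 else 0) + a * (\<Sum>y\<in>V. B x y * f y) / (\<Sum>y\<in>V. B x y)"
  shows "f u \<le> 2304"
proof -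
  define d where "d x = (\<Sum>y\<in>V. B x y)" for x
  have d0: "0 < d x" if "x \<in> V" for x using A(1) A(2)[OF that] by (simp add: d_def)
  have a0: "1 / 2 \<le> a" "a \<le> 1" using n by (auto simp: a field_simps)
  define Q where "Q = (\<Sum>x\<in>V. d x * (f x)\<^sup>2)"
  define \<E> where "\<E> = (\<Sum>x\<in>V. \<Sum>y\<in>V. B x y * (f x - f y)\<^sup>2)"
  have \<E>: "\<E> = 2 * Q - 2 * (\<Sum>x\<in>V. f x * (\<Sum>y\<in>V. B x y * f y))"
    unfolding \<E>_def Q_def d_def by (rule dirichlet_identity[OF sym])
  have "Q = (\<Sum>x\<in>V. d x * f x * f x)" by (simp add: Q_def power2_eq_square mult.assoc)
  also have "\<dots> \<le> (\<Sum>x\<in>V. d x * f x * ((if x = u then 1 else 0) + a * (\<Sum>y\<in>V. B x y * f y) / d x))"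
    using d0 f0 sub by (intro sum_mono mult_left_mono) (auto simp: d_def less_imp_le)
  also have "\<dots> = (\<Sum>x\<in>V. (if x = u then d x * f x else 0) + a * (f x * (\<Sum>y\<in>V. B x y * f y)))"
  proof (rule sum.cong[OF refl])
    fix x assume "x \<in> V"
    then have "d x \<noteq> 0" using d0[of x] by simp
    then show "d x * f x * ((if x = u then 1 else 0) + a * (\<Sum>y\<in>V. B x y * f y) / d x) =
        (if x = u then d x * f x else 0) + a * (f x * (\<Sum>y\<in>V. B x y * f y))"
      by (simp add: field_simps)
  qed
  also have "\<dots> = d u * f u + a * (\<Sum>x\<in>V. f x * (\<Sum>y\<in>V. B x y * f y))"
    using V u by (simp add: sum.distrib sum_distrib_left)
  also have "\<dots> = d u * f u + a * (Q - \<E> / 2)"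
  proof -
    have "(\<Sum>x\<in>V. f x * (\<Sum>y\<in>V. B x y * f y)) = Q - \<E> / 2" using \<E> by linarith
    then show ?thesis by (simp only:)
  qed
  finally have "(1 - a) * Q + a * \<E> / 2 \<le> d u * f u" by (simp add: algebra_simps)
  also have "\<dots> \<le> 3 * A * f u" using A(3)[OF u] f0[OF u] by (intro mult_right_mono) (auto simp: d_def)
  finally have main: "(1 - a) * Q + a * \<E> / 2 \<le> 3 * A * f u" .
  have Q0: "0 \<le> Q" unfolding Q_def using d0 by (intro sum_nonneg) (auto simp: less_imp_le)
  have \<E>0: "0 \<le> \<E>" unfolding \<E>_def using B0 by (intro sum_nonneg) auto
  \<comment> \<open>Either half of the vertices have \<open>f > m\<close>, and the killing term is large, or Cheeger applies to \<open>(f - m)\<^sup>+\<close>.\<close>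
  define m where "m = f u / 2"
  have m0: "0 \<le> m" using f0[OF u] by (simp add: m_def)
  define W where "W = {x \<in> V. m < f x}"
  have WV: "W \<subseteq> V" by (auto simp: W_def)
  have quad: "f u \<le> K" if "A * (f u)\<^sup>2 \<le> K * (A * f u)" "0 \<le> K" for K
  proof (cases "f u = 0")
    case False
    then have "0 < A * f u" using f0[OF u] A by simp
    moreover have "f u * (A * f u) \<le> K * (A * f u)" using that by (simp add: power2_eq_square mult_ac)
    ultimately show ?thesis by (meson mult_le_cancel_right not_less)
  qed (use that in simp)
  show ?thesis
  proof (cases "2 * card W \<le> card V")
    case False
    have "(card V / 2) * (A * m\<^sup>2) \<le> card W * (A * m\<^sup>2)" using False A by (intro mult_right_mono) auto
    also have "\<dots> = (\<Sum>x\<in>W. A * m\<^sup>2)" by simp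
    also have "\<dots> \<le> (\<Sum>x\<in>W. d x * (f x)\<^sup>2)"
      using m0 A d0 by (intro sum_mono mult_mono power_mono) (auto simp: W_def d_def less_imp_le)
    also have "\<dots> \<le> Q" unfolding Q_def using V WV d0 by (intro sum_mono2) (auto simp: less_imp_le)
    finally have "(1 / card V) * ((card V / 2) * (A * m\<^sup>2)) \<le> (1 / card V) * Q" by (intro mult_left_mono) auto
    then have "A * m\<^sup>2 / 2 \<le> (1 - a) * Q" using n by (simp add: a)
    also have "\<dots> \<le> 3 * A * f u" using main \<E>0 a0 mult_nonneg_nonneg[of a \<E>] by linarith
    finally have "A * (f u)\<^sup>2 \<le> 2304 * (A * f u)" using A f0[OF u] mult_nonneg_nonneg[of A "f u"]
      by (simp add: m_def power2_eq_square)
    then show ?thesis by (rule quad) simp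
  next
    case True
    define h where "h x = max 0 (f x - m)" for x
    have supp: "{x \<in> V. 0 < h x} = W" by (auto simp: h_def W_def)
    have "(A / 4)\<^sup>2 / (3 * A) * (h u)\<^sup>2 \<le> (A / 4)\<^sup>2 / (3 * A) * (\<Sum>x\<in>V. (h x)\<^sup>2)"
      using A V u member_le_sum[of u V "\<lambda>x. (h x)\<^sup>2"] by (intro mult_left_mono) auto
    also have "\<dots> \<le> (\<Sum>x\<in>V. \<Sum>y\<in>V. B x y * (h x - h y)\<^sup>2)"
      using A True supp by (intro cheeger_ineq V sym B0 iso) (auto simp: h_def)
    also have "\<dots> \<le> \<E>" unfolding \<E>_def
    proof (intro sum_mono mult_left_mono[OF _ B0])
      fix x y show "(h x - h y)\<^sup>2 \<le> (f x - f y)\<^sup>2"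
        unfolding abs_le_square_iff[symmetric] h_def by (simp add: max_def abs_if)
    qed
    \<comment> \<open>Here \<open>(A / 4)\<^sup>2 / (3 * A) = A / 48\<close>. With
      \<open>a \<ge> 1 / 2\<close> the 48 becomes 192, and with \<open>m = f u / 2\<close> the final
      constant is \<open>3 * 192 * 4 = 2304\<close>.\<close>
    finally have "A * m\<^sup>2 / 48 \<le> \<E>"
      using A m0 by (simp add: h_def m_def power2_eq_square)
    moreover have "1 / 2 * \<E> \<le> a * \<E>" using a0 \<E>0 by (intro mult_right_mono) auto
    moreover have "a * \<E> / 2 \<le> 3 * A * f u" using main Q0 a0 mult_nonneg_nonneg[of "1 - a" Q] by linarith
    ultimately have "A * m\<^sup>2 / 192 \<le> 3 * A * f u" by linarith
    then have "A * (f u)\<^sup>2 \<le> 2304 * (A * f u)" by (simp add: m_def power2_eq_square)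
    then show ?thesis by (rule quad) simp
  qed
qed

section \<open>Number of visits in an expanding graph\<close>

lemma neighbours_subset: "E \<subseteq> all_edges n \<Longrightarrow> neighbours E x \<subseteq> {1..n}"
  by (auto simp: neighbours_def all_edges_def)

lemma walk_step_range:
  assumes "E \<subseteq> all_edges n" "x \<in> {1..n}" shows "set_pmf (walk_step E x) \<subseteq> {1..n}"
  using assms neighbours_subset[of E n x] finite_subset[of "neighbours E x" "{1..n}"]
  by (auto simp: walk_step_def)

lemma random_walk_range:
  assumes "E \<subseteq> all_edges n" "v \<in> {1..n}" "xs \<in> set_pmf (random_walk E v t)"
  shows "set xs \<subseteq> {1..n} \<and> xs \<noteq> []"
  using assms(3)
proof (induction t arbitrary: xs)
  case (Suc t)
  then obtain ys y where ys: "ys \<in> set_pmf (random_walk E v t)" "y \<in> set_pmf (walk_step E (last ys))" "xs = ys @ [y]"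
    by auto
  then have sys: "set ys \<subseteq> {1..n}" "ys \<noteq> []" using Suc.IH[OF ys(1)] by auto
  then have "last ys \<in> {1..n}" using last_in_set by blast
  with sys show ?case using ys walk_step_range[OF assms(1), of "last ys"] by auto
qed (use assms(2) in simp)

text \<open>Expected number of visits to \<open>u\<close> before step \<open>j\<close> of a walk from \<open>x\<close> that is killed with
  probability \<open>1 / n\<close> at each step.\<close>

primrec green :: "nat \<Rightarrow> nat set set \<Rightarrow> nat \<Rightarrow> nat \<Rightarrow> nat \<Rightarrow> real" where
  "green n E u 0 x = 0"
| "green n E u (Suc j) x = (if x = u then 1 else 0) +
     (1 - 1 / n) * (\<Sum>y\<in>neighbours E x. green n E u j y) / card (neighbours E x)"

context
  fixes n :: nat and E :: "nat set set" and A :: real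
  assumes E: "E \<subseteq> all_edges n" and n: "2 \<le> n" and A: "0 < A"
    and deg: "degrees_within n A (3 * A) E" and cut: "cut_expander n (A / 4) E"
begin

lemma green_nonneg: "0 \<le> green n E u j x"
  using n by (induction j arbitrary: x) (auto intro!: add_nonneg_nonneg mult_nonneg_nonneg divide_nonneg_nonneg sum_nonneg)

text \<open>Monotonicity in the horizon turns the recursion into a subsolution inequality for one
  function, the form that \<open>green_energy_bound\<close> asks for.\<close>

lemma green_mono: "green n E u j x \<le> green n E u (Suc j) x"
proof (induction j arbitrary: x)
  case (Suc j)
  then show ?case using n
    by (subst (1 2) green.simps) (intro add_left_mono divide_right_mono mult_left_mono sum_mono; simp)
qed (use n green_nonneg in \<open>auto intro!: divide_nonneg_nonneg mult_nonneg_nonneg sum_nonneg\<close>)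

text \<open>The energy bound controls the value at \<open>u\<close> itself. Elsewhere the maximum
  principle applies: at a maximiser other than \<open>u\<close> the value is at most
  \<open>1 - 1 / n\<close> times itself.\<close>

lemma green_le:
  assumes u: "u \<in> {1..n}" and x: "x \<in> {1..n}"
  shows "green n E u j x \<le> 2304"
proof -
  define V where "V = {1..n}"
  define B :: "nat \<Rightarrow> nat \<Rightarrow> real" where "B x y = (if y \<in> neighbours E x then 1 else 0)" for x y
  have sumB: "(\<Sum>y\<in>V. B x y * f y) = (\<Sum>y\<in>neighbours E x. f y)" for x and f :: "nat \<Rightarrow> real"
  proof -
    have "(\<Sum>y\<in>V. B x y * f y) = (\<Sum>y\<in>V. if y \<in> neighbours E x then f y else 0)"
      by (intro sum.cong) (auto simp: B_def)
    also have "\<dots> = (\<Sum>y\<in>V \<inter> neighbours E x. f y)"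
      by (simp add: V_def sum.inter_restrict)
    also have "V \<inter> neighbours E x = neighbours E x" using neighbours_subset[OF E] by (auto simp: V_def)
    finally show ?thesis .
  qed
  have degB: "(\<Sum>y\<in>V. B x y) = card (neighbours E x)" for x using sumB[of x "\<lambda>_. 1"] by simp
  have green_sub: "green n E u j x \<le> (if x = u then 1 else 0) +
      (1 - 1 / card V) * (\<Sum>y\<in>V. B x y * green n E u j y) / (\<Sum>y\<in>V. B x y)" for x
    unfolding sumB degB using green_mono[of u j x] by (simp add: V_def)
  have gu: "green n E u j u \<le> 2304"
  proof (rule green_energy_bound[where B = B and V = V and A = A, OF _ _ _ _ A _ _ _ _ _ refl green_sub])
    fix x y show "B x y = B y x" by (auto simp: B_def neighbours_def insert_commute)
  next
    fix S assume S: "S \<subseteq> V" "2 * card S \<le> card V"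
    have "A / 4 * card S \<le> card {(x, y) \<in> S \<times> (V - S). {x, y} \<in> E}"
      using cut S by (simp add: cut_expander_def V_def)
    also have "\<dots> = (\<Sum>z\<in>{(x, y) \<in> S \<times> (V - S). {x, y} \<in> E}. 1)" by simp
    also have "\<dots> = (\<Sum>z\<in>S \<times> (V - S). case z of (x, y) \<Rightarrow> B x y)"
      using S finite_subset[of S V]
      by (intro sum.mono_neutral_cong_left) (auto simp: B_def neighbours_def V_def split: if_splits)
    also have "\<dots> = (\<Sum>x\<in>S. \<Sum>y\<in>V - S. B x y)" by (rule sum.cartesian_product[symmetric])
    finally show "A / 4 * card S \<le> (\<Sum>x\<in>S. \<Sum>y\<in>V - S. B x y)" .
  next
    fix x assume "x \<in> V"
    then show "A \<le> (\<Sum>y\<in>V. B x y)" "(\<Sum>y\<in>V. B x y) \<le> 3 * A"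
      unfolding degB using deg by (auto simp: degrees_within_def V_def)
  next
    fix x y show "0 \<le> B x y" by (simp add: B_def)
  qed (use n u green_nonneg in \<open>auto simp: V_def\<close>)
  obtain z where z: "z \<in> V" "\<And>y. y \<in> V \<Longrightarrow> green n E u j y \<le> green n E u j z"
  proof -
    have "finite (green n E u j ` V)" "green n E u j ` V \<noteq> {}" using n by (auto simp: V_def)
    then have "Max (green n E u j ` V) \<in> green n E u j ` V" by (rule Max_in)
    then obtain z where "z \<in> V" "green n E u j z = Max (green n E u j ` V)" by auto
    then show ?thesis using that[of z] by (simp add: V_def)
  qed
  have "green n E u j z \<le> 2304"
  proof (cases "z = u")
    case False
    define c where "c = real (card (neighbours E z))"
    have c: "0 < c" using deg z A unfolding degrees_within_def c_def V_def by force
    have "green n E u j z \<le> (1 - 1 / n) * (\<Sum>y\<in>neighbours E z. green n E u j y) / c"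
      using green_mono[of u j z] False by (simp add: c_def)
    also have "\<dots> \<le> (1 - 1 / n) * (\<Sum>y\<in>neighbours E z. green n E u j z) / c"
      using z n c neighbours_subset[OF E, of z]
      by (intro divide_right_mono mult_left_mono sum_mono) (auto simp: V_def)
    also have "\<dots> = (1 - 1 / n) * green n E u j z" using c by (simp add: c_def)
    finally have "green n E u j z / n \<le> 0" by (simp add: algebra_simps)
    then show ?thesis using n by (simp add: divide_le_0_iff)
  qed (use gu in simp)
  then show ?thesis using z(2)[of x] x by (simp add: V_def)
qed

text \<open>A departure from \<open>u\<close> earns a factor \<open>1 / q\<close>, paid for by the
  drop of \<open>g\<close> by one expected visit. The walk itself is not killed: the factor
  \<open>a ^ length xs\<close> stands in for the killing in \<open>green\<close> and reappears as
  the price \<open>(1 / (1 - 1 / n)) ^ T\<close>.\<close>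

lemma walk_visits_tail:
  assumes u: "u \<in> {1..n}" and v: "v \<in> {1..n}"
  shows "measure_pmf.prob (random_walk E v T) {xs. m < count_list xs u}
           \<le> 2 * (4607 / 4608) ^ m * (1 / (1 - 1 / n)) ^ T"
proof -
  define q where "q = (4607 / 4608 :: real)"
  define a where "a = 1 - 1 / real n"
  have a: "0 < a" "a \<le> 1" using n by (auto simp: a_def)
  define g where "g = green n E u"
  have g: "0 \<le> g j x" "x \<in> {1..n} \<Longrightarrow> g j x \<le> 2304" for j x
    using green_nonneg green_le[OF u] by (auto simp: g_def)
  \<comment> \<open>Using the remaining time in \<open>g\<close> makes the recursion of \<open>green\<close> exact and avoids a limit.\<close>
  define \<Phi> where "\<Phi> xs = (1 / q) ^ count_list (butlast xs) u * a ^ length xs * (1 + g (Suc T - length xs) (last xs) / 2304)"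
    for xs
  have cnt: "count_list xs u = count_list (butlast xs) u + (if last xs = u then 1 else 0)" if "xs \<noteq> []" for xs
    by (subst append_butlast_last_id[OF that, symmetric], subst count_list_append) simp
  have "measure_pmf.prob (random_walk E v T) {xs. m < count_list xs u} \<le> \<Phi> [v] / ((1 / q) ^ m * a ^ Suc T)"
    unfolding random_walk_adaptive
  proof (rule adaptive_walk_tail)
    fix t xs assume t: "t < T" and xs: "xs \<in> set_pmf (adaptive_walk (\<lambda>xs. walk_step E (last xs)) v t)"
    then have len: "length xs = Suc t" by (auto dest: adaptive_walk_length)
    have "set xs \<subseteq> {1..n}" "xs \<noteq> []" using random_walk_range[OF E v] xs by (auto simp: random_walk_adaptive)
    then have x: "last xs \<in> {1..n}" using last_in_set by blast
    define x where "x = last xs"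
    define N where "N = neighbours E x"
    obtain i where i: "T - t = Suc i" "T - Suc t = i" using t by (metis Suc_diff_Suc)
    have N: "finite N" "N \<noteq> {}" "0 < real (card N)"
    proof -
      show "finite N" using finite_subset[OF neighbours_subset[OF E]] by (simp add: N_def)
      have "A \<le> real (card N)" using deg x by (simp add: degrees_within_def N_def x_def)
      then show "0 < real (card N)" using A by simp
      then show "N \<noteq> {}" by auto
    qed
    define K where "K = (1 / q) ^ count_list (butlast xs) u * a ^ length xs"
    have K: "0 \<le> K" using a by (simp add: K_def q_def)
    define c where "c = (if x = u then 1 / q else 1)"
    have \<Phi>xs: "\<Phi> xs = K * (1 + g (Suc i) x / 2304)" using i len by (simp add: \<Phi>_def K_def x_def)
    have \<Phi>y: "\<Phi> (xs @ [y]) = K * c * (a + a * g i y / 2304)" for y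
      using i len \<open>xs \<noteq> []\<close> by (simp add: \<Phi>_def K_def c_def cnt x_def algebra_simps)
    have "(\<integral>\<^sup>+y. ennreal (\<Phi> (xs @ [y])) \<partial>walk_step E (last xs)) = ennreal (measure_pmf.expectation (pmf_of_set N) (\<lambda>y. \<Phi> (xs @ [y])))"
    proof -
      have "walk_step E (last xs) = pmf_of_set N" using N by (simp add: walk_step_def N_def x_def)
      moreover have "0 \<le> \<Phi> (xs @ [y])" for y
        unfolding \<Phi>y c_def using K a g(1) by (auto simp: q_def)
      ultimately show ?thesis
        using N by (simp add: nn_integral_eq_integral integrable_measure_pmf_finite)
    qed
    also have "measure_pmf.expectation (pmf_of_set N) (\<lambda>y. \<Phi> (xs @ [y])) = (\<Sum>y\<in>N. \<Phi> (xs @ [y])) / card N"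
      using N by (simp add: integral_pmf_of_set)
    also have "\<dots> = K * c * (a + (a * (\<Sum>y\<in>N. g i y) / card N) / 2304)"
      using N unfolding \<Phi>y
      by (simp add: sum_distrib_left[symmetric] sum.distrib sum_divide_distrib[symmetric] field_simps)
    also have "a * (\<Sum>y\<in>N. g i y) / card N = g (Suc i) x - (if x = u then 1 else 0)"
      by (simp add: g_def N_def a_def)
    also have "K * c * (a + (g (Suc i) x - (if x = u then 1 else 0)) / 2304) \<le> K * (1 + g (Suc i) x / 2304)"
    proof -
      have "c * (a + (g (Suc i) x - (if x = u then 1 else 0)) / 2304) \<le> 1 + g (Suc i) x / 2304"
      proof (cases "x = u")
        case True
        \<comment> \<open>As \<open>1 + g (Suc i) x / 2304\<close> is at most 2, multiplying it by
          \<open>q = 1 - 1 / 4608\<close> loses at most \<open>1 / 2304\<close>, which is the drop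
          caused by one visit.\<close>
        have "g (Suc i) x \<le> 2304" using g(2) x by (simp add: x_def)
        then have "1 + (g (Suc i) x - 1) / 2304 \<le> q * (1 + g (Suc i) x / 2304)"
          by (simp add: q_def field_simps)
        then have "a + (g (Suc i) x - 1) / 2304 \<le> q * (1 + g (Suc i) x / 2304)"
          using a by linarith
        then show ?thesis using True by (simp add: c_def q_def field_simps)
      qed (use a in \<open>simp add: c_def\<close>)
      then show ?thesis using K by (simp only: mult.assoc) (rule mult_left_mono)
    qed
    finally show "(\<integral>\<^sup>+y. ennreal (\<Phi> (xs @ [y])) \<partial>walk_step E (last xs)) \<le> ennreal (\<Phi> xs)"
      using \<Phi>xs by (simp add: ennreal_leI)
  next
    fix xs :: "nat list" assume xs: "length xs = Suc T" "m < count_list xs u"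
    then have "xs \<noteq> []" by auto
    then have "m \<le> count_list (butlast xs) u" using cnt[of xs] xs by (simp split: if_splits)
    then have "(1 / q) ^ m \<le> (1 / q) ^ count_list (butlast xs) u" by (intro power_increasing) (auto simp: q_def)
    then have "(1 / q) ^ m * a ^ Suc T * 1 \<le> \<Phi> xs"
      unfolding \<Phi>_def xs(1) using a g(1) by (intro mult_mono) (auto simp: q_def)
    then show "(1 / q) ^ m * a ^ Suc T \<le> \<Phi> xs" by simp
  qed (use a g(1) in \<open>auto simp: \<Phi>_def q_def intro!: mult_nonneg_nonneg add_nonneg_nonneg\<close>)
  also have "\<dots> \<le> (a * 2) / ((1 / q) ^ m * a ^ Suc T)"
    using a g(2)[OF v] by (intro divide_right_mono) (auto simp: \<Phi>_def q_def)
  also have "\<dots> = 2 * q ^ m * (1 / a) ^ T" using a by (simp add: q_def field_simps)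
  finally show ?thesis by (simp add: q_def a_def)
qed

end

section \<open>The annealed walk\<close>

lemma pmf_adaptive_walk_snoc:
  "pmf (adaptive_walk Q v (Suc t)) (xs @ [y]) = pmf (adaptive_walk Q v t) xs * pmf (Q xs) y"
proof -
  have "pmf (map_pmf (\<lambda>y. ys @ [y]) (Q ys)) (xs @ [y]) = indicator {xs} ys * pmf (Q xs) y" for ys
  proof (cases "ys = xs")
    case True
    moreover have "pmf (map_pmf (\<lambda>y. xs @ [y]) (Q xs)) (xs @ [y]) = pmf (Q xs) y"
      by (rule pmf_map_inj') (simp add: inj_def)
    ultimately show ?thesis by simp
  next
    case False
    then have "xs @ [y] \<notin> set_pmf (map_pmf (\<lambda>y. ys @ [y]) (Q ys))" by auto
    then show ?thesis using False by (simp add: set_pmf_eq)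
  qed
  then have "pmf (adaptive_walk Q v (Suc t)) (xs @ [y]) =
     measure_pmf.expectation (adaptive_walk Q v t) (\<lambda>ys. indicator {xs} ys * pmf (Q xs) y)"
    by (simp add: pmf_bind)
  also have "\<dots> = pmf (adaptive_walk Q v t) xs * pmf (Q xs) y" by (simp add: measure_pmf_single)
  finally show ?thesis .
qed

lemma pmf_next_step:
  assumes M: "map_pmf butlast M = M0" "[] \<notin> set_pmf M" and xs: "xs \<in> set_pmf M0"
  shows "pmf (map_pmf last (cond_pmf M {ys. butlast ys = xs})) y = pmf M (xs @ [y]) / pmf M0 xs"
    and "set_pmf (map_pmf last (cond_pmf M {ys. butlast ys = xs})) \<subseteq> last ` set_pmf M"
proof -
  define C where "C = cond_pmf M {ys. butlast ys = xs}"
  have ne: "set_pmf M \<inter> {ys. butlast ys = xs} \<noteq> {}" using xs unfolding M(1)[symmetric] by auto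
  have sC: "set_pmf C = set_pmf M \<inter> {ys. butlast ys = xs}" unfolding C_def by (rule set_cond_pmf[OF ne])
  show "set_pmf (map_pmf last (cond_pmf M {ys. butlast ys = xs})) \<subseteq> last ` set_pmf M"
    using sC by (auto simp: C_def)
  have "ys = xs @ [last ys]" if "ys \<in> set_pmf C" for ys
  proof -
    have "ys \<noteq> []" "butlast ys = xs" using that M(2) sC by auto
    then show ?thesis by auto
  qed
  then have eq: "(last -` {y}) \<inter> set_pmf C = {xs @ [y]} \<inter> set_pmf C" by auto
  have "pmf (map_pmf last C) y = measure_pmf.prob C (last -` {y})" by (simp add: pmf_map)
  also have "\<dots> = measure_pmf.prob C ((last -` {y}) \<inter> set_pmf C)" by (simp add: measure_Int_set_pmf)
  also have "\<dots> = pmf C (xs @ [y])" unfolding eq by (simp add: measure_Int_set_pmf measure_pmf_single)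
  also have "\<dots> = pmf M (xs @ [y]) / measure_pmf.prob M {ys. butlast ys = xs}"
    unfolding C_def using pmf_cond[OF ne] by simp
  also have "measure_pmf.prob M {ys. butlast ys = xs} = pmf M0 xs"
    unfolding M(1)[symmetric] by (simp add: pmf_map vimage_def)
  finally show "pmf (map_pmf last (cond_pmf M {ys. butlast ys = xs})) y = pmf M (xs @ [y]) / pmf M0 xs"
    by (simp add: C_def)
qed

definition annealed_walk :: "nat \<Rightarrow> real \<Rightarrow> nat \<Rightarrow> nat \<Rightarrow> nat list pmf" where
  "annealed_walk n p v t = bind_pmf (gnp n p) (\<lambda>E. random_walk E v t)"

lemma random_walk_length: "xs \<in> set_pmf (random_walk E v t) \<Longrightarrow> length xs = Suc t"
  unfolding random_walk_adaptive by (rule adaptive_walk_length)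

lemma annealed_walk_length: "xs \<in> set_pmf (annealed_walk n p v t) \<Longrightarrow> length xs = Suc t"
  using random_walk_length by (auto simp: annealed_walk_def)

lemma annealed_walk_range:
  "v \<in> {1..n} \<Longrightarrow> xs \<in> set_pmf (annealed_walk n p v t) \<Longrightarrow> set xs \<subseteq> {1..n} \<and> xs \<noteq> []"
  using random_walk_range[of _ n v xs t] set_pmf_gnp[of n p] by (auto simp: annealed_walk_def)

lemma finite_annealed_walk:
  assumes "v \<in> {1..n}" shows "finite (set_pmf (annealed_walk n p v t))"
proof (rule finite_subset)
  show "set_pmf (annealed_walk n p v t) \<subseteq> {xs. set xs \<subseteq> {1..n} \<and> length xs = Suc t}"
    using annealed_walk_range[OF assms] annealed_walk_length by blast
qed (rule finite_lists_length_eq, simp)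

lemma annealed_walk_take:
  "map_pmf (take (Suc i)) (annealed_walk n p v (i + j)) = annealed_walk n p v i"
  by (simp add: annealed_walk_def map_bind_pmf random_walk_adaptive map_take_adaptive_walk)

lemma annealed_walk_butlast: "map_pmf butlast (annealed_walk n p v (Suc t)) = annealed_walk n p v t"
proof -
  have "map_pmf butlast (annealed_walk n p v (Suc t)) = map_pmf (take (Suc t)) (annealed_walk n p v (t + 1))"
    by (intro map_pmf_cong) (auto dest!: annealed_walk_length simp: butlast_conv_take)
  then show ?thesis by (simp only: annealed_walk_take)
qed

lemma pmf_annealed_walk:
  "pmf (annealed_walk n p v t) xs = measure_pmf.expectation (gnp n p) (\<lambda>E. pmf (random_walk E v t) xs)"
  by (simp add: annealed_walk_def pmf_bind)

lemma pmf_annealed_walk_snoc: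
  "pmf (annealed_walk n p v (Suc t)) (xs @ [y]) =
     measure_pmf.expectation (gnp n p) (\<lambda>E. pmf (random_walk E v t) xs * pmf (walk_step E (last xs)) y)"
  unfolding pmf_annealed_walk random_walk_adaptive pmf_adaptive_walk_snoc ..

text \<open>On bad histories the kernel is uniform, so that it has the lower bound of
  \<^const>\<open>spread_kernel\<close> everywhere.\<close>

definition annealed_kernel :: "nat \<Rightarrow> real \<Rightarrow> nat \<Rightarrow> (nat list \<Rightarrow> bool) \<Rightarrow> nat list \<Rightarrow> nat pmf" where
  "annealed_kernel n p v G xs =
     (if G xs \<and> xs \<in> set_pmf (annealed_walk n p v (length xs - 1))
      then map_pmf last (cond_pmf (annealed_walk n p v (length xs)) {ys. butlast ys = xs})
      else pmf_of_set {1..n})"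

lemma annealed_kernel_good:
  assumes "G xs" "xs \<in> set_pmf (annealed_walk n p v t)"
  shows "pmf (annealed_kernel n p v G xs) y = pmf (annealed_walk n p v (Suc t)) (xs @ [y]) / pmf (annealed_walk n p v t) xs"
    and "set_pmf (annealed_kernel n p v G xs) \<subseteq> last ` set_pmf (annealed_walk n p v (Suc t))"
proof -
  have len: "length xs = Suc t" using annealed_walk_length assms(2) by blast
  have "[] \<notin> set_pmf (annealed_walk n p v (Suc t))" by (auto dest: annealed_walk_length)
  note step = pmf_next_step[OF annealed_walk_butlast this assms(2)]
  have eq: "annealed_kernel n p v G xs = map_pmf last (cond_pmf (annealed_walk n p v (Suc t)) {ys. butlast ys = xs})"
    using assms len by (simp add: annealed_kernel_def)
  show "pmf (annealed_kernel n p v G xs) y = pmf (annealed_walk n p v (Suc t)) (xs @ [y]) / pmf (annealed_walk n p v t) xs"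
    "set_pmf (annealed_kernel n p v G xs) \<subseteq> last ` set_pmf (annealed_walk n p v (Suc t))"
    unfolding eq by (rule step)+
qed

lemma annealed_kernel_range:
  assumes "v \<in> {1..n}" shows "set_pmf (annealed_kernel n p v G xs) \<subseteq> {1..n}"
proof (cases "G xs \<and> xs \<in> set_pmf (annealed_walk n p v (length xs - 1))")
  case True
  have "last ys \<in> {1..n}" if "ys \<in> set_pmf (annealed_walk n p v t)" for ys t
    using annealed_walk_range[OF assms that] last_in_set by blast
  then show ?thesis using annealed_kernel_good(2)[of G xs n p v "length xs - 1"] True by blast
next
  case False
  then show ?thesis using assms unfolding annealed_kernel_def by (subst if_not_P) auto
qed

text \<open>Along good prefixes the transition probabilities are ratios of annealed path weights,
  and their product telescopes. A prefix outside the annealed support has weight zero on both sides,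
  so the uniform branch of the kernel does not matter there.\<close>

lemma adaptive_walk_annealed_kernel:
  assumes "\<And>i. i < t \<Longrightarrow> G (take (Suc i) xs)" "length xs = Suc t"
  shows "pmf (adaptive_walk (annealed_kernel n p v G) v t) xs = pmf (annealed_walk n p v t) xs"
  using assms
proof (induction t arbitrary: xs)
  case 0
  have "annealed_walk n p v 0 = return_pmf [v]" by (simp add: annealed_walk_def)
  then show ?case by simp
next
  case (Suc t)
  then obtain ys y where xs: "xs = ys @ [y]" "length ys = Suc t" by (metis length_Suc_conv_rev)
  have ys: "pmf (adaptive_walk (annealed_kernel n p v G) v t) ys = pmf (annealed_walk n p v t) ys"
  proof (rule Suc.IH)
    fix i assume "i < t" then show "G (take (Suc i) ys)" using Suc.prems(1)[of i] xs by simp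
  qed fact
  have G: "G ys" using Suc.prems(1)[of t] xs by simp
  show ?case
  proof (cases "ys \<in> set_pmf (annealed_walk n p v t)")
    case True
    then have "pmf (annealed_walk n p v t) ys \<noteq> 0" by (simp add: set_pmf_iff)
    then show ?thesis
      unfolding xs(1) pmf_adaptive_walk_snoc ys annealed_kernel_good(1)[where G = G, OF G True] by simp
  next
    case False
    have "xs \<notin> set_pmf (annealed_walk n p v (Suc t))"
    proof
      assume "xs \<in> set_pmf (annealed_walk n p v (Suc t))"
      then have "butlast xs \<in> set_pmf (map_pmf butlast (annealed_walk n p v (Suc t)))" by simp
      then show False using False xs by (simp only: annealed_walk_butlast) simp
    qed
    then show ?thesis
      using False unfolding xs(1) pmf_adaptive_walk_snoc ys by (simp add: set_pmf_iff)
  qed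
qed

lemma annealed_walk_transfer:
  assumes v: "v \<in> {1..n}"
  shows "measure_pmf.prob (annealed_walk n p v t) {xs. P xs} \<le>
      measure_pmf.prob (adaptive_walk (annealed_kernel n p v G) v t) {xs. P xs}
      + measure_pmf.prob (annealed_walk n p v t) {xs. \<exists>i<t. \<not> G (take (Suc i) xs)}"
proof -
  let ?A = "annealed_walk n p v t" and ?B = "adaptive_walk (annealed_kernel n p v G) v t"
  define X where "X = {xs. P xs \<and> (\<forall>i<t. G (take (Suc i) xs))} \<inter> set_pmf ?A"
  have fin: "finite X" using finite_annealed_walk[OF v] by (simp add: X_def)
  have "measure_pmf.prob ?A {xs. P xs} = measure_pmf.prob ?A ({xs. P xs} \<inter> set_pmf ?A)"
    by (simp add: measure_Int_set_pmf)
  also have "\<dots> \<le> measure_pmf.prob ?A (X \<union> {xs. \<exists>i<t. \<not> G (take (Suc i) xs)})"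
    by (intro measure_pmf.finite_measure_mono) (auto simp: X_def)
  also have "\<dots> \<le> measure_pmf.prob ?A X + measure_pmf.prob ?A {xs. \<exists>i<t. \<not> G (take (Suc i) xs)}"
    by (rule measure_Un_le) auto
  also have "measure_pmf.prob ?A X = (\<Sum>x\<in>X. pmf ?A x)" using fin by (simp add: measure_measure_pmf_finite)
  also have "\<dots> = (\<Sum>x\<in>X. pmf ?B x)"
    by (intro sum.cong refl adaptive_walk_annealed_kernel[symmetric])
      (auto simp: X_def dest: annealed_walk_length)
  also have "\<dots> = measure_pmf.prob ?B X" using fin by (simp add: measure_measure_pmf_finite)
  also have "\<dots> \<le> measure_pmf.prob ?B {xs. P xs}"
    by (intro measure_pmf.finite_measure_mono) (auto simp: X_def)
  finally show ?thesis by simp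
qed

section \<open>How much a path reveals about a single edge\<close>

lemma pmf_walk_step:
  assumes "finite (neighbours E x)" "neighbours E x \<noteq> {}"
  shows "pmf (walk_step E x) y = (if y \<in> neighbours E x then 1 / card (neighbours E x) else 0)"
  using assms by (simp add: walk_step_def indicator_def)

text \<open>At an endpoint of the new edge a degree \<open>N\<close> grows to \<open>N + 1\<close>,
  and \<open>N / (N + 1) \<ge> 1 - 1 / N \<ge> 1 - 1 / d\<close>.\<close>

lemma walk_step_insert:
  fixes d :: real
  assumes e: "e = {x, y}" "x \<noteq> y" "e \<notin> E" and fin: "finite (neighbours E z)"
    and d: "1 \<le> d" "d \<le> card (neighbours E z)"
  shows "(if z \<in> e then 1 - 1 / d else 1) * pmf (walk_step E z) w \<le> pmf (walk_step (insert e E) z) w"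
proof (cases "z \<in> e")
  case False
  then have "neighbours (insert e E) z = neighbours E z" using e by (auto simp: neighbours_def)
  then show ?thesis using False by (simp add: walk_step_def)
next
  case True
  then obtain y' where y': "e = {z, y'}" "y' \<noteq> z" using e by auto
  define N where "N = neighbours E z"
  have N': "neighbours (insert e E) z = insert y' N" and nin: "y' \<notin> N"
    using y' e(3) by (auto simp: neighbours_def N_def doubleton_eq_iff insert_commute)
  have ne: "N \<noteq> {}" using d by (auto simp: N_def)
  have 1: "pmf (walk_step E z) w = (if w \<in> N then 1 / card N else 0)"
    using pmf_walk_step[OF fin] ne by (simp add: N_def)
  have 2: "pmf (walk_step (insert e E) z) w = (if w \<in> insert y' N then 1 / (card N + 1) else 0)"
    using pmf_walk_step[of "insert e E" z w] fin N' nin by (simp add: N_def add.commute)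
  have "(1 - 1 / d) * (1 / card N) \<le> 1 / (card N + 1)"
  proof -
    have "d \<le> card N" using d by (simp add: N_def)
    then have "1 / real (card N) \<le> 1 / d" using d by (simp add: frac_le)
    then have "(1 - 1 / d) * (1 / card N) \<le> (1 - 1 / card N) * (1 / card N)" by (intro mult_right_mono) auto
    also have "\<dots> \<le> 1 / (card N + 1)" using ne \<open>d \<le> card N\<close> d by (simp add: field_simps)
    finally show ?thesis .
  qed
  then show ?thesis using True unfolding 1 2 by auto
qed

text \<open>Adding an edge changes the transition probabilities only at its two endpoints, and there only
  by a factor close to one; hence the path weight determines the edge only weakly.\<close>

lemma pmf_random_walk_insert:
  assumes e: "e = {x, y}" "x \<noteq> y" "e \<notin> E" and E: "E \<subseteq> all_edges n" and v: "v \<in> {1..n}"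
    and d: "1 \<le> d" "degrees_within n d D E"
  shows "(1 - 1 / d) ^ exits e xs * pmf (random_walk E v t) xs \<le> pmf (random_walk (insert e E) v t) xs"
proof (induction t arbitrary: xs)
  case 0
  have "(1 - 1 / d) ^ exits e xs \<le> 1" using d(1) by (intro power_le_one) auto
  then show ?case by (auto simp: indicator_def)
next
  case (Suc t)
  show ?case
  proof (cases "xs \<in> set_pmf (random_walk E v (Suc t))")
    case False
    then show ?thesis by (simp add: set_pmf_iff del: random_walk.simps)
  next
    case True
    then obtain ys w where ys: "xs = ys @ [w]" "ys \<in> set_pmf (random_walk E v t)" by auto
    have z: "set ys \<subseteq> {1..n}" "ys \<noteq> []" using random_walk_range[OF E v ys(2)] by auto
    then have zz: "last ys \<in> {1..n}" using last_in_set by blast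
    have fin: "finite (neighbours E (last ys))" using neighbours_subset[OF E] finite_subset by blast
    have step: "(if last ys \<in> e then 1 - 1 / d else 1) * pmf (walk_step E (last ys)) w \<le> pmf (walk_step (insert e E) (last ys)) w"
      by (rule walk_step_insert[OF e fin d(1)]) (use d(2) zz in \<open>simp add: degrees_within_def\<close>)
    have ex: "(1 - 1 / d) ^ exits e xs = (1 - 1 / d) ^ exits e ys * (if last ys \<in> e then 1 - 1 / d else 1)"
      using exits_snoc[OF z(2), of e w] ys by simp
    have 0: "0 \<le> 1 - 1 / d" using d(1) by simp
    have "(1 - 1 / d) ^ exits e xs * pmf (random_walk E v (Suc t)) xs =
       ((1 - 1 / d) ^ exits e ys * pmf (random_walk E v t) ys) *
       ((if last ys \<in> e then 1 - 1 / d else 1) * pmf (walk_step E (last ys)) w)"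
      unfolding ex unfolding ys(1) random_walk_adaptive pmf_adaptive_walk_snoc by (simp only: mult_ac)
    also have "\<dots> \<le> pmf (random_walk (insert e E) v t) ys * pmf (walk_step (insert e E) (last ys)) w"
      using 0 by (intro mult_mono Suc.IH step) auto
    also have "\<dots> = pmf (random_walk (insert e E) v (Suc t)) xs"
      unfolding ys(1) random_walk_adaptive pmf_adaptive_walk_snoc ..
    finally show ?thesis .
  qed
qed

text \<open>Bayes' rule with the path weight \<open>W\<close> as likelihood. In a regular graph,
  adding \<open>e\<close> lowers \<open>W\<close> by a factor of at least
  \<open>1 - \<kappa>\<close>, so resampling \<open>e\<close> shows that its posterior probability
  is almost the prior \<open>p\<close>. If \<open>e\<close> is present and degrees are at most
  \<open>b\<close>, the walk takes it with probability at least \<open>1 / b\<close>; irregular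
  graphs are charged to \<open>\<theta>\<close>.\<close>

lemma annealed_walk_next:
  fixes n :: nat and p a b m \<theta> :: real
  assumes p: "0 \<le> p" "p \<le> 1" and v: "v \<in> {1..n}" and y: "y \<in> {1..n}" "y \<noteq> last xs"
    and xs: "xs \<in> set_pmf (annealed_walk n p v t)"
    and a: "1 \<le> a" and b: "0 < b"
    and vis: "\<And>u. u \<in> {1..n} \<Longrightarrow> real (count_list xs u) \<le> m" and m: "2 * m \<le> \<kappa> * a" "\<kappa> \<le> 1"
    and post: "measure_pmf.expectation (gnp n p)
         (\<lambda>E. indicator {E. \<not> degrees_within n a b E} E * pmf (random_walk E v t) xs) \<le> \<theta> * pmf (annealed_walk n p v t) xs"
  shows "((1 - \<kappa>) * p * (1 - \<theta>) - \<theta>) / b * pmf (annealed_walk n p v t) xs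
           \<le> pmf (annealed_walk n p v (Suc t)) (xs @ [y])"
proof -
  define \<nu> where "\<nu> = pmf (annealed_walk n p v t) xs"
  define W where "W E = pmf (random_walk E v t) xs" for E
  define D where "D = (\<lambda>E. indicator {E. degrees_within n a b E} E :: real)"
  define e where "e = {last xs, y}"
  let ?E = "measure_pmf.expectation (gnp n p)"
  have rng: "set xs \<subseteq> {1..n}" "xs \<noteq> []" using annealed_walk_range[OF v xs] by auto
  then have x: "last xs \<in> {1..n}" using last_in_set by blast
  have e: "e \<in> all_edges n" using x y by (auto simp: e_def all_edges_def card_2_iff)
  have W0: "0 \<le> W E" for E by (simp add: W_def)
  have \<nu>: "?E W = \<nu>" unfolding \<nu>_def W_def pmf_annealed_walk ..
  have D01: "0 \<le> D E" "D E \<le> 1" for E by (auto simp: D_def indicator_def)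
  have bad: "?E (\<lambda>E. (1 - D E) * W E) \<le> \<theta> * \<nu>"
  proof -
    have "(\<lambda>E. (1 - D E) * W E) = (\<lambda>E. indicator {E. \<not> degrees_within n a b E} E * pmf (random_walk E v t) xs)"
      by (auto simp: D_def W_def indicator_def)
    then show ?thesis using post by (simp add: \<nu>_def)
  qed
  have key: "(1 - \<kappa>) * (p * (?E (\<lambda>E. D E * W E))) \<le> ?E (\<lambda>E. indicator {E. e \<in> E} E * W E)"
  proof -
    have "(1 - \<kappa>) * (p * (?E (\<lambda>E. D E * W E))) =
       ?E (\<lambda>E. (1 - \<kappa>) * (p * (p * (D (insert e E) * W (insert e E)) + (1 - p) * (D (E - {e}) * W (E - {e})))))"
      unfolding gnp_expectation_resample[OF e p, of "\<lambda>E. D E * W E"] by simp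
    also have "\<dots> \<le> ?E (\<lambda>E. p * W (insert e E))"
    proof (rule integral_mono_AE)
      show "AE E in measure_pmf (gnp n p). (1 - \<kappa>) * (p * (p * (D (insert e E) * W (insert e E)) + (1 - p) * (D (E - {e}) * W (E - {e})))) \<le> p * W (insert e E)"
        unfolding AE_measure_pmf_iff
      proof
        fix E assume "E \<in> set_pmf (gnp n p)"
        then have E: "E - {e} \<subseteq> all_edges n" using set_pmf_gnp by blast
        \<comment> \<open>Each of the at most \<open>2 * m \<le> \<kappa> * a\<close> steps started
          in \<open>e\<close> costs a factor \<open>1 - 1 / a\<close>, and Bernoulli's inequality
          leaves \<open>1 - \<kappa>\<close>. Because \<open>D\<close> is resampled together with
          \<open>W\<close>, the degrees in question are those of \<open>E - {e}\<close>.\<close>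
        have A: "(1 - \<kappa>) * (D (E - {e}) * W (E - {e})) \<le> W (insert e E)"
        proof (cases "degrees_within n a b (E - {e})")
          case True
          have "real (exits e xs) \<le> 2 * m"
          proof -
            have c: "count_list (butlast xs) u \<le> count_list xs u" for u
            proof -
              have "count_list xs u = count_list (butlast xs @ [last xs]) u" using rng by simp
              then show ?thesis by (simp del: append_butlast_last_id)
            qed
            have "exits e xs = (\<Sum>u\<in>e. count_list (butlast xs) u)"
              unfolding exits_def by (rule length_filter_eq_sum_count) (simp add: e_def)
            also have "\<dots> = count_list (butlast xs) (last xs) + count_list (butlast xs) y"
              using y by (simp add: e_def)
            also have "\<dots> \<le> count_list xs (last xs) + count_list xs y" by (intro add_mono c)
            finally have "real (exits e xs) \<le> real (count_list xs (last xs)) + real (count_list xs y)" by linarith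
            then show ?thesis using vis[OF x] vis[OF y(1)] by linarith
          qed
          then have "real (exits e xs) \<le> \<kappa> * a" using m by linarith
          then have "1 - \<kappa> \<le> 1 + real (exits e xs) * (- (1 / a))" using a by (simp add: field_simps)
          also have "\<dots> \<le> (1 + - (1 / a)) ^ exits e xs" by (rule Bernoulli_inequality) (use a in auto)
          finally have "(1 - \<kappa>) * W (E - {e}) \<le> (1 - 1 / a) ^ exits e xs * W (E - {e})"
            using W0 by (intro mult_right_mono) auto
          also have "\<dots> \<le> W (insert e (E - {e}))"
            unfolding W_def by (rule pmf_random_walk_insert[OF e_def _ _ E v a True]) (use y in auto)
          finally show ?thesis using True by (simp add: D_def)
        qed (use W0 in \<open>simp add: D_def\<close>)
        have B: "(1 - \<kappa>) * (D (insert e E) * W (insert e E)) \<le> W (insert e E)"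
        proof -
          have "0 \<le> m" using vis[OF x] by (rule order_trans[rotated]) simp
          then have "0 \<le> \<kappa> * a" using m(1) by linarith
          then have "0 \<le> \<kappa>" using a by (simp add: zero_le_mult_iff)
          then have "(1 - \<kappa>) * D (insert e E) \<le> 1" using D01 m(2) by (intro mult_le_one) auto
          from mult_right_mono[OF this W0, of "insert e E"] show ?thesis by (simp add: mult.assoc)
        qed
        have "p * ((1 - \<kappa>) * (D (insert e E) * W (insert e E))) + (1 - p) * ((1 - \<kappa>) * (D (E - {e}) * W (E - {e})))
           \<le> p * W (insert e E) + (1 - p) * W (insert e E)"
          using p A B by (intro add_mono mult_left_mono) auto
        also have "\<dots> = W (insert e E)" by (simp add: algebra_simps)
        finally have "p * (p * ((1 - \<kappa>) * (D (insert e E) * W (insert e E))) + (1 - p) * ((1 - \<kappa>) * (D (E - {e}) * W (E - {e}))))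
           \<le> p * W (insert e E)" using p by (intro mult_left_mono) auto
        then show "(1 - \<kappa>) * (p * (p * (D (insert e E) * W (insert e E)) + (1 - p) * (D (E - {e}) * W (E - {e})))) \<le> p * W (insert e E)"
          by (simp add: algebra_simps)
      qed
    qed auto
    also have "\<dots> = ?E (\<lambda>E. indicator {E. e \<in> E} E * W E)"
      unfolding gnp_expectation_resample[OF e p, of "\<lambda>E. indicator {E. e \<in> E} E * W E"] by simp
    finally show ?thesis .
  qed
  have "?E (\<lambda>E. W E - (1 - D E) * W E) = ?E W - ?E (\<lambda>E. (1 - D E) * W E)"
    by (rule Bochner_Integration.integral_diff) auto
  moreover have "(\<lambda>E. D E * W E) = (\<lambda>E. W E - (1 - D E) * W E)" by (rule ext) (simp add: left_diff_distrib)
  ultimately have "?E (\<lambda>E. D E * W E) = \<nu> - ?E (\<lambda>E. (1 - D E) * W E)" by (simp only: \<nu>)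
  then have "(1 - \<theta>) * \<nu> \<le> ?E (\<lambda>E. D E * W E)"
    using bad left_diff_distrib[of 1 \<theta> \<nu>] by linarith
  then have "(1 - \<kappa>) * (p * ((1 - \<theta>) * \<nu>)) \<le> (1 - \<kappa>) * (p * ?E (\<lambda>E. D E * W E))"
    using p m(2) by (intro mult_left_mono) auto
  with key have 1: "(1 - \<kappa>) * (p * ((1 - \<theta>) * \<nu>)) \<le> ?E (\<lambda>E. indicator {E. e \<in> E} E * W E)"
    by linarith
  \<comment> \<open>A next step along \<open>e\<close> is likely enough only where the degrees are
    regular; discarding the other graphs costs at most \<open>\<theta> * \<nu>\<close>.\<close>
  have "?E (\<lambda>E. indicator {E. e \<in> E} E * W E) - \<theta> * \<nu> \<le> ?E (\<lambda>E. indicator {E. e \<in> E} E * W E) - ?E (\<lambda>E. (1 - D E) * W E)"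
    using bad by simp
  also have "\<dots> = ?E (\<lambda>E. indicator {E. e \<in> E} E * W E - (1 - D E) * W E)"
    by (subst Bochner_Integration.integral_diff) auto
  also have "\<dots> \<le> ?E (\<lambda>E. b * (W E * pmf (walk_step E (last xs)) y))"
  proof (rule integral_mono_AE)
    show "AE E in measure_pmf (gnp n p). indicator {E. e \<in> E} E * W E - (1 - D E) * W E \<le> b * (W E * pmf (walk_step E (last xs)) y)"
      unfolding AE_measure_pmf_iff
    proof
      fix E assume "E \<in> set_pmf (gnp n p)"
      then have E: "E \<subseteq> all_edges n" using set_pmf_gnp by blast
      have rhs0: "0 \<le> b * (W E * pmf (walk_step E (last xs)) y)" using b W0 by simp
      show "indicator {E. e \<in> E} E * W E - (1 - D E) * W E \<le> b * (W E * pmf (walk_step E (last xs)) y)"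
      proof (cases "e \<in> E \<and> degrees_within n a b E")
        case True
        have c: "real (card (neighbours E (last xs))) \<le> b" "a \<le> real (card (neighbours E (last xs)))"
          using True x by (auto simp: degrees_within_def)
        have ne: "neighbours E (last xs) \<noteq> {}" using c(2) a by auto
        have fin: "finite (neighbours E (last xs))" using neighbours_subset[OF E] finite_subset by blast
        have "y \<in> neighbours E (last xs)" using True y by (auto simp: neighbours_def e_def)
        then have "pmf (walk_step E (last xs)) y = 1 / card (neighbours E (last xs))"
          using pmf_walk_step[OF fin ne] by simp
        then have "real (card (neighbours E (last xs))) * pmf (walk_step E (last xs)) y = 1"
          using c a by simp
        then have "1 \<le> b * pmf (walk_step E (last xs)) y"
          using mult_right_mono[OF c(1), of "pmf (walk_step E (last xs)) y"] by simp
        then have "W E * 1 \<le> W E * (b * pmf (walk_step E (last xs)) y)" using W0 by (intro mult_left_mono) auto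
        then show ?thesis using True by (simp add: D_def mult_ac)
      next
        case False
        then have "indicator {E. e \<in> E} E * W E - (1 - D E) * W E \<le> 0" using W0[of E] by (auto simp: D_def indicator_def)
        then show ?thesis using rhs0 by linarith
      qed
    qed
  qed auto
  also have "\<dots> = b * pmf (annealed_walk n p v (Suc t)) (xs @ [y])"
    unfolding pmf_annealed_walk_snoc W_def by simp
  finally have "(1 - \<kappa>) * (p * ((1 - \<theta>) * \<nu>)) - \<theta> * \<nu> \<le> b * pmf (annealed_walk n p v (Suc t)) (xs @ [y])"
    using 1 by linarith
  then have "((1 - \<kappa>) * p * (1 - \<theta>) - \<theta>) * \<nu> \<le> b * pmf (annealed_walk n p v (Suc t)) (xs @ [y])"
    by (simp only: left_diff_distrib mult.assoc)
  then have "((1 - \<kappa>) * p * (1 - \<theta>) - \<theta>) * \<nu> / b \<le> pmf (annealed_walk n p v (Suc t)) (xs @ [y])"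
    using b by (simp only: pos_divide_le_eq mult.commute)
  then show ?thesis by (simp only: \<nu>_def times_divide_eq_left)
qed

section \<open>Exceptional histories and their probability\<close>

lemma prob_bind_pmf:
  fixes f :: "'b \<Rightarrow> 'a pmf" and S :: "'a set"
  shows "measure_pmf.prob (bind_pmf M f) S = measure_pmf.expectation M (\<lambda>x. measure_pmf.prob (f x) S)"
proof -
  have *: "measure_pmf.prob M S = pmf (map_pmf (\<lambda>x. x \<in> S) M) True" for M :: "'a pmf"
    by (simp add: pmf_map vimage_def)
  show ?thesis unfolding * by (simp add: map_bind_pmf pmf_bind)
qed

text \<open>Markov's inequality for the posterior probability of \<open>D\<close>, whose mean over
  the annealed paths is the prior probability of \<open>D\<close>.\<close>

lemma annealed_posterior_tail:
  assumes v: "v \<in> {1..n}" and \<theta>: "0 < \<theta>"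
  shows "measure_pmf.prob (annealed_walk n p v t)
      {xs. \<theta> * pmf (annealed_walk n p v t) xs <
         measure_pmf.expectation (gnp n p) (\<lambda>E. indicator D E * pmf (random_walk E v t) xs)}
     \<le> measure_pmf.prob (gnp n p) D / \<theta>"
proof -
  let ?A = "annealed_walk n p v t" and ?E = "measure_pmf.expectation (gnp n p)"
  define X where "X = {xs. \<theta> * pmf ?A xs < ?E (\<lambda>E. indicator D E * pmf (random_walk E v t) xs)} \<inter> set_pmf ?A"
  have fin: "finite X" using finite_annealed_walk[OF v] by (simp add: X_def)
  have "\<theta> * measure_pmf.prob ?A X = (\<Sum>xs\<in>X. \<theta> * pmf ?A xs)"
    using fin by (simp add: measure_measure_pmf_finite sum_distrib_left)
  also have "\<dots> \<le> (\<Sum>xs\<in>X. ?E (\<lambda>E. indicator D E * pmf (random_walk E v t) xs))"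
    by (intro sum_mono) (auto simp: X_def)
  also have "\<dots> = ?E (\<lambda>E. \<Sum>xs\<in>X. indicator D E * pmf (random_walk E v t) xs)"
    by (subst Bochner_Integration.integral_sum) auto
  also have "\<dots> \<le> ?E (\<lambda>E. indicator D E)"
  proof (rule integral_mono_AE)
    have "(\<Sum>xs\<in>X. indicator D E * pmf (random_walk E v t) xs) = indicator D E * measure_pmf.prob (random_walk E v t) X" for E
      using fin by (simp add: measure_measure_pmf_finite sum_distrib_left)
    then show "AE E in measure_pmf (gnp n p). (\<Sum>xs\<in>X. indicator D E * pmf (random_walk E v t) xs) \<le> indicator D E"
      by (auto simp: indicator_def)
  qed auto
  also have "\<dots> = measure_pmf.prob (gnp n p) D" by simp
  finally have "measure_pmf.prob ?A X \<le> measure_pmf.prob (gnp n p) D / \<theta>" using \<theta> by (simp add: field_simps)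
  then show ?thesis by (simp add: X_def measure_Int_set_pmf)
qed

lemma annealed_visits_tail:
  fixes p A :: real
  assumes v: "v \<in> {1..n}" and n: "2 \<le> n" and A: "0 < A"
  shows "measure_pmf.prob (annealed_walk n p v T) {xs. \<exists>u\<in>{1..n}. m < count_list xs u}
    \<le> measure_pmf.prob (gnp n p) {E. \<not> (degrees_within n A (3 * A) E \<and> cut_expander n (A / 4) E)}
      + n * (2 * (4607 / 4608) ^ m * (1 / (1 - 1 / n)) ^ T)"
proof -
  define B where "B = {E. \<not> (degrees_within n A (3 * A) E \<and> cut_expander n (A / 4) E)}"
  define c where "c = n * (2 * (4607 / 4608 :: real) ^ m * (1 / (1 - 1 / n)) ^ T)"
  have c0: "0 \<le> c" using n by (simp add: c_def)
  let ?X = "{xs. \<exists>u\<in>{1..n}. m < count_list xs u}"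
  have "measure_pmf.prob (annealed_walk n p v T) ?X = measure_pmf.expectation (gnp n p) (\<lambda>E. measure_pmf.prob (random_walk E v T) ?X)"
    unfolding annealed_walk_def by (rule prob_bind_pmf)
  also have "\<dots> \<le> measure_pmf.expectation (gnp n p) (\<lambda>E. indicator B E + c)"
  proof (rule integral_mono_AE)
    show "AE E in measure_pmf (gnp n p). measure_pmf.prob (random_walk E v T) ?X \<le> indicator B E + c"
      unfolding AE_measure_pmf_iff
    proof
      fix E assume "E \<in> set_pmf (gnp n p)"
      then have E: "E \<subseteq> all_edges n" using set_pmf_gnp by blast
      show "measure_pmf.prob (random_walk E v T) ?X \<le> indicator B E + c"
      proof (cases "E \<in> B")
        case True
        then show ?thesis using c0 by (simp add: add_increasing2)
      next
        case False
        have "?X = (\<Union>u\<in>{1..n}. {xs. m < count_list xs u})" by auto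
        then have "measure_pmf.prob (random_walk E v T) ?X \<le> (\<Sum>u\<in>{1..n}. measure_pmf.prob (random_walk E v T) {xs. m < count_list xs u})"
          by (simp only:) (rule measure_pmf.finite_measure_subadditive_finite, auto)
        also have "\<dots> \<le> (\<Sum>u\<in>{1..n}. 2 * (4607 / 4608 :: real) ^ m * (1 / (1 - 1 / n)) ^ T)"
          using False by (intro sum_mono walk_visits_tail[OF E n A _ _ _ v]) (auto simp: B_def)
        also have "\<dots> = c" by (simp add: c_def)
        finally show ?thesis using False by simp
      qed
    qed
  qed auto
  also have "\<dots> = measure_pmf.prob (gnp n p) B + c" by simp
  finally show ?thesis by (simp add: B_def c_def)
qed

text \<open>The second condition says that, given the path, the posterior probability of an irregular degree
  is at most \<open>\<theta>\<close>.\<close>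

definition good_history :: "nat \<Rightarrow> real \<Rightarrow> nat \<Rightarrow> real \<Rightarrow> real \<Rightarrow> nat \<Rightarrow> real \<Rightarrow> nat list \<Rightarrow> bool" where
  "good_history n p v a b m \<theta> xs \<longleftrightarrow> (\<forall>u\<in>{1..n}. count_list xs u \<le> m) \<and>
     measure_pmf.expectation (gnp n p) (\<lambda>E. indicator {E. \<not> degrees_within n a b E} E *
        pmf (random_walk E v (length xs - 1)) xs) \<le> \<theta> * pmf (annealed_walk n p v (length xs - 1)) xs"

text \<open>Visit counts only grow, so the full path controls all its prefixes at once. The
  posterior condition has no such monotonicity and is paid for separately at each of the
  \<open>L\<close> times.\<close>

lemma good_history_fail:
  assumes v: "v \<in> {1..n}" and \<theta>: "0 < \<theta>"
  shows "measure_pmf.prob (annealed_walk n p v L) {xs. \<exists>i<L. \<not> good_history n p v a b m \<theta> (take (Suc i) xs)}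
    \<le> measure_pmf.prob (annealed_walk n p v L) {xs. \<exists>u\<in>{1..n}. m < count_list xs u}
      + L * (measure_pmf.prob (gnp n p) {E. \<not> degrees_within n a b E} / \<theta>)"
proof -
  let ?A = "annealed_walk n p v L"
  let ?V = "{xs. \<exists>u\<in>{1..n}. m < count_list xs u}"
  define D where "D = {E. \<not> degrees_within n a b E}"
  define Y where "Y i = {xs. \<theta> * pmf (annealed_walk n p v i) xs <
     measure_pmf.expectation (gnp n p) (\<lambda>E. indicator D E * pmf (random_walk E v i) xs)}" for i
  define Z where "Z i = {xs. take (Suc i) xs \<in> Y i}" for i
  have "measure_pmf.prob ?A {xs. \<exists>i<L. \<not> good_history n p v a b m \<theta> (take (Suc i) xs)}
     = measure_pmf.prob ?A ({xs. \<exists>i<L. \<not> good_history n p v a b m \<theta> (take (Suc i) xs)} \<inter> set_pmf ?A)"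
    by (simp add: measure_Int_set_pmf)
  also have "\<dots> \<le> measure_pmf.prob ?A (?V \<union> (\<Union>i\<in>{..<L}. Z i))"
  proof (rule measure_pmf.finite_measure_mono)
    show "{xs. \<exists>i<L. \<not> good_history n p v a b m \<theta> (take (Suc i) xs)} \<inter> set_pmf ?A \<subseteq> ?V \<union> (\<Union>i\<in>{..<L}. Z i)"
    proof
      fix xs assume "xs \<in> {xs. \<exists>i<L. \<not> good_history n p v a b m \<theta> (take (Suc i) xs)} \<inter> set_pmf ?A"
      then obtain i where i: "i < L" "\<not> good_history n p v a b m \<theta> (take (Suc i) xs)" "length xs = Suc L"
        by (auto dest: annealed_walk_length)
      show "xs \<in> ?V \<union> (\<Union>i\<in>{..<L}. Z i)"
      proof (cases "xs \<in> ?V")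
        case False
        have "count_list (take (Suc i) xs) u \<le> count_list xs u" for u
          using count_list_append[of "take (Suc i) xs" "drop (Suc i) xs" u] by simp
        then have "\<forall>u\<in>{1..n}. count_list (take (Suc i) xs) u \<le> m"
          using False by (auto simp: not_less intro: order_trans)
        moreover have "length (take (Suc i) xs) - 1 = i" using i by simp
        ultimately have "take (Suc i) xs \<in> Y i"
          using i(2) by (simp add: good_history_def Y_def D_def not_le)
        then show ?thesis using i(1) by (auto simp: Z_def)
      qed blast
    qed
  qed simp
  also have "\<dots> \<le> measure_pmf.prob ?A ?V + measure_pmf.prob ?A (\<Union>i\<in>{..<L}. Z i)"
    by (rule measure_Un_le) auto
  also have "measure_pmf.prob ?A (\<Union>i\<in>{..<L}. Z i) \<le> (\<Sum>i\<in>{..<L}. measure_pmf.prob ?A (Z i))"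
    by (rule measure_pmf.finite_measure_subadditive_finite) auto
  also have "\<dots> \<le> (\<Sum>i\<in>{..<L}. measure_pmf.prob (gnp n p) D / \<theta>)"
  proof (rule sum_mono)
    fix i assume "i \<in> {..<L}"
    then have L: "L = i + (L - i)" by simp
    have "measure_pmf.prob ?A (Z i) = measure_pmf.prob (map_pmf (take (Suc i)) ?A) (Y i)"
      by (simp add: Z_def vimage_def)
    also have "map_pmf (take (Suc i)) ?A = annealed_walk n p v i"
      by (subst L) (rule annealed_walk_take)
    also have "measure_pmf.prob (annealed_walk n p v i) (Y i) \<le> measure_pmf.prob (gnp n p) D / \<theta>"
      unfolding Y_def by (rule annealed_posterior_tail[OF v \<theta>])
    finally show "measure_pmf.prob ?A (Z i) \<le> measure_pmf.prob (gnp n p) D / \<theta>" .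
  qed
  also have "\<dots> = L * (measure_pmf.prob (gnp n p) D / \<theta>)" by simp
  finally show ?thesis by (simp add: D_def)
qed

lemma annealed_kernel_spread:
  fixes p a b :: real
  assumes p: "0 \<le> p" "p \<le> 1" and v: "v \<in> {1..n}" and a: "1 \<le> a" and b: "0 < b"
    and m: "2 * real m \<le> \<kappa> * a" "\<kappa> \<le> 1" and r: "r \<le> ((1 - \<kappa>) * p * (1 - \<theta>) - \<theta>) / b" "r \<le> 1 / n"
  shows "spread_kernel n r (annealed_kernel n p v (good_history n p v a b m \<theta>))"
  unfolding spread_kernel_def
proof (intro allI ballI)
  fix xs y assume y: "y \<in> {1..n} - {last xs}"
  let ?G = "good_history n p v a b m \<theta>"
  show "r \<le> pmf (annealed_kernel n p v ?G xs) y"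
  proof (cases "?G xs \<and> xs \<in> set_pmf (annealed_walk n p v (length xs - 1))")
    case True
    define t where "t = length xs - 1"
    have xs: "?G xs" "xs \<in> set_pmf (annealed_walk n p v t)" using True by (auto simp: t_def)
    have "0 < pmf (annealed_walk n p v t) xs" using xs(2) by (simp add: pmf_positive)
    moreover have "((1 - \<kappa>) * p * (1 - \<theta>) - \<theta>) / b * pmf (annealed_walk n p v t) xs
       \<le> pmf (annealed_walk n p v (Suc t)) (xs @ [y])"
    proof (rule annealed_walk_next[OF p v _ _ xs(2) a b _ m])
      show "real (count_list xs u) \<le> real m" if "u \<in> {1..n}" for u
        using xs(1) that by (simp add: good_history_def)
    qed (use xs(1) y in \<open>auto simp: good_history_def t_def\<close>)
    ultimately have "((1 - \<kappa>) * p * (1 - \<theta>) - \<theta>) / b \<le> pmf (annealed_kernel n p v ?G xs) y"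
      unfolding annealed_kernel_good(1)[where G = ?G, OF xs] by (simp only: pos_le_divide_eq)
    then show ?thesis using r by linarith
  next
    case False
    have "pmf (annealed_kernel n p v ?G xs) y = 1 / n"
      unfolding annealed_kernel_def using False y by (subst if_not_P) auto
    then show ?thesis using r by simp
  qed
qed

section \<open>Conclusion\<close>

text \<open>The power 6 must survive a union over \<open>n\<close> vertices, over \<open>L\<close>
  times, and the factor \<open>n\<^sup>2\<close> of the posterior threshold. It comes from
  \<open>24 / \<delta>\<^sup>2\<close> and the Chernoff exponent
  \<open>\<delta>\<^sup>2 / 4\<close>; the power 4 for cuts comes from 32 and the exponent
  \<open>1 / 8\<close>.\<close>

lemma gnp_fail_le:
  fixes p \<delta> C :: real
  assumes p: "p \<le> 1" "C * ln n / n \<le> p" and n: "3 \<le> n" and \<delta>: "0 < \<delta>" "\<delta> \<le> 1 / 2"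
    and C: "32 \<le> C" "24 / \<delta>\<^sup>2 \<le> C"
  shows "measure_pmf.prob (gnp n p) {E. \<not> degrees_within n ((1 - \<delta>) * n * p) ((1 + \<delta>) * n * p) E}
           \<le> n * (4 * exp (- 6 * ln n))" (is "?D \<le> _")
    and "measure_pmf.prob (gnp n p) {E. \<not> (degrees_within n (n * p / 2) (3 * (n * p / 2)) E \<and> cut_expander n (n * p / 2 / 4) E)}
           \<le> n * (4 * exp (- 6 * ln n)) + ((1 + exp (- 4 * ln n)) ^ n - 1)"
proof -
  have ln0: "0 \<le> ln (real n)" using n by simp
  have np: "C * ln n \<le> n * p" using p n by (simp add: field_simps)
  have p0: "0 \<le> p" using p(2) C ln0 n by (meson divide_nonneg_nonneg mult_nonneg_nonneg of_nat_0_le_iff order_trans zero_le_numeral)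
  have "24 * ln n \<le> \<delta>\<^sup>2 * C * ln n" using C(2) \<delta> ln0 by (intro mult_right_mono) (simp_all add: field_simps)
  also have "\<dots> \<le> \<delta>\<^sup>2 * (n * p)" using np by (simp add: mult.assoc mult_left_mono)
  finally have e6: "exp (- \<delta>\<^sup>2 * n * p / 4) \<le> exp (- 6 * ln n)" by simp
  have D: "?D \<le> n * (4 * exp (- \<delta>\<^sup>2 * n * p / 4))" using \<delta> by (intro gnp_degrees p0 p(1)) auto
  also have "\<dots> \<le> n * (4 * exp (- 6 * ln n))" using e6 by (intro mult_left_mono) auto
  finally show D: "?D \<le> n * (4 * exp (- 6 * ln n))" .
  have "32 * ln n \<le> C * ln n" using C(1) ln0 by (rule mult_right_mono)
  with np have "exp (- real n * p / 8) \<le> exp (- 4 * ln n)" by simp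
  then have "(1 + exp (- real n * p / 8)) ^ n \<le> (1 + exp (- 4 * ln n)) ^ n"
    by (intro power_mono add_left_mono add_nonneg_nonneg) auto
  then have X: "measure_pmf.prob (gnp n p) {E. \<not> cut_expander n (n * p / 8) E} \<le> (1 + exp (- 4 * ln n)) ^ n - 1"
    using gnp_cut_expander[OF p0 p(1), of n] by linarith
  have sub: "degrees_within n (n * p / 2) (3 * (n * p / 2)) E" if "degrees_within n ((1 - \<delta>) * n * p) ((1 + \<delta>) * n * p) E" for E
  proof -
    have np2: "1 / 2 * (n * p) \<le> (1 - \<delta>) * (n * p)" "(1 + \<delta>) * (n * p) \<le> 3 / 2 * (n * p)"
      using \<delta> p0 by (intro mult_right_mono; simp)+
    show ?thesis
      unfolding degrees_within_def
    proof
      fix x assume "x \<in> {1..n}"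
      then have "(1 - \<delta>) * (n * p) \<le> card (neighbours E x)" "card (neighbours E x) \<le> (1 + \<delta>) * (n * p)"
        using that unfolding degrees_within_def by (auto simp: mult.assoc)
      with np2 show "n * p / 2 \<le> card (neighbours E x) \<and> card (neighbours E x) \<le> 3 * (n * p / 2)"
        by linarith
    qed
  qed
  have "measure_pmf.prob (gnp n p) {E. \<not> (degrees_within n (n * p / 2) (3 * (n * p / 2)) E \<and> cut_expander n (n * p / 2 / 4) E)}
     \<le> measure_pmf.prob (gnp n p) ({E. \<not> degrees_within n ((1 - \<delta>) * n * p) ((1 + \<delta>) * n * p) E} \<union> {E. \<not> cut_expander n (n * p / 8) E})"
    using sub by (intro measure_pmf.finite_measure_mono) auto
  also have "\<dots> \<le> ?D + measure_pmf.prob (gnp n p) {E. \<not> cut_expander n (n * p / 8) E}"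
    by (rule measure_Un_le) auto
  finally show "measure_pmf.prob (gnp n p) {E. \<not> (degrees_within n (n * p / 2) (3 * (n * p / 2)) E \<and> cut_expander n (n * p / 2 / 4) E)}
           \<le> n * (4 * exp (- 6 * ln n)) + ((1 + exp (- 4 * ln n)) ^ n - 1)"
    using D X by linarith
qed

text \<open>Undoing the killing costs at most \<open>exp (2 * (1 + \<epsilon>) * ln n)\<close>, by
  \<open>1 / (1 - 1 / n) \<le> exp (2 / n)\<close>. The multiple of \<open>ln n\<close> in the visit
  bound is chosen to pay for this and leave \<open>exp (- 3 * ln n)\<close>; rounding it down costs
  \<open>4608 / 4607 \<le> 2\<close>.\<close>

lemma visits_exponent:
  fixes \<epsilon> :: real
  assumes \<epsilon>: "0 < \<epsilon>" and n: "3 \<le> n"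
  shows "(4607 / 4608) ^ nat \<lfloor>(2 * (1 + \<epsilon>) + 3) / ln (4608 / 4607) * ln n\<rfloor> *
      (1 / (1 - 1 / n)) ^ nat \<lfloor>(1 + \<epsilon>) * real n * ln n\<rfloor> \<le> 2 * exp (- 3 * ln n)"
proof -
  define l where "l = ln (4608 / 4607 :: real)"
  define K where "K = (2 * (1 + \<epsilon>) + 3) / l"
  define m where "m = nat \<lfloor>K * ln n\<rfloor>"
  define L where "L = nat \<lfloor>(1 + \<epsilon>) * real n * ln n\<rfloor>"
  have l: "0 < l" by (simp add: l_def)
  have el: "exp l = 4608 / 4607" by (simp add: l_def)
  have eml: "exp (- l) = 4607 / 4608" unfolding exp_minus el by simp
  have ln0: "0 \<le> ln (real n)" using n by simp
  have "(4607 / 4608 :: real) ^ m = exp (- l * m)"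
    unfolding exp_of_nat2_mult eml ..
  also have "\<dots> \<le> exp (l - (2 * (1 + \<epsilon>) + 3) * ln n)"
  proof -
    have "K * ln n - 1 \<le> m" unfolding m_def by linarith
    then have "l * (K * ln n - 1) \<le> l * m" using l by (intro mult_left_mono) auto
    moreover have "l * (K * ln n - 1) = (2 * (1 + \<epsilon>) + 3) * ln n - l" using l by (simp add: K_def field_simps)
    ultimately show ?thesis by simp
  qed
  finally have 1: "(4607 / 4608 :: real) ^ m \<le> exp (l - (2 * (1 + \<epsilon>) + 3) * ln n)" .
  have "1 / (1 - 1 / n) \<le> exp (2 / n)"
  proof -
    have "1 / (1 - 1 / n) \<le> 1 + 2 / n" using n by (simp add: field_simps)
    also have "\<dots> \<le> exp (2 / n)" by (rule exp_ge_add_one_self)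
    finally show ?thesis .
  qed
  then have "(1 / (1 - 1 / n)) ^ L \<le> exp (2 / n) ^ L" using n by (intro power_mono) auto
  also have "\<dots> = exp (2 / n * L)" by (rule exp_of_nat2_mult[symmetric])
  also have "\<dots> \<le> exp (2 * (1 + \<epsilon>) * ln n)"
  proof -
    have "real L \<le> (1 + \<epsilon>) * real n * ln n" unfolding L_def using \<epsilon> ln0 by (simp add: of_nat_nat)
    then have "2 / n * L \<le> 2 / n * ((1 + \<epsilon>) * real n * ln n)" by (intro mult_left_mono) auto
    also have "\<dots> = 2 * (1 + \<epsilon>) * ln n" using n by simp
    finally show ?thesis by simp
  qed
  finally have 2: "(1 / (1 - 1 / n)) ^ L \<le> exp (2 * (1 + \<epsilon>) * ln n)" .
  have "(4607 / 4608) ^ m * (1 / (1 - 1 / n)) ^ L \<le> exp (l - (2 * (1 + \<epsilon>) + 3) * ln n) * exp (2 * (1 + \<epsilon>) * ln n)"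
    using n by (intro mult_mono 1 2) auto
  also have "\<dots> = exp l * exp (- 3 * ln n)" by (simp add: exp_add[symmetric] algebra_simps)
  also have "\<dots> \<le> 2 * exp (- 3 * ln n)" unfolding el by (intro mult_right_mono) auto
  finally show ?thesis unfolding m_def L_def K_def l_def .
qed

lemma annealed_walk_good:
  fixes \<epsilon> :: real
  assumes \<epsilon>: "0 < \<epsilon>"
  shows "\<exists>C>0. \<exists>\<beta>>0. \<exists>B::nat \<Rightarrow> real. B \<longlonglongrightarrow> 0 \<and> (\<forall>\<^sub>F n in sequentially. \<forall>p v.
     C * ln n / n \<le> p \<longrightarrow> p \<le> 1 \<longrightarrow> v \<in> {1..n} \<longrightarrow>
     measure_pmf.prob (annealed_walk n p v (nat \<lfloor>(1 + \<epsilon>) * real n * ln n\<rfloor>))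
       {xs. deficient n (nat \<lceil>\<beta> * ln n\<rceil>) xs} \<le> B n)"
proof -
  obtain \<beta> \<kappa> b where \<beta>: "0 < \<beta>" and \<kappa>: "0 < \<kappa>" "\<kappa> < 1" and b: "b \<longlonglongrightarrow> 0"
    and good: "\<forall>\<^sub>F n in sequentially. \<forall>Q v.
     spread_kernel n ((1 - \<kappa>) / n) Q \<longrightarrow> (\<forall>xs. set_pmf (Q xs) \<subseteq> {1..n}) \<longrightarrow> v \<in> {1..n} \<longrightarrow>
     measure_pmf.prob (adaptive_walk Q v (nat \<lfloor>(1 + \<epsilon>) * real n * ln n\<rfloor>))
       {xs. deficient n (nat \<lceil>\<beta> * ln n\<rceil>) xs} \<le> b n"
    using adaptive_walk_good[OF \<epsilon>] by blast
  \<comment> \<open>The visit bound is \<open>K * ln n\<close>. Taking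
    \<open>C \<ge> 16 * K / \<kappa>\<close> makes twice this at most \<open>\<kappa> / 4\<close>
    times the minimal degree, which is at least \<open>n * p / 2\<close>;
    \<open>\<kappa> / 4\<close> for visits, \<open>\<delta> = \<kappa> / 4\<close> for degrees and
    the posterior threshold together stay within the allowed loss \<open>\<kappa>\<close>.\<close>
  define K where "K = (2 * (1 + \<epsilon>) + 3) / ln (4608 / 4607)"
  define \<delta> where "\<delta> = \<kappa> / 4"
  define C where "C = max 32 (max (24 / \<delta>\<^sup>2) (16 * K / \<kappa>))"
  define Dn where "Dn n = real n * (4 * exp (- 6 * ln n))" for n :: nat
  define B where "B n = b n + ((Dn n + ((1 + exp (- 4 * ln n)) ^ n - 1) + n * (2 * (2 * exp (- 3 * ln n))))
      + (1 + \<epsilon>) * n * ln n * (Dn n * (real n)\<^sup>2))" for n :: nat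
  have K: "0 < K" using \<epsilon> by (simp add: K_def)
  have \<delta>: "0 < \<delta>" "\<delta> \<le> 1 / 2" using \<kappa> by (auto simp: \<delta>_def)
  have C: "32 \<le> C" "24 / \<delta>\<^sup>2 \<le> C" "16 * K / \<kappa> \<le> C" by (auto simp: C_def)
  have "B \<longlonglongrightarrow> 0 + 0" unfolding B_def
  proof (rule tendsto_add[OF b])
    show "(\<lambda>n. (Dn n + ((1 + exp (- 4 * ln (real n))) ^ n - 1) + n * (2 * (2 * exp (- 3 * ln (real n)))))
      + (1 + \<epsilon>) * n * ln n * (Dn n * (real n)\<^sup>2)) \<longlonglongrightarrow> 0"
      unfolding Dn_def using \<epsilon> by real_asymp
  qed
  then have B: "B \<longlonglongrightarrow> 0" by simp
  have "\<forall>\<^sub>F n in sequentially. \<forall>p v. C * ln n / n \<le> p \<longrightarrow> p \<le> 1 \<longrightarrow> v \<in> {1..n} \<longrightarrow>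
     measure_pmf.prob (annealed_walk n p v (nat \<lfloor>(1 + \<epsilon>) * real n * ln n\<rfloor>))
       {xs. deficient n (nat \<lceil>\<beta> * ln n\<rceil>) xs} \<le> B n"
    using good eventually_ge_at_top[of "max 3 (nat \<lceil>8 / \<kappa>\<rceil>)"]
  proof (eventually_elim, intro allI impI)
    fix n :: nat and p :: real and v :: nat
    assume adapt: "\<forall>Q v. spread_kernel n ((1 - \<kappa>) / n) Q \<longrightarrow> (\<forall>xs. set_pmf (Q xs) \<subseteq> {1..n}) \<longrightarrow> v \<in> {1..n} \<longrightarrow>
     measure_pmf.prob (adaptive_walk Q v (nat \<lfloor>(1 + \<epsilon>) * real n * ln n\<rfloor>))
       {xs. deficient n (nat \<lceil>\<beta> * ln n\<rceil>) xs} \<le> b n"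
      and n: "max 3 (nat \<lceil>8 / \<kappa>\<rceil>) \<le> n" and p: "C * ln n / n \<le> p" "p \<le> 1" and v: "v \<in> {1..n}"
    define L where "L = nat \<lfloor>(1 + \<epsilon>) * real n * ln n\<rfloor>"
    define m where "m = nat \<lfloor>K * ln n\<rfloor>"
    \<comment> \<open>Small compared with \<open>p\<close>, which is at least \<open>32 / n\<close>,
      yet only polynomially small, so that \<open>Dn n\<close> still absorbs the factor
      \<open>1 / \<theta>\<close> of the posterior bound.\<close>
    define \<theta> where "\<theta> = 1 / (real n)\<^sup>2"
    define a where "a = (1 - \<delta>) * n * p"
    define c where "c = (1 + \<delta>) * n * p"
    let ?P = "\<lambda>xs. deficient n (nat \<lceil>\<beta> * ln n\<rceil>) xs"
    let ?G = "good_history n p v a c m \<theta>"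
    have n3: "3 \<le> n" "8 / \<kappa> \<le> n" using n by (auto simp: real_nat_ceiling_ge intro: order_trans[OF real_nat_ceiling_ge])
    have ln1: "1 \<le> ln (real n)"
    proof -
      have "exp 1 \<le> (3::real)" by (rule exp_le)
      also have "\<dots> \<le> n" using n3 by simp
      finally show ?thesis using n3 by (subst ln_ge_iff) auto
    qed
    have np: "C * ln n \<le> n * p" using p n3 by (simp add: field_simps)
    have "32 * 1 \<le> C * ln n" using C ln1 by (intro mult_mono) auto
    then have np32: "32 \<le> n * p" using np by simp
    then have "0 < real n * p" by linarith
    then have p0: "0 < p" by (rule zero_less_mult_pos) (use n3 in simp)
    have an: "n * p / 2 \<le> a"
      using mult_right_mono[of "1 / 2" "1 - \<delta>" "n * p"] \<delta> p0 by (simp add: a_def mult.assoc)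
    have "16 * K \<le> C * \<kappa>" using C(3) \<kappa> by (simp add: field_simps)
    then have "16 * K * ln n \<le> C * \<kappa> * ln n" using ln1 by (intro mult_right_mono) auto
    also have "\<dots> \<le> \<kappa> * (n * p)" using np \<kappa> by (simp add: mult_ac mult_left_mono)
    finally have "16 * (K * ln n) \<le> \<kappa> * (n * p)" by simp
    moreover have "real m \<le> K * ln n" unfolding m_def using K ln1 by (simp add: of_nat_nat)
    ultimately have "2 * real m \<le> \<kappa> / 4 * (n * p / 2)" by simp
    also have "\<dots> \<le> \<kappa> / 4 * a" using an \<kappa> by (intro mult_left_mono) auto
    finally have ma: "2 * real m \<le> \<kappa> / 4 * a" .
    have c0: "0 < c" using \<delta> p0 n3 by (simp add: c_def)
    have \<theta>0: "0 < \<theta>" using n3 by (simp add: \<theta>_def)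
    have n2: "1 \<le> \<kappa> / 8 * n" using n3 \<kappa> by (simp add: field_simps)
    have \<theta>p: "\<theta> \<le> \<kappa> / 8 * p"
    proof -
      have "1 * 1 \<le> (\<kappa> / 8 * n) * (n * p)" using n2 np32 by (intro mult_mono) auto
      then show ?thesis using n3 by (simp add: \<theta>_def field_simps power2_eq_square)
    qed
    also have "\<dots> \<le> \<kappa> / 8" using p \<kappa> by (simp add: mult_left_le)
    finally have \<theta>1: "\<theta> \<le> \<kappa> / 8" .
    have r: "(1 - \<kappa>) / n \<le> ((1 - \<kappa> / 4) * p * (1 - \<theta>) - \<theta>) / c"
    proof -
      have "(1 - \<kappa>) * (1 + \<delta>) \<le> (1 - \<kappa> / 4) * (1 - \<kappa> / 8) - \<kappa> / 8"
        using \<kappa> by (simp add: \<delta>_def algebra_simps)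
      also have "\<dots> \<le> (1 - \<kappa> / 4) * (1 - \<theta>) - \<kappa> / 8" using \<theta>1 \<kappa> by (intro diff_right_mono mult_left_mono) auto
      finally have "p * ((1 - \<kappa>) * (1 + \<delta>)) \<le> p * ((1 - \<kappa> / 4) * (1 - \<theta>) - \<kappa> / 8)"
        using p0 by (intro mult_left_mono) auto
      also have "\<dots> \<le> (1 - \<kappa> / 4) * p * (1 - \<theta>) - \<theta>" using \<theta>p by (simp add: right_diff_distrib mult_ac)
      finally have "(1 - \<kappa>) / n * c \<le> (1 - \<kappa> / 4) * p * (1 - \<theta>) - \<theta>"
        using n3 by (simp add: c_def mult_ac)
      then show ?thesis using c0 by (simp only: pos_le_divide_eq)
    qed
    have "spread_kernel n ((1 - \<kappa>) / n) (annealed_kernel n p v ?G)"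
    proof (rule annealed_kernel_spread[OF _ p(2) v _ c0 ma _ r])
      show "1 \<le> a" using an np32 by simp
      show "(1 - \<kappa>) / n \<le> 1 / n" using \<kappa> by (intro divide_right_mono) auto
    qed (use p0 \<kappa> in auto)
    then have 1: "measure_pmf.prob (adaptive_walk (annealed_kernel n p v ?G) v L) {xs. ?P xs} \<le> b n"
      using adapt annealed_kernel_range[OF v] v unfolding L_def by blast
    have D: "measure_pmf.prob (gnp n p) {E. \<not> degrees_within n a c E} \<le> Dn n"
      unfolding a_def c_def Dn_def by (rule gnp_fail_le(1)[OF p(2,1) n3(1) \<delta> C(1,2)])
    have ex: "2 * (4607 / 4608) ^ m * (1 / (1 - 1 / n)) ^ L \<le> 2 * (2 * exp (- 3 * ln (real n)))"
      using visits_exponent[OF \<epsilon> n3(1)] unfolding m_def L_def K_def by (simp only: mult.assoc mult_le_cancel_left_pos zero_less_numeral)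
    have "measure_pmf.prob (annealed_walk n p v L) {xs. \<exists>u\<in>{1..n}. m < count_list xs u}
       \<le> (Dn n + ((1 + exp (- 4 * ln n)) ^ n - 1)) + n * (2 * (4607 / 4608) ^ m * (1 / (1 - 1 / n)) ^ L)"
      by (rule order_trans[OF annealed_visits_tail[OF v, where A = "n * p / 2"]])
        (use n3 p0 gnp_fail_le(2)[OF p(2,1) n3(1) \<delta> C(1,2)] in \<open>auto simp: Dn_def\<close>)
    also have "\<dots> \<le> Dn n + ((1 + exp (- 4 * ln n)) ^ n - 1) + n * (2 * (2 * exp (- 3 * ln (real n))))"
      using ex by (intro add_left_mono mult_left_mono) auto
    finally have V: "measure_pmf.prob (annealed_walk n p v L) {xs. \<exists>u\<in>{1..n}. m < count_list xs u}
       \<le> Dn n + ((1 + exp (- 4 * ln n)) ^ n - 1) + n * (2 * (2 * exp (- 3 * ln (real n))))" .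
    have "real L * (measure_pmf.prob (gnp n p) {E. \<not> degrees_within n a c E} / \<theta>) \<le> (1 + \<epsilon>) * n * ln n * (Dn n * (real n)\<^sup>2)"
    proof (rule mult_mono)
      show "real L \<le> (1 + \<epsilon>) * n * ln n" unfolding L_def using \<epsilon> ln1 by (simp add: of_nat_nat)
      show "measure_pmf.prob (gnp n p) {E. \<not> degrees_within n a c E} / \<theta> \<le> Dn n * (real n)\<^sup>2"
        using D n3 by (simp add: \<theta>_def mult_right_mono)
    qed (use \<epsilon> ln1 \<theta>0 in auto)
    then have 2: "measure_pmf.prob (annealed_walk n p v L) {xs. \<exists>i<L. \<not> ?G (take (Suc i) xs)} \<le> B n - b n"
      using good_history_fail[OF v \<theta>0, of p L a c m] V unfolding B_def by linarith
    have "measure_pmf.prob (annealed_walk n p v L) {xs. ?P xs} \<le> B n"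
      using annealed_walk_transfer[OF v, where P = ?P and G = ?G and t = L and p = p] 1 2 by linarith
    then show "measure_pmf.prob (annealed_walk n p v (nat \<lfloor>(1 + \<epsilon>) * real n * ln n\<rfloor>)) {xs. ?P xs} \<le> B n"
      unfolding L_def .
  qed
  then show ?thesis using \<beta> B C(1) by (intro exI[of _ C] conjI exI[of _ \<beta>] exI[of _ B]) auto
qed

theorem theorem1:
  fixes \<epsilon> :: real
  assumes "\<epsilon> > 0"
  shows "\<exists>C>0::real. \<exists>\<beta>>0::real. \<forall>(p :: nat \<Rightarrow> real) (v :: nat \<Rightarrow> nat).
    (\<forall>\<^sub>F n in sequentially. C * ln (real n) / real n \<le> p n \<and> p n \<le> 1 \<and> v n \<in> {1..n}) \<longrightarrow>
    (\<exists>\<delta> :: nat \<Rightarrow> real. \<delta> \<longlonglongrightarrow> 0 \<and>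
      (\<lambda>n. measure_pmf.prob (gnp n (p n))
        {E. measure_pmf.prob (trace_dist E (v n) (nat \<lfloor>(1 + \<epsilon>) * real n * ln (real n)\<rfloor>))
              {\<Gamma>. hamiltonian {1..n} (simple_edges \<Gamma>) \<and>
                  vertex_connected (nat \<lceil>\<beta> * ln (real n)\<rceil>) {1..n} (simple_edges \<Gamma>)}
            \<ge> 1 - \<delta> n}) \<longlonglongrightarrow> 1)"
proof -
  obtain C \<beta> B where C: "0 < C" and \<beta>: "0 < \<beta>" and B: "B \<longlonglongrightarrow> 0"
    and bound: "\<forall>\<^sub>F n in sequentially. \<forall>p v.
     C * ln (real n) / real n \<le> p \<longrightarrow> p \<le> 1 \<longrightarrow> v \<in> {1..n} \<longrightarrow>
     measure_pmf.prob (annealed_walk n p v (nat \<lfloor>(1 + \<epsilon>) * real n * ln (real n)\<rfloor>))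
       {xs. deficient n (nat \<lceil>\<beta> * ln (real n)\<rceil>) xs} \<le> B n"
    using annealed_walk_good[OF assms] by blast
  \<comment> \<open>Markov's inequality at level \<open>\<delta> n\<close> gives
    \<open>\<bar>B n\<bar> / \<delta> n \<le> \<delta> n\<close>, so one sequence serves for the
    graph and for the walk; the summand \<open>1 / real (Suc n)\<close> keeps it positive when
    \<open>B n = 0\<close>.\<close>
  define \<delta> where "\<delta> n = sqrt \<bar>B n\<bar> + 1 / real (Suc n)" for n
  have \<delta>: "\<delta> \<longlonglongrightarrow> 0"
  proof -
    have "(\<lambda>n. sqrt \<bar>B n\<bar>) \<longlonglongrightarrow> sqrt \<bar>0\<bar>" by (intro tendsto_intros B)
    moreover have "(\<lambda>n. 1 / real (Suc n)) \<longlonglongrightarrow> 0" by real_asymp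
    ultimately show ?thesis unfolding \<delta>_def using tendsto_add by fastforce
  qed
  show ?thesis
  proof (rule exI[of _ C], rule conjI[OF C], rule exI[of _ \<beta>], rule conjI[OF \<beta>], intro allI impI)
    fix p :: "nat \<Rightarrow> real" and v :: "nat \<Rightarrow> nat"
    assume pv: "\<forall>\<^sub>F n in sequentially. C * ln (real n) / real n \<le> p n \<and> p n \<le> 1 \<and> v n \<in> {1..n}"
    let ?L = "\<lambda>n. nat \<lfloor>(1 + \<epsilon>) * real n * ln (real n)\<rfloor>"
    let ?good = "\<lambda>n \<Gamma>. hamiltonian {1..n} (simple_edges \<Gamma>) \<and>
                  vertex_connected (nat \<lceil>\<beta> * ln (real n)\<rceil>) {1..n} (simple_edges \<Gamma>)"
    let ?W = "\<lambda>n. {E. measure_pmf.prob (trace_dist E (v n) (?L n)) {\<Gamma>. ?good n \<Gamma>} \<ge> 1 - \<delta> n}"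
    have lower: "\<forall>\<^sub>F n in sequentially. 1 - \<delta> n \<le> measure_pmf.prob (gnp n (p n)) (?W n)"
      using pv bound
    proof eventually_elim
      case (elim n)
      define F where "F E = measure_pmf.prob (random_walk E (v n) (?L n)) {xs. \<not> ?good n (walk_trace xs)}" for E
      have F0: "0 \<le> F E" for E by (simp add: F_def)
      have good: "measure_pmf.prob (trace_dist E (v n) (?L n)) {\<Gamma>. ?good n \<Gamma>} = 1 - F E" for E
      proof -
        have "{xs. ?good n (walk_trace xs)} = UNIV - {xs. \<not> ?good n (walk_trace xs)}" by blast
        then show ?thesis
          unfolding trace_dist_def F_def measure_map_pmf vimage_def
          by (simp add: measure_pmf.prob_compl[where A = "{xs. \<not> ?good n (walk_trace xs)}", simplified])
      qed
      \<comment> \<open>The annealed failure probability is the mean over the graph of the quenched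
        failure probability \<open>F\<close>.\<close>
      have "measure_pmf.expectation (gnp n (p n)) F \<le> B n"
        using elim(1) elim(2)[rule_format, of "p n" "v n"] unfolding annealed_walk_def prob_bind_pmf F_def by simp
      then have EF: "(\<integral>\<^sup>+E. ennreal (F E) \<partial>gnp n (p n)) \<le> ennreal \<bar>B n\<bar>"
        using F0 by (subst nn_integral_eq_integral) (auto intro: ennreal_leI)
      have d0: "0 < \<delta> n" by (simp add: \<delta>_def add_nonneg_pos)
      have "measure_pmf.prob (gnp n (p n)) {E. \<delta> n < F E} \<le> \<bar>B n\<bar> / \<delta> n"
        by (rule pmf_markov[OF EF]) (use d0 in auto)
      also have "\<dots> \<le> \<delta> n"
      proof -
        have "\<bar>B n\<bar> = sqrt \<bar>B n\<bar> * sqrt \<bar>B n\<bar>" by simp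
        also have "\<dots> \<le> \<delta> n * \<delta> n" by (intro mult_mono) (auto simp: \<delta>_def)
        finally show ?thesis using d0 by (simp add: field_simps)
      qed
      finally have "1 - \<delta> n \<le> 1 - measure_pmf.prob (gnp n (p n)) {E. \<delta> n < F E}" by simp
      also have "\<dots> = measure_pmf.prob (gnp n (p n)) (UNIV - {E. \<delta> n < F E})"
        using measure_pmf.prob_compl[of "{E. \<delta> n < F E}" "gnp n (p n)"] by simp
      also have "UNIV - {E. \<delta> n < F E} = ?W n" unfolding good by auto
      finally show ?case .
    qed
    have "(\<lambda>n. measure_pmf.prob (gnp n (p n)) (?W n)) \<longlonglongrightarrow> 1"
    proof (rule tendsto_sandwich[OF lower])
      show "(\<lambda>n. 1 - \<delta> n) \<longlonglongrightarrow> 1" using tendsto_diff[OF tendsto_const[of 1] \<delta>] by simp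
    qed auto
    then show "\<exists>\<delta> :: nat \<Rightarrow> real. \<delta> \<longlonglongrightarrow> 0 \<and>
      (\<lambda>n. measure_pmf.prob (gnp n (p n))
        {E. measure_pmf.prob (trace_dist E (v n) (?L n)) {\<Gamma>. ?good n \<Gamma>} \<ge> 1 - \<delta> n}) \<longlonglongrightarrow> 1"
      using \<delta> by blast
  qed
qed

end
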